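(* Let $p:\mathbb{N}\to(0,1)$ satisfy $p(N)\to0$ and $Np(N)\to\infty$. Fix nonnegative integers $s,d,h$ with $h\ge2$ and $s+d=h$. Let $A\subseteq I_N$ be the random subset in which each element of $I_N$ is included independently with probability $p(N)$. Then: (i) If $p(N)=o\big(N^{-\frac{h-1}{h}}\big)$, then $|A_{s,d}|\sim\dfrac{(Np(N))^h}{s!\,d!}$. (ii) If $p(N)=cN^{-\frac{h-1}{h}}$ for a constant $c>0$, then $$|A_{s,d}|\sim\left(h-2\int_0^{h/2}\exp\Big(-\frac{c^h}{s!d!}\mathsf{IH}_h(x)\Big)dx\right)N,\qquad |A_{s,d}^c|\sim\left(2\int_0^{h/2}\exp\Big(-\frac{c^h}{s!d!}\mathsf{IH}_h(x)\Big)dx\right)N.$$ (iii) If $N^{-\frac{h-1}{h}}=o(p(N))$, then $$|A_{s,d}^c|\sim\frac{2\,\Gamma\!\left(\frac{1}{h-1}\right)\sqrt[h-1]{(h-1)!\,s!\,d!}}{(h-1)\,p(N)^{\frac{h}{h-1}}}.$$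
   Context: $I_N=\{0,1,\dots,N\}$; intervals denote their intersections with $\mathbb{Z}$. For $A\subseteq I_N$, $A_{s,d}=\{a_1+\cdots+a_s-b_1-\cdots-b_d: a_i,b_j\in A\}\subseteq[-dN,sN]$ and $A_{s,d}^c=[-dN,sN]\setminus A_{s,d}$. $\mathsf{IH}_h(x)=\frac{1}{(h-1)!}\sum_{j=0}^h(-1)^j\binom{h}{j}(x-j)_+^{h-1}$ for $x\le h$ and $0$ for $x>h$ (Irwin–Hall density), with $y_+=\max\{0,y\}$. $\Gamma$ is the Gamma function. For a random variable $X=X_N$, $X\sim f(N)$ means: for all $\epsilon_1,\epsilon_2>0$ and all sufficiently large $N$, $\Pr\big(X\notin[(1-\epsilon_1)f(N),(1+\epsilon_1)f(N)]\big)<\epsilon_2$. *)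

theory Defs
  imports "HOL-Probability.Probability" "HOL-Probability.Product_PMF" "HOL-Library.Landau_Symbols"
begin

text \<open>The binomial random subset of \<open>I\<^sub>N = {0, \<dots>, N}\<close>: every element is included independently
  with probability \<open>q\<close>. Sets of integers are used throughout since differences can be negative.\<close>

definition random_subset :: "nat \<Rightarrow> real \<Rightarrow> int set pmf" where
  "random_subset N q =
     map_pmf (\<lambda>f. {k \<in> {0..int N}. f k}) (Pi_pmf {0..int N} False (\<lambda>_. bernoulli_pmf q))"

definition sumdiff_set :: "nat \<Rightarrow> nat \<Rightarrow> int set \<Rightarrow> int set" where
  "sumdiff_set s d A =
     {(\<Sum>i<s. a i) - (\<Sum>j<d. b j) | a b :: nat \<Rightarrow> int. (\<forall>i<s. a i \<in> A) \<and> (\<forall>j<d. b j \<in> A)}"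

definition sumdiff_compl :: "nat \<Rightarrow> nat \<Rightarrow> nat \<Rightarrow> int set \<Rightarrow> int set" where
  "sumdiff_compl s d N A = {- (int d * int N)..int s * int N} - sumdiff_set s d A"

definition irwin_hall :: "nat \<Rightarrow> real \<Rightarrow> real" where
  "irwin_hall h x =
     (if x \<le> real h
      then 1 / fact (h - 1) *
           (\<Sum>j=0..h. (- 1) ^ j * real (h choose j) * (max 0 (x - real j)) ^ (h - 1))
      else 0)"

text \<open>\<open>X\<^sub>N \<sim> f(N)\<close>, where \<open>X\<^sub>N\<close> is a real random variable on the discrete probability space \<open>P\<^sub>N\<close>.\<close>

definition rv_asymp :: "(nat \<Rightarrow> 'a pmf) \<Rightarrow> (nat \<Rightarrow> 'a \<Rightarrow> real) \<Rightarrow> (nat \<Rightarrow> real) \<Rightarrow> bool" where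
  "rv_asymp P X f \<longleftrightarrow>
     (\<forall>\<epsilon>\<^sub>1>0. \<forall>\<epsilon>\<^sub>2>0. \<forall>\<^sub>F N in sequentially.
        measure_pmf.prob (P N) {\<omega>. X N \<omega> \<notin> {(1 - \<epsilon>\<^sub>1) * f N..(1 + \<epsilon>\<^sub>1) * f N}} < \<epsilon>\<^sub>2)"

end

theory Submission
  imports Defs "HOL-Real_Asymp.Real_Asymp"
begin

text \<open>
  Shift a value \<open>k\<close> of \<open>A\<^sub>s\<^sub>,\<^sub>d\<close> to \<open>m = k + d N\<close>, a sum of \<open>h\<close> coordinates in \<open>{0..N}\<close>. Values having only
  representations with a repeated element are negligible. For representations by distinct elements,
  a product lower bound and Janson's inequality pin the probability that \<open>m\<close> is missed to
  \<open>exp (- \<mu>\<^sub>m)\<close>, where \<open>\<mu>\<^sub>m\<close> is the expected number of representations; applied to pairs of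
  values, the same inequality gives the second moment. In the critical regime \<open>\<mu>\<^sub>m\<close> is the
  Irwin--Hall density at \<open>m / N\<close> up to a factor, and the count of missing values becomes a Riemann sum. In the dense
  regime the values are missed only within \<open>O(p\<^sup>-\<^sup>h\<^sup>/\<^sup>(\<^sup>h\<^sup>-\<^sup>1\<^sup>))\<close> of the two edges, where
  \<open>\<mu>\<^sub>m\<close> is a power of \<open>m\<close> and the Riemann sum converges to a Gamma integral. In the sparse regime almost all
  representations have different values, since the expected number of collisions is \<open>o((N p)\<^sup>h)\<close>.
\<close>

section \<open>Expectations over a binomial random subset\<close>

text \<open>Expectations are finite sums over \<open>Pow V\<close>, so every probabilistic
  inequality is an induction on the ground set or on the family of forbidden sets. Let b be the
  number of values in a window at the lower edge and y = b q. A value in it has at most of order y^h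
  / b expected representations, and the Janson overlap is at most of order y^(2h-1) / b^2, smaller
  by the factor y^(h-1) / b. If the mean is bounded, the overlap is O(1/y). Hence one window
  theorem, at a scale T with T^(h-1) p^h bounded, serves the critical regime (T = N) and the dense
  one (T = p^(-h/(h-1))). For this, all counts must be made in boxes of side b, not N. The delicate
  pairs are those of representations on one support that differ by sign flips on a set W of
  positions. They satisfy two independent linear relations unless W is everything, which forces the
  two values to be opposite. Thus the value 0 and pairs of opposite values are left out; they cost
  O(T) in a second moment of order T^2. Only the lower edge is treated; the reflection x -> N - x
  preserves the distribution and carries the result to the upper edge.\<close>

definition subset_expect :: "real \<Rightarrow> 'a set \<Rightarrow> ('a set \<Rightarrow> real) \<Rightarrow> real" where
  "subset_expect q V f = (\<Sum>A\<in>Pow V. q ^ card A * (1 - q) ^ card (V - A) * f A)"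

lemma subset_expect_empty: "subset_expect q {} f = f {}"
  by (simp add: subset_expect_def)

text \<open>Conditioning on whether \<open>v\<close> is chosen: the recursion behind the inductions
  over the ground set.\<close>

lemma subset_expect_insert:
  assumes "finite V" "v \<notin> V"
  shows "subset_expect q (insert v V) f = q * subset_expect q V (\<lambda>A. f (insert v A)) + (1 - q) * subset_expect q V f"
proof -
  have disj: "Pow V \<inter> insert v ` Pow V = {}" using assms by auto
  have inj: "inj_on (insert v) (Pow V)"
    using assms by (auto simp: inj_on_def)
  have c1: "card (insert v A) = Suc (card A)" if "A \<in> Pow V" for A
    using that assms by (subst card_insert_disjoint) (auto intro: finite_subset)
  have c2: "insert v V - insert v A = V - A" if "A \<in> Pow V" for A
    using that assms by auto
  have c3: "card (insert v V - A) = Suc (card (V - A))" if "A \<in> Pow V" for A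
  proof -
    have "insert v V - A = insert v (V - A)" using that assms by auto
    then show ?thesis using assms by simp
  qed
  have "subset_expect q (insert v V) f
      = (\<Sum>A\<in>Pow V. q ^ card A * (1 - q) ^ card (insert v V - A) * f A)
      + (\<Sum>A\<in>Pow V. q ^ card (insert v A) * (1 - q) ^ card (insert v V - insert v A) * f (insert v A))"
    unfolding subset_expect_def Pow_insert using assms disj inj
    by (subst sum.union_disjoint) (auto simp: sum.reindex)
  also have "(\<Sum>A\<in>Pow V. q ^ card A * (1 - q) ^ card (insert v V - A) * f A) = (1 - q) * subset_expect q V f"
    unfolding subset_expect_def sum_distrib_left by (intro sum.cong refl) (simp only: c3, simp)
  also have "(\<Sum>A\<in>Pow V. q ^ card (insert v A) * (1 - q) ^ card (insert v V - insert v A) * f (insert v A))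
      = q * subset_expect q V (\<lambda>A. f (insert v A))"
    unfolding subset_expect_def sum_distrib_left by (intro sum.cong refl) (simp only: c1 c2, simp)
  finally show ?thesis by simp
qed

lemma subset_expect_cong: "(\<And>A. A \<subseteq> V \<Longrightarrow> f A = g A) \<Longrightarrow> subset_expect q V f = subset_expect q V g"
  unfolding subset_expect_def by (intro sum.cong) auto

lemma subset_expect_add: "subset_expect q V (\<lambda>A. f A + g A) = subset_expect q V f + subset_expect q V g"
  by (simp add: subset_expect_def ring_distribs sum.distrib)

lemma subset_expect_diff: "subset_expect q V (\<lambda>A. f A - g A) = subset_expect q V f - subset_expect q V g"
  by (simp add: subset_expect_def ring_distribs sum_subtractf)

lemma subset_expect_cmult: "subset_expect q V (\<lambda>A. c * f A) = c * subset_expect q V f"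
  by (simp add: subset_expect_def sum_distrib_left mult_ac)

lemma subset_expect_sum: "subset_expect q V (\<lambda>A. \<Sum>i\<in>I. f i A) = (\<Sum>i\<in>I. subset_expect q V (f i))"
  unfolding subset_expect_def by (subst sum.swap) (simp add: sum_distrib_left)

lemma subset_expect_mono:
  assumes "0 \<le> q" "q \<le> 1" "\<And>A. A \<subseteq> V \<Longrightarrow> f A \<le> g A"
  shows "subset_expect q V f \<le> subset_expect q V g"
  unfolding subset_expect_def using assms by (intro sum_mono mult_left_mono) auto

lemma subset_expect_const: "finite V \<Longrightarrow> subset_expect q V (\<lambda>_. c) = c"
  by (induction V rule: finite_induct) (auto simp: subset_expect_empty subset_expect_insert algebra_simps)

lemma subset_expect_nonneg:
  assumes "0 \<le> q" "q \<le> 1" "\<And>A. A \<subseteq> V \<Longrightarrow> 0 \<le> f A"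
  shows "0 \<le> subset_expect q V f"
  unfolding subset_expect_def using assms by (intro sum_nonneg mult_nonneg_nonneg) auto

lemma subset_expect_mem:
  assumes "finite V" "v \<in> V"
  shows "subset_expect q V (\<lambda>A. of_bool (v \<in> A) * g A) = q * subset_expect q V (\<lambda>A. g (insert v A))"
proof -
  define W where "W = V - {v}"
  have V: "V = insert v W" and W: "finite W" "v \<notin> W" using assms by (auto simp: W_def)
  have 0: "subset_expect q W (\<lambda>A. of_bool (v \<in> A) * g A) = 0"
    using W by (simp add: subset_expect_def subset_iff) (intro sum.neutral, auto)
  show ?thesis unfolding V subset_expect_insert[OF W]
    by (simp only: 0, simp add: algebra_simps)
qed

text \<open>For increasing events that are unions of \<open>{A. R \<subseteq> A}\<close>, this identity replaces the Harris inequality.\<close>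

lemma subset_expect_subset:
  assumes "finite V" "R \<subseteq> V"
  shows "subset_expect q V (\<lambda>A. of_bool (R \<subseteq> A) * g A) = q ^ card R * subset_expect q V (\<lambda>A. g (A \<union> R))"
proof -
  have "finite R" using assms finite_subset by blast
  then show ?thesis using assms(2)
  proof (induction R arbitrary: g rule: finite_induct)
    case empty
    then show ?case by simp
  next
    case (insert v R)
    have "subset_expect q V (\<lambda>A. of_bool (insert v R \<subseteq> A) * g A)
        = subset_expect q V (\<lambda>A. of_bool (v \<in> A) * (of_bool (R \<subseteq> A) * g A))"
      by (intro subset_expect_cong) auto
    also have "\<dots> = q * subset_expect q V (\<lambda>A. of_bool (R \<subseteq> insert v A) * g (insert v A))"
      using insert.prems assms by (subst subset_expect_mem) auto
    also have "subset_expect q V (\<lambda>A. of_bool (R \<subseteq> insert v A) * g (insert v A))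
       = subset_expect q V (\<lambda>A. of_bool (R \<subseteq> A) * g (insert v A))"
      using insert.hyps by (intro subset_expect_cong) (auto simp: subset_insert)
    also have "\<dots> = q ^ card R * subset_expect q V (\<lambda>A. g (insert v (A \<union> R)))"
      using insert.prems by (subst insert.IH) auto
    finally show ?case using insert.hyps by simp
  qed
qed

lemma subset_expect_subset_prob:
  assumes "finite V" "R \<subseteq> V"
  shows "subset_expect q V (\<lambda>A. of_bool (R \<subseteq> A)) = q ^ card R"
  using subset_expect_subset[OF assms, of q "\<lambda>_. 1"] assms by (simp add: subset_expect_const)

text \<open>Induction over the ground set, one coin at a time: the expectation is affine in the bias
  of the coin, and its slope is nonpositive because \<open>f\<close> decreases when an element is
  added. It permits lowering the density in upper bounds for avoidance.\<close>

lemma subset_expect_antimono_prob: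
  assumes "finite V" "0 \<le> q'" "q' \<le> q" "q \<le> 1"
    and "\<And>A B. A \<subseteq> B \<Longrightarrow> B \<subseteq> V \<Longrightarrow> f B \<le> f A"
  shows "subset_expect q V f \<le> subset_expect q' V f"
  using assms(1,5)
proof (induction V arbitrary: f rule: finite_induct)
  case empty
  then show ?case by (simp add: subset_expect_empty)
next
  case (insert v V)
  have 1: "subset_expect q V (\<lambda>A. f (insert v A)) \<le> subset_expect q' V (\<lambda>A. f (insert v A))"
    by (rule insert.IH, rule insert.prems) auto
  have 2: "subset_expect q V f \<le> subset_expect q' V f"
    by (rule insert.IH, rule insert.prems) auto
  have 3: "subset_expect q' V (\<lambda>A. f (insert v A)) \<le> subset_expect q' V f"
    using assms by (intro subset_expect_mono insert.prems) auto
  have "q * subset_expect q V (\<lambda>A. f (insert v A)) + (1 - q) * subset_expect q V f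
      \<le> q * subset_expect q' V (\<lambda>A. f (insert v A)) + (1 - q) * subset_expect q' V f"
    using 1 2 assms by (intro add_mono mult_left_mono) auto
  also have "\<dots> = subset_expect q' V f - q * (subset_expect q' V f - subset_expect q' V (\<lambda>A. f (insert v A)))"
    by (simp add: algebra_simps)
  also have "\<dots> \<le> subset_expect q' V f - q' * (subset_expect q' V f - subset_expect q' V (\<lambda>A. f (insert v A)))"
    using 3 assms by (intro diff_left_mono mult_right_mono) auto
  also have "\<dots> = q' * subset_expect q' V (\<lambda>A. f (insert v A)) + (1 - q') * subset_expect q' V f"
    by (simp add: algebra_simps)
  finally show ?case using insert.hyps by (simp add: subset_expect_insert)
qed

text \<open>A permutation of the ground set preserves the weights. Needed for the reflection
  \<open>x\<close> to \<open>N - x\<close>.\<close>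

lemma subset_expect_image:
  assumes "finite V" "bij_betw \<phi> V V"
  shows "subset_expect q V (\<lambda>A. f (\<phi> ` A)) = subset_expect q V f"
proof -
  have inj: "inj_on \<phi> V" and im: "\<phi> ` V = V" using assms by (auto simp: bij_betw_def)
  have b: "bij_betw (image \<phi>) (Pow V) (Pow V)"
    by (rule bij_betw_Pow[OF assms(2)])
  have c: "card (\<phi> ` A) = card A" if "A \<in> Pow V" for A
    using that inj by (meson PowD card_image inj_on_subset)
  have d: "V - \<phi> ` A = \<phi> ` (V - A)" if "A \<in> Pow V" for A
    using that inj im by (metis PowD Diff_subset inj_on_image_set_diff)
  have e: "card (V - \<phi> ` A) = card (V - A)" if "A \<in> Pow V" for A
    unfolding d[OF that] using inj by (meson Diff_subset card_image inj_on_subset)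
  show ?thesis unfolding subset_expect_def
    by (subst sum.reindex_bij_betw[OF b, symmetric]) (intro sum.cong refl, simp only: c e)
qed

lemma subset_expect_markov:
  assumes "0 \<le> q" "q \<le> 1" "a > 0" "\<And>A. A \<subseteq> V \<Longrightarrow> 0 \<le> f A"
  shows "subset_expect q V (\<lambda>A. of_bool (f A \<ge> a)) \<le> subset_expect q V f / a"
proof -
  have "subset_expect q V (\<lambda>A. of_bool (f A \<ge> a)) \<le> subset_expect q V (\<lambda>A. (1/a) * f A)"
    using assms by (intro subset_expect_mono) (auto simp: field_simps)
  then show ?thesis by (simp only: subset_expect_cmult) simp
qed

text \<open>The centre \<open>c\<close> is free and need not be the mean. For
  \<open>c \<ge> 0\<close> an upper bound on the second moment and a lower bound on the first then
  suffice.\<close>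

lemma subset_expect_chebyshev:
  assumes "finite V" "0 \<le> q" "q \<le> 1" "a > 0"
  shows "subset_expect q V (\<lambda>A. of_bool (\<bar>f A - c\<bar> > a))
    \<le> (subset_expect q V (\<lambda>A. (f A)\<^sup>2) - 2 * c * subset_expect q V f + c\<^sup>2) / a\<^sup>2"
proof -
  have "subset_expect q V (\<lambda>A. of_bool (\<bar>f A - c\<bar> > a)) \<le> subset_expect q V (\<lambda>A. (1/a\<^sup>2) * ((f A)\<^sup>2 - (2 * c) * f A + c\<^sup>2))"
  proof (intro subset_expect_mono)
    fix A
    have "a\<^sup>2 \<le> (f A - c)\<^sup>2" if "\<bar>f A - c\<bar> > a"
      using that assms by (simp add: abs_le_square_iff[symmetric])
    moreover have "(f A - c)\<^sup>2 = (f A)\<^sup>2 - (2 * c) * f A + c\<^sup>2"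
      by (simp add: power2_eq_square algebra_simps)
    ultimately have "of_bool (\<bar>f A - c\<bar> > a) * a\<^sup>2 \<le> (f A)\<^sup>2 - (2 * c) * f A + c\<^sup>2"
      by (metis mult_1 mult_zero_left of_bool_eq(1,2) zero_le_power2)
    then show "of_bool (\<bar>f A - c\<bar> > a) \<le> (1/a\<^sup>2) * ((f A)\<^sup>2 - (2 * c) * f A + c\<^sup>2)"
      using assms by (simp add: pos_le_divide_eq)
  qed (use assms in auto)
  then show ?thesis using assms
    by (simp only: subset_expect_cmult subset_expect_add subset_expect_diff subset_expect_const) simp
qed

text \<open>Links the probability monad to the weighted sum; both satisfy the recursion that splits
  off one independent coin.\<close>

lemma random_subset_pmf_aux:
  assumes "finite (V :: int set)" "0 \<le> q" "q \<le> 1"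
  shows "measure_pmf.expectation (map_pmf (\<lambda>f. {k \<in> V. f k}) (Pi_pmf V False (\<lambda>_. bernoulli_pmf q))) g
    = subset_expect q V g"
  using assms(1)
proof (induction V arbitrary: g rule: finite_induct)
  case empty
  then show ?case by (simp add: subset_expect_empty)
next
  case (insert v V)
  let ?P = "Pi_pmf V False (\<lambda>_. bernoulli_pmf q)"
  have fin: "finite (set_pmf ?P)"
    by (rule finite_subset[OF set_Pi_pmf_subset'])
       (use insert.hyps in \<open>auto intro!: finite_PiE_dflt\<close>)
  have Pi: "Pi_pmf (insert v V) False (\<lambda>_. bernoulli_pmf q)
     = bind_pmf (bernoulli_pmf q) (\<lambda>y. map_pmf (\<lambda>f. f(v := y)) ?P)"
    using insert.hyps by (subst Pi_pmf_insert) (auto simp: pair_pmf_def map_bind_pmf map_pmf_def bind_assoc_pmf bind_return_pmf)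
  have s: "{k \<in> insert v V. (f(v := True)) k} = insert v {k\<in>V. f k}"
      "{k \<in> insert v V. (f(v := False)) k} = {k\<in>V. f k}" for f
    using insert.hyps by auto
  have "map_pmf (\<lambda>f. {k \<in> insert v V. f k}) (Pi_pmf (insert v V) False (\<lambda>_. bernoulli_pmf q))
    = bind_pmf (bernoulli_pmf q) (\<lambda>y. map_pmf (\<lambda>f. {k \<in> insert v V. (f(v:=y)) k}) ?P)"
    unfolding Pi map_bind_pmf by (simp add: pmf.map_comp o_def)
  also have "measure_pmf.expectation \<dots> g =
     q * measure_pmf.expectation (map_pmf (\<lambda>f. {k \<in> insert v V. (f(v:=True)) k}) ?P) g
    + (1-q) * measure_pmf.expectation (map_pmf (\<lambda>f. {k \<in> insert v V. (f(v:=False)) k}) ?P) g"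
    using assms fin by (subst pmf_expectation_bind[where A = UNIV]) (auto simp: UNIV_bool)
  also have "\<dots> = q * subset_expect q V (\<lambda>A. g (insert v A)) + (1-q) * subset_expect q V g"
    unfolding s insert.IH[symmetric] by simp
  finally show ?case using insert.hyps by (simp add: subset_expect_insert)
qed

lemma prob_random_subset:
  assumes "0 \<le> q" "q \<le> 1"
  shows "measure_pmf.prob (random_subset N q) {A. P A} = subset_expect q {0..int N} (\<lambda>A. of_bool (P A))"
proof -
  have "measure_pmf.prob (random_subset N q) {A. P A}
     = measure_pmf.expectation (random_subset N q) (indicator {A. P A})"
    by simp
  also have "\<dots> = subset_expect q {0..int N} (indicator {A. P A})"
    unfolding random_subset_def by (rule random_subset_pmf_aux) (use assms in auto)
  also have "(indicator {A. P A} :: int set \<Rightarrow> real) = (\<lambda>A. of_bool (P A))"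
    by (auto simp: indicator_def)
  finally show ?thesis .
qed

section \<open>Avoiding a family of sets: product lower bound and Janson's upper bound\<close>

context
  fixes V :: "'a set" and q :: real and R :: "'i \<Rightarrow> 'a set"
  assumes V: "finite V" and q: "0 \<le> q" "q \<le> 1"
begin

text \<open>Adding a set to the family removes the mass \<open>q ^ n\<close> times the avoidance
  probability given that this set is present, and avoidance only gets harder when elements are
  forced in. So each set costs at most a factor \<open>1 - q ^ n\<close>.\<close>

lemma subset_expect_avoid_lower:
  assumes "finite I" "\<And>i. i \<in> I \<Longrightarrow> R i \<subseteq> V" "\<And>i. i \<in> I \<Longrightarrow> card (R i) = n"
  shows "(1 - q ^ n) ^ card I \<le> subset_expect q V (\<lambda>A. of_bool (\<forall>i\<in>I. \<not> R i \<subseteq> A))"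
  using assms
proof (induction I rule: finite_induct)
  case empty
  then show ?case using V by (simp add: subset_expect_const)
next
  case (insert i I)
  let ?F = "\<lambda>A. of_bool (\<forall>i\<in>I. \<not> R i \<subseteq> A) :: real"
  have Ri: "R i \<subseteq> V" "card (R i) = n" using insert.prems by auto
  have "subset_expect q V (\<lambda>A. of_bool (\<forall>i\<in>insert i I. \<not> R i \<subseteq> A))
     = subset_expect q V (\<lambda>A. ?F A - of_bool (R i \<subseteq> A) * ?F A)"
    by (intro subset_expect_cong) auto
  also have "\<dots> = subset_expect q V ?F - q ^ n * subset_expect q V (\<lambda>A. ?F (A \<union> R i))"
    using Ri V by (simp only: subset_expect_diff subset_expect_subset)
  also have "\<dots> \<ge> subset_expect q V ?F - q ^ n * subset_expect q V ?F"
    using q Ri by (intro diff_left_mono mult_left_mono subset_expect_mono) auto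
  finally have "subset_expect q V (\<lambda>A. of_bool (\<forall>i\<in>insert i I. \<not> R i \<subseteq> A)) \<ge> (1 - q ^ n) * subset_expect q V ?F"
    by (simp add: algebra_simps)
  moreover have "(1 - q ^ n) * (1 - q ^ n) ^ card I \<le> (1 - q ^ n) * subset_expect q V ?F"
    using insert q by (intro mult_left_mono) (auto simp: power_le_one)
  ultimately show ?case using insert.hyps by simp
qed

text \<open>Induction over the family. For a new set \<open>R i\<close>, avoidance of the sets
  disjoint from it is independent of \<open>R i \<subseteq> A\<close>, and the sets meeting it are
  handled by a union bound. The exponent sums over ordered pairs, twice what the induction produces,
  which is harmless here.\<close>

lemma janson_inequality:
  assumes "finite I" "\<And>i. i \<in> I \<Longrightarrow> R i \<subseteq> V"
  shows "subset_expect q V (\<lambda>A. of_bool (\<forall>i\<in>I. \<not> R i \<subseteq> A))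
    \<le> exp (- (\<Sum>i\<in>I. q ^ card (R i))
        + (\<Sum>i\<in>I. \<Sum>j\<in>{j\<in>I. j \<noteq> i \<and> R i \<inter> R j \<noteq> {}}. q ^ card (R i \<union> R j)))"
  using assms
proof (induction I rule: finite_induct)
  case empty
  then show ?case using V by (simp add: subset_expect_const)
next
  case (insert i I)
  let ?J = "{j\<in>I. R i \<inter> R j \<noteq> {}}"
  let ?F = "\<lambda>A. of_bool (\<forall>i\<in>I. \<not> R i \<subseteq> A) :: real"
  let ?D = "\<lambda>A. of_bool (\<forall>j\<in>I-?J. \<not> R j \<subseteq> A) :: real"
  let ?S = "\<Sum>j\<in>?J. q ^ card (R i \<union> R j)"
  have Ri: "R i \<subseteq> V" using insert.prems by auto
  have finJ: "finite ?J" using insert.hyps by auto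
  have iI: "i \<notin> I" using insert.hyps by auto
  have Dpos: "0 \<le> subset_expect q V ?D" "0 \<le> subset_expect q V ?F" using q by (auto intro!: subset_expect_nonneg)
  have FD: "subset_expect q V ?F \<le> subset_expect q V ?D" using q by (intro subset_expect_mono) auto
  have indep: "subset_expect q V (\<lambda>A. ?D (A \<union> R i)) = subset_expect q V ?D"
  proof (intro subset_expect_cong arg_cong[where f = of_bool] ball_cong refl)
    fix A j assume "j \<in> I - ?J"
    then have "R i \<inter> R j = {}" by auto
    then show "(\<not> R j \<subseteq> A \<union> R i) = (\<not> R j \<subseteq> A)" by blast
  qed
  \<comment> \<open>Pointwise union bound: if \<open>R i\<close> is present and all sets disjoint
    from it are avoided, then the whole family is avoided or some set meeting \<open>R i\<close> is
    also present.\<close>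
  have "?D A * of_bool (R i \<subseteq> A) - (\<Sum>j\<in>?J. of_bool (R i \<union> R j \<subseteq> A) * ?D A) \<le> of_bool (R i \<subseteq> A) * ?F A" for A
  proof (cases "R i \<subseteq> A \<and> (\<forall>j\<in>I-?J. \<not> R j \<subseteq> A)")
    case True
    show ?thesis
    proof (cases "\<exists>j\<in>?J. R j \<subseteq> A")
      case T: True
      then obtain j where j: "j \<in> ?J" "R j \<subseteq> A" by blast
      have "(\<Sum>j\<in>{j}. of_bool (R i \<union> R j \<subseteq> A) * ?D A) \<le> (\<Sum>j\<in>?J. of_bool (R i \<union> R j \<subseteq> A) * ?D A)"
        using j finJ by (intro sum_mono2) auto
      then have "1 \<le> (\<Sum>j\<in>?J. of_bool (R i \<union> R j \<subseteq> A) * ?D A)"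
        using True j by simp
      moreover have "?D A * of_bool (R i \<subseteq> A) \<le> 1" "0 \<le> of_bool (R i \<subseteq> A) * ?F A" by auto
      ultimately show ?thesis by linarith
    next
      case F: False
      then have "?F A = 1" using True by auto
      moreover have "(\<Sum>j\<in>?J. of_bool (R i \<union> R j \<subseteq> A) * ?D A) \<ge> 0" by (intro sum_nonneg) auto
      ultimately show ?thesis using True by simp
    qed
  next
    case False
    then have "?D A * of_bool (R i \<subseteq> A) = 0" by auto
    moreover have "(\<Sum>j\<in>?J. of_bool (R i \<union> R j \<subseteq> A) * ?D A) \<ge> 0" by (intro sum_nonneg) auto
    moreover have "0 \<le> of_bool (R i \<subseteq> A) * ?F A" by simp
    ultimately show ?thesis by linarith
  qed
  then have "subset_expect q V (\<lambda>A. of_bool (R i \<subseteq> A) * ?F A)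
     \<ge> subset_expect q V (\<lambda>A. of_bool (R i \<subseteq> A) * ?D A - (\<Sum>j\<in>?J. of_bool (R i \<union> R j \<subseteq> A) * ?D A))"
    using q by (intro subset_expect_mono) (auto simp: mult.commute)
  also have "subset_expect q V (\<lambda>A. of_bool (R i \<subseteq> A) * ?D A - (\<Sum>j\<in>?J. of_bool (R i \<union> R j \<subseteq> A) * ?D A))
     = q ^ card (R i) * subset_expect q V ?D - (\<Sum>j\<in>?J. q ^ card (R i \<union> R j) * subset_expect q V (\<lambda>A. ?D (A \<union> (R i \<union> R j))))"
  proof -
    have "subset_expect q V (\<lambda>A. of_bool (R i \<union> R j \<subseteq> A) * ?D A) = q ^ card (R i \<union> R j) * subset_expect q V (\<lambda>A. ?D (A \<union> (R i \<union> R j)))"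
      if "j \<in> ?J" for j
      using that insert.prems V by (intro subset_expect_subset) auto
    moreover have "subset_expect q V (\<lambda>A. of_bool (R i \<subseteq> A) * ?D A) = q ^ card (R i) * subset_expect q V ?D"
      by (subst subset_expect_subset[OF V Ri]) (simp only: indep)
    ultimately show ?thesis
      by (simp only: subset_expect_diff subset_expect_sum cong: sum.cong)
  qed
  \<comment> \<open>\<open>?D\<close> is decreasing, so forcing \<open>R i \<union> R j\<close> into
    the set can only lower its expectation.\<close>
  also have "\<dots> \<ge> q ^ card (R i) * subset_expect q V ?D - (\<Sum>j\<in>?J. q ^ card (R i \<union> R j) * subset_expect q V ?D)"
    using q Ri insert.prems by (intro diff_left_mono sum_mono mult_left_mono subset_expect_mono) auto
  finally have *: "subset_expect q V (\<lambda>A. of_bool (R i \<subseteq> A) * ?F A) \<ge> subset_expect q V ?D * (q ^ card (R i) - ?S)"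
    by (simp add: algebra_simps sum_distrib_left sum_distrib_right)
  \<comment> \<open>Passing from \<open>?D\<close> to the smaller \<open>?F\<close> keeps the bound
    if the bracket is nonnegative; if it is negative, the right-hand side is at most 0 and nothing
    is to be shown.\<close>
  have **: "subset_expect q V (\<lambda>A. of_bool (R i \<subseteq> A) * ?F A) \<ge> subset_expect q V ?F * (q ^ card (R i) - ?S)"
  proof (cases "q ^ card (R i) - ?S \<ge> 0")
    case True
    then show ?thesis using * FD by (meson mult_right_mono order_trans)
  next
    case False
    then have "subset_expect q V ?F * (q ^ card (R i) - ?S) \<le> 0" using Dpos by (simp add: mult_nonneg_nonpos)
    also have "0 \<le> subset_expect q V (\<lambda>A. of_bool (R i \<subseteq> A) * ?F A)" using q by (intro subset_expect_nonneg) auto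
    finally show ?thesis .
  qed
  have "subset_expect q V (\<lambda>A. of_bool (\<forall>i\<in>insert i I. \<not> R i \<subseteq> A))
     = subset_expect q V (\<lambda>A. ?F A - of_bool (R i \<subseteq> A) * ?F A)"
    by (intro subset_expect_cong) auto
  also have "\<dots> \<le> subset_expect q V ?F * (1 + (- (q ^ card (R i)) + ?S))"
    using ** by (simp add: subset_expect_diff algebra_simps)
  also have "\<dots> \<le> subset_expect q V ?F * exp (- (q ^ card (R i)) + ?S)"
    using Dpos by (intro mult_left_mono exp_ge_add_one_self)
  also have "\<dots> \<le> exp (- (\<Sum>i\<in>I. q ^ card (R i))
        + (\<Sum>i\<in>I. \<Sum>j\<in>{j\<in>I. j \<noteq> i \<and> R i \<inter> R j \<noteq> {}}. q ^ card (R i \<union> R j))) * exp (- (q ^ card (R i)) + ?S)"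
    using insert by (intro mult_right_mono insert.IH) auto
  also have "\<dots> \<le> exp (- (\<Sum>i\<in>insert i I. q ^ card (R i))
        + (\<Sum>k\<in>insert i I. \<Sum>j\<in>{j\<in>insert i I. j \<noteq> k \<and> R k \<inter> R j \<noteq> {}}. q ^ card (R k \<union> R j)))"
  proof -
    have eqJ: "{j\<in>insert i I. j \<noteq> i \<and> R i \<inter> R j \<noteq> {}} = ?J" using iI by auto
    have "(\<Sum>i\<in>I. \<Sum>j\<in>{j\<in>I. j \<noteq> i \<and> R i \<inter> R j \<noteq> {}}. q ^ card (R i \<union> R j))
      \<le> (\<Sum>k\<in>I. \<Sum>j\<in>{j\<in>insert i I. j \<noteq> k \<and> R k \<inter> R j \<noteq> {}}. q ^ card (R k \<union> R j))"
      using insert.hyps q by (intro sum_mono sum_mono2) auto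
    then show ?thesis
      unfolding exp_add[symmetric] sum.insert[OF insert.hyps(1) iI] eqJ by simp
  qed
  finally show ?case .
qed

end

section \<open>Signed sums of tuples\<close>

text \<open>Restriction to the coordinates outside \<open>J\<close> is injective on
  \<open>X\<close>. Every count of tuples under linear constraints below comes from this.\<close>

lemma card_PiE_determined:
  assumes "finite I" "\<And>i. i \<in> I \<Longrightarrow> finite (S i)" "J \<subseteq> I" "X \<subseteq> PiE I S"
    and "\<And>f g i. f \<in> X \<Longrightarrow> g \<in> X \<Longrightarrow> (\<And>i. i \<in> I - J \<Longrightarrow> f i = g i) \<Longrightarrow> i \<in> J \<Longrightarrow> f i = g i"
  shows "card X \<le> (\<Prod>i\<in>I-J. card (S i))"
proof -
  have inj: "inj_on (\<lambda>f. restrict f (I - J)) X"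
  proof (rule inj_onI)
    fix f g assume fg: "f \<in> X" "g \<in> X" "restrict f (I - J) = restrict g (I - J)"
    have 1: "f i = g i" if "i \<in> I - J" for i
      using fg(3) that by (metis restrict_apply')
    have "f i = g i" if "i \<in> I" for i
      using 1 assms(5)[OF fg(1,2) 1] that by blast
    then show "f = g" using fg assms(4) by (intro PiE_ext[of f I S g]) auto
  qed
  have "card X \<le> card (PiE (I - J) S)"
    using assms by (intro card_inj_on_le[OF inj] finite_PiE) (auto simp: PiE_def Pi_def)
  then show ?thesis using assms by (simp add: card_PiE)
qed

lemma sum_lessThan_add: "(\<Sum>i<s+d. g i) = (\<Sum>i<s. g i) + (\<Sum>j<d. g (s + j :: nat) :: 'a :: comm_monoid_add)"
  by (induction d) (simp_all add: add.assoc)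

locale sumdiff_params =
  fixes s d h :: nat
  assumes h_eq: "s + d = h" and h2: "2 \<le> h"
begin

definition sgn_at :: "nat \<Rightarrow> int" where "sgn_at i = (if i < s then 1 else -1)"

definition signed_sum :: "(nat \<Rightarrow> int) \<Rightarrow> int" where "signed_sum f = (\<Sum>i<h. sgn_at i * f i)"

text \<open>Forgets the order of the summands within each sign class. On injective tuples the fibres
  have \<open>s! d!\<close> elements, the origin of that factor in the theorem.\<close>

definition blocks :: "(nat \<Rightarrow> int) \<Rightarrow> int set \<times> int set" where
  "blocks f = (f ` {..<s}, f ` {s..<h})"

definition supp :: "int set \<times> int set \<Rightarrow> int set" where "supp \<rho> = fst \<rho> \<union> snd \<rho>"

definition inj_tuples :: "nat \<Rightarrow> (nat \<Rightarrow> int) set" where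
  "inj_tuples N = {f \<in> {..<h} \<rightarrow>\<^sub>E {0..int N}. inj_on f {..<h}}"

definition inj_reps :: "nat \<Rightarrow> int \<Rightarrow> (nat \<Rightarrow> int) set" where
  "inj_reps N k = {f \<in> inj_tuples N. signed_sum f = k}"

definition reps :: "nat \<Rightarrow> int \<Rightarrow> (nat \<Rightarrow> int) set" where
  "reps N k = {f \<in> {..<h} \<rightarrow>\<^sub>E {0..int N}. signed_sum f = k}"

definition rep_pairs :: "nat \<Rightarrow> int \<Rightarrow> (int set \<times> int set) set" where
  "rep_pairs N k = blocks ` inj_reps N k"

text \<open>The region that holds all representations of a value within \<open>B\<close> of the
  lower edge \<open>- d N\<close>: small entries with sign plus, entries near \<open>N\<close> with
  sign minus.\<close>

definition box :: "nat \<Rightarrow> nat \<Rightarrow> nat \<Rightarrow> int set" where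
  "box N B i = (if i < s then {0..int B} else {int N - int B..int N})"

lemma sgn_at_sq [simp]: "sgn_at i * sgn_at i = 1" "sgn_at i \<noteq> 0" "sgn_at i * (sgn_at i * x) = x"
  by (auto simp: sgn_at_def)

lemma signed_sum_split: "signed_sum f = (\<Sum>i<s. f i) - (\<Sum>j<d. f (s + j))"
  using sum_lessThan_add[of "\<lambda>i. sgn_at i * f i" s d] unfolding h_eq signed_sum_def by (simp add: sgn_at_def sum_negf)

lemma lessThan_h: "{..<h} = {..<s} \<union> {s..<h}" using h_eq by auto

lemma sumdiff_set_iff: "k \<in> sumdiff_set s d A \<longleftrightarrow> (\<exists>f \<in> {..<h} \<rightarrow>\<^sub>E A. signed_sum f = k)"
proof
  assume "k \<in> sumdiff_set s d A"
  then obtain a b where ab: "k = (\<Sum>i<s. a i) - (\<Sum>j<d. b j)" "\<forall>i<s. a i \<in> A" "\<forall>j<d. b j \<in> A"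
    by (auto simp: sumdiff_set_def)
  let ?f = "\<lambda>i\<in>{..<h}. if i < s then a i else b (i - s)"
  have "?f \<in> {..<h} \<rightarrow>\<^sub>E A" using ab h_eq by auto
  moreover have "signed_sum ?f = k" unfolding signed_sum_split using h_eq ab by simp
  ultimately show "\<exists>f \<in> {..<h} \<rightarrow>\<^sub>E A. signed_sum f = k" by blast
next
  assume "\<exists>f \<in> {..<h} \<rightarrow>\<^sub>E A. signed_sum f = k"
  then obtain f where f: "f \<in> {..<h} \<rightarrow>\<^sub>E A" "signed_sum f = k" by blast
  have "f i \<in> A" if "i < h" for i using f(1) that by auto
  then have "\<forall>i<s. f i \<in> A" "\<forall>j<d. f (s + j) \<in> A" using h_eq by simp_all
  with f(2) show "k \<in> sumdiff_set s d A"
    unfolding sumdiff_set_def signed_sum_split by blast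
qed

lemma signed_sum_diff:
  assumes "J \<subseteq> {..<h}" "\<And>i. i \<in> {..<h} - J \<Longrightarrow> f i = g i"
  shows "signed_sum f - signed_sum g = (\<Sum>i\<in>J. sgn_at i * (f i - g i))"
proof -
  have "signed_sum f - signed_sum g = (\<Sum>i<h. sgn_at i * (f i - g i))"
    by (simp add: signed_sum_def sum_subtractf ring_distribs)
  also have "\<dots> = (\<Sum>i\<in>J. sgn_at i * (f i - g i))"
    using assms by (intro sum.mono_neutral_right) auto
  finally show ?thesis .
qed

lemma finite_box [simp]: "finite (box N B i)" by (simp add: box_def)
lemma card_box [simp]: "card (box N B i) = Suc B" by (simp add: box_def)

text \<open>After replacing the entries of negative sign by \<open>N - f i\<close>, all summands are
  nonnegative and add up to \<open>k + d N\<close>, so each is at most \<open>B\<close>.\<close>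

lemma reps_subset_box:
  assumes "k + int d * int N \<le> int B"
  shows "reps N k \<subseteq> PiE {..<h} (box N B)"
proof
  fix f assume f: "f \<in> reps N k"
  then have fE: "f \<in> {..<h} \<rightarrow>\<^sub>E {0..int N}" and fv: "signed_sum f = k" by (simp_all add: reps_def)
  have fb: "f i \<in> {0..int N}" if "i < h" for i using PiE_mem[OF fE] that by simp
  let ?x = "\<lambda>i. if i < s then f i else int N - f i"
  have x0: "0 \<le> ?x i" if "i < h" for i using fb[OF that] by auto
  have "(\<Sum>i<h. ?x i) = (\<Sum>i<s. f i) + (\<Sum>j<d. int N - f (s + j))"
    using sum_lessThan_add[of ?x s d] unfolding h_eq by simp
  also have "\<dots> = signed_sum f + int d * int N"
    unfolding signed_sum_split by (simp add: sum_subtractf)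
  also have "\<dots> \<le> int B" using fv assms by simp
  finally have tot: "(\<Sum>i<h. ?x i) \<le> int B" .
  have xB: "?x i \<le> int B" if "i < h" for i
    using order.trans[OF member_le_sum[of i "{..<h}" ?x] tot] x0 that by simp
  have "f i \<in> box N B i" if "i < h" for i
    using xB[OF that] fb[OF that] by (auto simp: box_def split: if_splits)
  then show "f \<in> PiE {..<h} (box N B)" using fE by (simp add: PiE_iff)
qed

lemma inj_reps_subset_reps: "inj_reps N k \<subseteq> reps N k" by (auto simp: inj_reps_def inj_tuples_def reps_def)

lemma finite_reps [simp]: "finite (reps N k)"
  unfolding reps_def by (rule finite_subset[OF _ finite_PiE[of "{..<h}" "\<lambda>_. {0..int N}"]]) auto

lemma finite_inj_tuples [simp]: "finite (inj_tuples N)"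
  unfolding inj_tuples_def by (rule finite_subset[OF _ finite_PiE[of "{..<h}" "\<lambda>_. {0..int N}"]]) auto

lemma finite_inj_reps [simp]: "finite (inj_reps N k)" by (simp add: inj_reps_def)

lemma finite_rep_pairs [simp]: "finite (rep_pairs N k)" by (simp add: rep_pairs_def)

lemma supp_blocks: "supp (blocks f) = f ` {..<h}"
  unfolding supp_def blocks_def lessThan_h by auto

lemma card_prod_box: "J \<subseteq> {..<h} \<Longrightarrow> (\<Prod>i\<in>{..<h} - J. card (box N B i)) = Suc B ^ (h - card J)"
  by (simp add: card_Diff_subset finite_subset[of J "{..<h}"])

text \<open>One linear relation on a nonempty set of positions determines one coordinate by the
  others.\<close>

lemma card_linear:
  assumes "X \<subseteq> PiE {..<h} (box N B)" "\<And>f. f \<in> X \<Longrightarrow> (\<Sum>i\<in>W. sgn_at i * f i) = k" "W \<subseteq> {..<h}" "W \<noteq> {}"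
  shows "card X \<le> Suc B ^ (h - 1)"
proof -
  obtain w where w: "w \<in> W" using assms by auto
  have finW: "finite W" using assms finite_subset by blast
  have "card X \<le> (\<Prod>i\<in>{..<h} - {w}. card (box N B i))"
  proof (rule card_PiE_determined)
    fix f g i assume fg: "f \<in> X" "g \<in> X" and eq: "\<And>i. i \<in> {..<h} - {w} \<Longrightarrow> f i = g i" and i: "i \<in> {w}"
    have "(\<Sum>i\<in>W-{w}. sgn_at i * f i) = (\<Sum>i\<in>W-{w}. sgn_at i * g i)"
      using eq assms(3) by (intro sum.cong) auto
    moreover have "(\<Sum>i\<in>W. sgn_at i * f i) = (\<Sum>i\<in>W. sgn_at i * g i)" using assms(2) fg by simp
    ultimately have "sgn_at w * f w = sgn_at w * g w" using finW w by (simp add: sum.remove)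
    then show "f i = g i" using i by simp
  qed (use assms w in auto)
  then show ?thesis using w assms(3) by (subst (asm) card_prod_box) auto
qed

text \<open>The relations on \<open>W\<close> and on its complement determine one coordinate each;
  this is why both sets must be nonempty.\<close>

lemma card_two_linear:
  assumes "X \<subseteq> PiE {..<h} (box N B)" "\<And>f. f \<in> X \<Longrightarrow> (\<Sum>i\<in>W. sgn_at i * f i) = k"
    "\<And>f. f \<in> X \<Longrightarrow> (\<Sum>i\<in>{..<h}-W. sgn_at i * f i) = l" "W \<subseteq> {..<h}" "W \<noteq> {}" "W \<noteq> {..<h}"
  shows "card X \<le> Suc B ^ (h - 2)"
proof -
  obtain w u where w: "w \<in> W" and u: "u \<in> {..<h} - W" using assms by auto
  have wu: "w \<noteq> u" "w < h" "u < h" using w u assms(4) by auto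
  have finW: "finite W" using assms finite_subset by blast
  have "card X \<le> (\<Prod>i\<in>{..<h} - {w, u}. card (box N B i))"
  proof (rule card_PiE_determined)
    fix f g i assume fg: "f \<in> X" "g \<in> X" and eq: "\<And>i. i \<in> {..<h} - {w,u} \<Longrightarrow> f i = g i" and i: "i \<in> {w,u}"
    have "(\<Sum>i\<in>W-{w}. sgn_at i * f i) = (\<Sum>i\<in>W-{w}. sgn_at i * g i)"
      using eq assms(4) u by (intro sum.cong) auto
    moreover have "(\<Sum>i\<in>W. sgn_at i * f i) = (\<Sum>i\<in>W. sgn_at i * g i)" using assms(2) fg by simp
    ultimately have 1: "sgn_at w * f w = sgn_at w * g w" using finW w by (simp add: sum.remove)
    have "(\<Sum>i\<in>({..<h}-W)-{u}. sgn_at i * f i) = (\<Sum>i\<in>({..<h}-W)-{u}. sgn_at i * g i)"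
      using eq w by (intro sum.cong) auto
    moreover have "(\<Sum>i\<in>{..<h}-W. sgn_at i * f i) = (\<Sum>i\<in>{..<h}-W. sgn_at i * g i)" using assms(3) fg by simp
    ultimately have 2: "sgn_at u * f u = sgn_at u * g u" using u by (simp add: sum.remove)
    from 1 2 show "f i = g i" using i by auto
  qed (use assms w u in auto)
  then show ?thesis using wu by (subst (asm) card_prod_box) (auto simp: numeral_2_eq_2)
qed

text \<open>Let \<open>f i = f j\<close>. With equal signs, the value determines the common entry.
  With opposite signs the two entries cancel, so the value determines some third entry and
  \<open>f j\<close> follows from \<open>f i\<close>. In both cases two coordinates are
  determined.\<close>

lemma card_noninj:
  assumes "k \<noteq> 0"
  shows "card {f \<in> PiE {..<h} (box N B). signed_sum f = k \<and> \<not> inj_on f {..<h}} \<le> h\<^sup>2 * Suc B ^ (h - 2)"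
proof -
  let ?X = "\<lambda>(i,j). {f \<in> PiE {..<h} (box N B). signed_sum f = k \<and> f i = f j}"
  let ?P = "{(i,j). i < h \<and> j < h \<and> i \<noteq> j}"
  have finP: "finite ?P" by (rule finite_subset[of _ "{..<h} \<times> {..<h}"]) auto
  have cardP: "card ?P \<le> h\<^sup>2"
    using card_mono[of "{..<h} \<times> {..<h}" ?P] by (force simp: power2_eq_square card_cartesian_product)
  have fin: "finite (?X p)" for p
    by (cases p) (auto intro: finite_subset[OF _ finite_PiE[of "{..<h}" "box N B"]])
  have "card {f \<in> PiE {..<h} (box N B). signed_sum f = k \<and> \<not> inj_on f {..<h}} \<le> card (\<Union>p\<in>?P. ?X p)"
    using finP fin by (intro card_mono finite_UN_I) (auto simp: inj_on_def)
  also have "\<dots> \<le> (\<Sum>p\<in>?P. card (?X p))" using finP by (rule card_UN_le)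
  also have "\<dots> \<le> (\<Sum>p\<in>?P. Suc B ^ (h - 2))"
  proof (intro sum_mono)
    fix p assume "p \<in> ?P"
    then obtain i j where p: "p = (i,j)" and ij: "i < h" "j < h" "i \<noteq> j" by auto
    show "card (?X p) \<le> Suc B ^ (h - 2)"
    proof (cases "sgn_at i = sgn_at j")
      case True
      have "card (?X p) \<le> (\<Prod>i\<in>{..<h} - {i,j}. card (box N B i))"
      proof (rule card_PiE_determined)
        fix f g v assume fg: "f \<in> ?X p" "g \<in> ?X p" and eq: "\<And>v. v \<in> {..<h} - {i,j} \<Longrightarrow> f v = g v" and v: "v \<in> {i,j}"
        have "signed_sum f - signed_sum g = (\<Sum>v\<in>{i,j}. sgn_at v * (f v - g v))"
          using ij eq by (intro signed_sum_diff) auto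
        then have "0 = sgn_at i * (2 * (f i - g i))" using fg ij True by (simp add: p algebra_simps)
        then have "f i = g i" by simp
        moreover have "f i = f j" "g i = g j" using fg by (simp_all add: p)
        ultimately show "f v = g v" using v by (elim insertE) simp_all
      qed (use p ij in auto)
      then show ?thesis using ij by (subst (asm) card_prod_box) (simp_all add: numeral_2_eq_2)
    next
      case False
      then have sgij: "sgn_at i + sgn_at j = 0" by (auto simp: sgn_at_def split: if_splits)
      show ?thesis
      proof (cases "\<exists>u<h. u \<noteq> i \<and> u \<noteq> j")
        case True
        then obtain u where u: "u < h" "u \<noteq> i" "u \<noteq> j" by auto
        have "card (?X p) \<le> (\<Prod>i\<in>{..<h} - {u,j}. card (box N B i))"
        proof (rule card_PiE_determined)
          fix f g v assume fg: "f \<in> ?X p" "g \<in> ?X p" and eq: "\<And>v. v \<in> {..<h} - {u,j} \<Longrightarrow> f v = g v" and v: "v \<in> {u,j}"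
          have "f i = g i" using eq ij u by auto
          then have j: "f j = g j" using fg by (auto simp: p)
          have "signed_sum f - signed_sum g = (\<Sum>v\<in>{u,j}. sgn_at v * (f v - g v))"
            using ij u eq by (intro signed_sum_diff) auto
          then have "0 = sgn_at u * (f u - g u)" using fg u j by (simp add: p)
          then have "f u = g u" by simp
          then show "f v = g v" using v j by (elim insertE) simp_all
        qed (use p ij u in auto)
        then show ?thesis using ij u by (subst (asm) card_prod_box) (simp_all add: numeral_2_eq_2)
      next
        case False
        \<comment> \<open>No third coordinate: this is the difference set \<open>A - A\<close>,
          where equal entries give the value 0 in \<open>B + 1\<close> ways. Hence the hypothesis
          \<open>k \<noteq> 0\<close>.\<close>
        then have hs: "{..<h} = {i,j}" using ij by auto
        have "signed_sum f = 0" if "f i = f j" for f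
          unfolding signed_sum_def hs using ij sgij that by (simp add: distrib_right[symmetric])
        then have "?X p = {}" using assms by (auto simp: p)
        then show ?thesis by simp
      qed
    qed
  qed
  also have "\<dots> \<le> h\<^sup>2 * Suc B ^ (h - 2)" using cardP by (simp add: mult_right_mono)
  finally show ?thesis .
qed

lemma card_inj_funcset: "finite A \<Longrightarrow> finite S \<Longrightarrow> card S = card A \<Longrightarrow> card {f \<in> A \<rightarrow>\<^sub>E S. inj_on f A} = fact (card A)"
  using card_inj_on_subset_funcset[of A S A] by (simp add: fact_prod_rev)

text \<open>A tuple with given blocks is a pair of bijections, from the positive positions onto one
  block and from the negative positions onto the other.\<close>

lemma card_fiber:
  assumes "f0 \<in> inj_tuples N"
  shows "card {f \<in> inj_tuples N. blocks f = blocks f0} = fact s * fact d"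
proof -
  define S D where "S = f0 ` {..<s}" and "D = f0 ` {s..<h}"
  have inj0: "inj_on f0 {..<h}" and r0: "f0 ` {..<h} \<subseteq> {0..int N}" using assms by (auto simp: inj_tuples_def)
  have ij: "inj_on f0 {..<s}" "inj_on f0 {s..<h}" using h_eq by (auto intro: inj_on_subset[OF inj0])
  have S: "finite S" "card S = s" unfolding S_def using ij by (simp_all add: card_image)
  have D: "finite D" "card D = d" unfolding D_def using ij h_eq by (auto simp add: card_image)
  have SD: "S \<inter> D = {}"
  proof -
    have "f0 ` ({..<s} \<inter> {s..<h}) = S \<inter> D" unfolding S_def D_def
      by (rule inj_on_image_Int[OF inj0]) (use h_eq in auto)
    then show ?thesis by auto
  qed
  have SDN: "S \<subseteq> {0..int N}" "D \<subseteq> {0..int N}" using r0 unfolding S_def D_def lessThan_h by auto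
  let ?G = "{g \<in> {..<s} \<rightarrow>\<^sub>E S. inj_on g {..<s}}" and ?H = "{g \<in> {s..<h} \<rightarrow>\<^sub>E D. inj_on g {s..<h}}"
  have "bij_betw (\<lambda>f. (restrict f {..<s}, restrict f {s..<h})) {f \<in> inj_tuples N. blocks f = (S,D)} (?G \<times> ?H)"
  proof (rule bij_betw_byWitness[where f' = "\<lambda>(g,g') i. if i < s then g i else g' i"])
    show "\<forall>f\<in>{f \<in> inj_tuples N. blocks f = (S,D)}. (case (restrict f {..<s}, restrict f {s..<h}) of (g,g') \<Rightarrow> \<lambda>i. if i < s then g i else g' i) = f"
      using h_eq by (auto simp: inj_tuples_def fun_eq_iff PiE_iff extensional_def)
    show "\<forall>a'\<in>?G \<times> ?H. (restrict (case a' of (g,g') \<Rightarrow> \<lambda>i. if i < s then g i else g' i) {..<s}, restrict (case a' of (g,g') \<Rightarrow> \<lambda>i. if i < s then g i else g' i) {s..<h}) = a'"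
      by (auto simp: fun_eq_iff PiE_iff extensional_def)
    show "(\<lambda>f. (restrict f {..<s}, restrict f {s..<h})) ` {f \<in> inj_tuples N. blocks f = (S,D)} \<subseteq> ?G \<times> ?H"
      using h_eq by (auto simp: inj_tuples_def blocks_def inj_on_def)
    show "(\<lambda>(g,g') i. if i < s then g i else g' i) ` (?G \<times> ?H) \<subseteq> {f \<in> inj_tuples N. blocks f = (S,D)}"
    proof clarify
      fix g g' assume g: "g \<in> {..<s} \<rightarrow>\<^sub>E S" "inj_on g {..<s}" and g': "g' \<in> {s..<h} \<rightarrow>\<^sub>E D" "inj_on g' {s..<h}"
      let ?f = "\<lambda>i. if i < s then g i else g' i"
      have "g ` {..<s} = S" using g S by (intro card_subset_eq) (auto simp: card_image)
      moreover have "g' ` {s..<h} = D" using g' D h_eq by (intro card_subset_eq) (auto simp: card_image)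
      ultimately have c: "blocks ?f = (S, D)" unfolding blocks_def by auto
      have "?f i \<in> {0..int N}" if "i < h" for i
        using PiE_mem[OF g(1), of i] PiE_mem[OF g'(1), of i] that SDN by (simp add: subset_iff)
      moreover have "?f i = undefined" if "\<not> i < h" for i using that g'(1) h_eq by (auto simp: PiE_iff extensional_def)
      ultimately have r: "?f \<in> {..<h} \<rightarrow>\<^sub>E {0..int N}" by (auto simp: PiE_iff extensional_def)
      have "i = j" if "i < h" "j < h" "?f i = ?f j" for i j
      proof -
        have 1: "g i \<in> S" if "i < s" for i using PiE_mem[OF g(1)] that by simp
        have 2: "g' i \<in> D" if "s \<le> i" "i < h" for i using PiE_mem[OF g'(1)] that by simp
        show ?thesis using that SD g(2) g'(2) 1[of i] 1[of j] 2[of i] 2[of j]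
          by (cases "i < s"; cases "j < s") (auto simp: inj_on_def)
      qed
      then have "inj_on ?f {..<h}" by (auto simp: inj_on_def)
      with r c show "?f \<in> inj_tuples N \<and> blocks ?f = (S, D)" by (simp add: inj_tuples_def)
    qed
  qed
  then have "card {f \<in> inj_tuples N. blocks f = (S,D)} = card (?G \<times> ?H)" by (rule bij_betw_same_card)
  also have "\<dots> = fact s * fact d"
  proof -
    have "h - s = d" using h_eq by simp
    then show ?thesis using S D by (simp add: card_cartesian_product card_inj_funcset)
  qed
  finally show ?thesis by (simp add: blocks_def S_def D_def)
qed

lemma signed_sum_blocks: "inj_on f {..<h} \<Longrightarrow> signed_sum f = \<Sum> (fst (blocks f)) - \<Sum> (snd (blocks f))"
proof -
  assume inj: "inj_on f {..<h}"
  have "inj_on f {..<s}" "inj_on f {s..<h}" using h_eq by (auto intro!: inj_on_subset[OF inj])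
  then have "\<Sum> (fst (blocks f)) - \<Sum> (snd (blocks f)) = (\<Sum>i<s. f i) - (\<Sum>i\<in>{s..<h}. f i)"
    by (simp add: blocks_def sum.reindex)
  also have "(\<Sum>i\<in>{s..<h}. f i) = (\<Sum>j<d. f (s + j))"
    using sum.shift_bounds_nat_ivl[of f 0 s d] h_eq by (simp add: lessThan_atLeast0 add.commute)
  finally show ?thesis by (simp add: signed_sum_split)
qed

text \<open>\<open>closed\<close> says that \<open>F\<close> is a union of complete fibres of
  \<open>blocks\<close>, all of which have the same size.\<close>

lemma card_blocks_image:
  assumes "F \<subseteq> inj_tuples N" and closed: "\<And>f g. f \<in> F \<Longrightarrow> g \<in> inj_tuples N \<Longrightarrow> blocks g = blocks f \<Longrightarrow> g \<in> F"
  shows "card F = fact s * fact d * card (blocks ` F)"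
proof -
  have "finite F" using assms(1) finite_subset finite_inj_tuples by blast
  then have "card F = (\<Sum>\<rho>\<in>blocks ` F. card {f \<in> F. blocks f = \<rho>})"
    using sum.image_gen[of F "\<lambda>_. 1::nat" blocks] by simp
  also have "\<dots> = (\<Sum>\<rho>\<in>blocks ` F. fact s * fact d)"
  proof (rule sum.cong[OF refl])
    fix \<rho> assume "\<rho> \<in> blocks ` F"
    then obtain f0 where f0: "f0 \<in> F" "\<rho> = blocks f0" by auto
    have "{f \<in> F. blocks f = \<rho>} = {f \<in> inj_tuples N. blocks f = blocks f0}"
      using f0 assms(1) closed[OF f0(1)] by blast
    then show "card {f \<in> F. blocks f = \<rho>} = fact s * fact d"
      using card_fiber[of f0 N] f0(1) assms(1) by auto
  qed
  finally show ?thesis by simp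
qed

lemma card_inj_reps: "card (inj_reps N k) = fact s * fact d * card (rep_pairs N k)"
  unfolding rep_pairs_def
proof (rule card_blocks_image[where N = N])
  fix f g assume "f \<in> inj_reps N k" "g \<in> inj_tuples N" "blocks g = blocks f"
  then show "g \<in> inj_reps N k" using signed_sum_blocks[of f] signed_sum_blocks[of g] by (simp add: inj_reps_def inj_tuples_def)
qed (simp add: inj_reps_def)

lemma card_reps_le_inj_reps:
  assumes "k \<noteq> 0" "k + int d * int N \<le> int B"
  shows "card (reps N k) \<le> card (inj_reps N k) + h\<^sup>2 * Suc B ^ (h - 2)"
proof -
  let ?Y = "{f \<in> PiE {..<h} (box N B). signed_sum f = k \<and> \<not> inj_on f {..<h}}"
  have finY: "finite ?Y" by (rule finite_subset[OF _ finite_PiE[of "{..<h}" "box N B"]]) auto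
  have "reps N k \<subseteq> inj_reps N k \<union> ?Y"
    using reps_subset_box[OF assms(2)] by (auto simp: reps_def inj_reps_def inj_tuples_def)
  then have "card (reps N k) \<le> card (inj_reps N k \<union> ?Y)" using finY by (intro card_mono) auto
  also have "\<dots> \<le> card (inj_reps N k) + card ?Y" by (rule card_Un_le)
  finally show ?thesis using card_noninj[OF assms(1), of N B] by linarith
qed

lemma card_rep_pairs_le:
  assumes "inj_reps N k \<subseteq> PiE {..<h} (box N B)"
  shows "card (rep_pairs N k) \<le> Suc B ^ (h - 1)"
proof -
  have "card (rep_pairs N k) \<le> card (inj_reps N k)" unfolding rep_pairs_def by (rule card_image_le) simp
  also have "\<dots> \<le> Suc B ^ (h - 1)"
    by (rule card_linear[where W = "{..<h}" and k = k and N = N, OF assms])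
       (use h2 in \<open>auto simp: inj_reps_def signed_sum_def lessThan_empty_iff\<close>)
  finally show ?thesis .
qed

text \<open>The positions outside \<open>J\<close> take one of at most \<open>h\<close> values each,
  giving \<open>h ^ h\<close>; those in \<open>J\<close> range over the box, but the value of the
  sum determines one of them.\<close>

lemma card_new_positions:
  assumes "finite R" "card R \<le> h" "J \<subseteq> {..<h}" "J \<noteq> {}"
  shows "card {f \<in> PiE {..<h} (box N B). signed_sum f = l \<and> {i\<in>{..<h}. f i \<notin> R} = J} \<le> h ^ h * Suc B ^ (card J - 1)"
proof -
  obtain j where j: "j \<in> J" using assms by auto
  let ?X = "{f \<in> PiE {..<h} (box N B). signed_sum f = l \<and> {i\<in>{..<h}. f i \<notin> R} = J}"
  let ?S = "\<lambda>i. if i \<in> J then box N B i else R"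
  have finJ: "finite J" using assms finite_subset by blast
  have "card ?X \<le> (\<Prod>i\<in>{..<h}-{j}. card (?S i))"
  proof (rule card_PiE_determined)
    fix f g v assume fg: "f \<in> ?X" "g \<in> ?X" and eq: "\<And>v. v \<in> {..<h} - {j} \<Longrightarrow> f v = g v" and v: "v \<in> {j}"
    have "signed_sum f - signed_sum g = (\<Sum>v\<in>{j}. sgn_at v * (f v - g v))"
      using j assms(3) eq by (intro signed_sum_diff) auto
    then show "f v = g v" using fg v by simp
  next
    show "?X \<subseteq> PiE {..<h} ?S"
    proof
      fix f assume f: "f \<in> ?X"
      then have fE: "f \<in> PiE {..<h} (box N B)" by simp
      have fJ: "{i\<in>{..<h}. f i \<notin> R} = J" using f by simp
      have "f i \<in> ?S i" if "i < h" for i using PiE_mem[OF fE, of i] that by (simp flip: fJ)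
      then show "f \<in> PiE {..<h} ?S" using fE by (simp add: PiE_iff)
    qed
  qed (use assms j in auto)
  also have "\<dots> = (\<Prod>i\<in>{..<h}-{j}. if i \<in> J then Suc B else card R)"
    by (intro prod.cong) auto
  also have "\<dots> = Suc B ^ card (({..<h}-{j}) \<inter> J) * card R ^ card (({..<h}-{j}) \<inter> -J)"
    by (subst prod.If_cases) auto
  also have "({..<h}-{j}) \<inter> J = J - {j}" using assms by auto
  also have "card (J - {j}) = card J - 1" using j finJ by simp
  also have "Suc B ^ (card J - 1) * card R ^ card (({..<h}-{j}) \<inter> -J) \<le> Suc B ^ (card J - 1) * h ^ h"
  proof (rule mult_left_mono)
    have "card (({..<h}-{j}) \<inter> -J) \<le> card {..<h}" by (intro card_mono) auto
    then show "card R ^ card (({..<h}-{j}) \<inter> -J) \<le> h ^ h"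
      using order.trans[OF power_mono[OF assms(2)] power_increasing[of _ h h]] h2 by simp
  qed auto
  finally show ?thesis by (simp add: mult.commute)
qed

text \<open>\<open>W\<close> consists of the positions whose element carries the opposite sign in
  \<open>f'\<close>. Flipping these signs turns the value of \<open>f\<close> into that of
  \<open>f'\<close>; adding and subtracting the two values isolates the sums over the complement of
  \<open>W\<close> and over \<open>W\<close>.\<close>

lemma flipped_positions:
  assumes "inj_on f {..<h}" "inj_on f' {..<h}" "f ` {..<h} = f' ` {..<h}" "blocks f \<noteq> blocks f'"
  shows "\<exists>W\<subseteq>{..<h}. W \<noteq> {} \<and> 2 * (\<Sum>i\<in>W. sgn_at i * f i) = signed_sum f - signed_sum f'
           \<and> 2 * (\<Sum>i\<in>{..<h}-W. sgn_at i * f i) = signed_sum f + signed_sum f'"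
proof -
  \<comment> \<open>The sign that the element \<open>x\<close> carries in \<open>f'\<close>; an
    element of the common support lies in exactly one block of \<open>f'\<close>.\<close>
  define \<sigma> where "\<sigma> x = (if x \<in> f' ` {..<s} then 1 else -1 :: int)" for x
  define W where "W = {i\<in>{..<h}. \<sigma> (f i) \<noteq> sgn_at i}"
  have s': "\<sigma> (f' i) = sgn_at i" if "i < h" for i
  proof (cases "i < s")
    case False
    have "f' i \<noteq> f' j" if "j < s" for j using inj_onD[OF assms(2), of i j] False that \<open>i < h\<close> h_eq by auto
    then show ?thesis using False by (auto simp: \<sigma>_def sgn_at_def)
  qed (auto simp: \<sigma>_def sgn_at_def)
  have "signed_sum f' = (\<Sum>i<h. \<sigma> (f' i) * f' i)" unfolding signed_sum_def using s' by (intro sum.cong) auto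
  also have "\<dots> = (\<Sum>x\<in>f' ` {..<h}. \<sigma> x * x)" using assms(2) by (simp add: sum.reindex)
  also have "\<dots> = (\<Sum>i<h. \<sigma> (f i) * f i)" using assms(1) by (simp add: sum.reindex flip: assms(3))
  also have "\<dots> = (\<Sum>i\<in>{..<h}-W. \<sigma> (f i) * f i) + (\<Sum>i\<in>W. \<sigma> (f i) * f i)"
    by (rule sum.subset_diff) (auto simp: W_def)
  also have "(\<Sum>i\<in>{..<h}-W. \<sigma> (f i) * f i) = (\<Sum>i\<in>{..<h}-W. sgn_at i * f i)"
    by (intro sum.cong) (auto simp: W_def)
  also have "(\<Sum>i\<in>W. \<sigma> (f i) * f i) = (\<Sum>i\<in>W. - (sgn_at i * f i))"
    by (intro sum.cong) (auto simp: W_def \<sigma>_def sgn_at_def)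
  finally have 1: "signed_sum f' = (\<Sum>i\<in>{..<h}-W. sgn_at i * f i) - (\<Sum>i\<in>W. sgn_at i * f i)"
    by (simp add: sum_negf)
  have 2: "signed_sum f = (\<Sum>i\<in>{..<h}-W. sgn_at i * f i) + (\<Sum>i\<in>W. sgn_at i * f i)"
    unfolding signed_sum_def by (rule sum.subset_diff) (auto simp: W_def)
  have "W \<noteq> {}"
  proof
    \<comment> \<open>If no element changes sign, the first block of \<open>f\<close> lies in that
      of \<open>f'\<close> and the second is disjoint from it; as the unions agree, the blocks
      coincide.\<close>
    assume "W = {}"
    have "f' ` ({..<s} \<inter> {s..<h}) = f' ` {..<s} \<inter> f' ` {s..<h}" "f ` ({..<s} \<inter> {s..<h}) = f ` {..<s} \<inter> f ` {s..<h}"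
      using h_eq by (auto intro!: inj_on_image_Int[OF assms(1)] inj_on_image_Int[OF assms(2)])
    then have dj: "f' ` {..<s} \<inter> f' ` {s..<h} = {}" "f ` {..<s} \<inter> f ` {s..<h} = {}" by auto
    have un: "f ` {..<s} \<union> f ` {s..<h} = f' ` {..<s} \<union> f' ` {s..<h}"
      using assms(3) by (simp add: lessThan_h image_Un)
    have e: "\<sigma> (f i) = sgn_at i" if "i < h" for i using that \<open>W = {}\<close> by (auto simp: W_def)
    have s1: "f i \<in> f' ` {..<s}" if "i < s" for i
      using e[of i] that h_eq by (auto simp: \<sigma>_def sgn_at_def split: if_splits)
    have s2: "f i \<notin> f' ` {..<s}" if "s \<le> i" "i < h" for i
      using e[of i] that h_eq by (auto simp: \<sigma>_def sgn_at_def split: if_splits)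
    have i1: "f ` {..<s} \<subseteq> f' ` {..<s}" by (rule image_subsetI, rule s1) simp
    have i2: "f ` {s..<h} \<inter> f' ` {..<s} = {}"
    proof (intro equals0I, elim IntE)
      fix x assume "x \<in> f ` {s..<h}" and x: "x \<in> f' ` {..<s}"
      from \<open>x \<in> f ` {s..<h}\<close> obtain i where "x = f i" "i \<in> {s..<h}" by (rule imageE)
      then show False using s2[of i] x by simp
    qed
    have sets: "a = b \<and> c = e" if "a \<subseteq> b" "c \<inter> b = {}" "b \<inter> e = {}" "a \<union> c = b \<union> e" for a b c e :: "int set"
      using that by blast
    have "blocks f = blocks f'" unfolding blocks_def using sets[OF i1 i2 dj(1) un] by simp
    then show False using assms(4) by simp
  qed
  then show ?thesis using 1 2 by (intro exI[of _ W]) (auto simp: W_def)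
qed

end

section \<open>Overlapping representations\<close>

lemma sum_add_of_bool:
  assumes "finite S"
  shows "(\<Sum>x\<in>S. K + of_bool (P x) * a * b) = real (card S) * K + real (card {x\<in>S. P x}) * (a * b)"
proof -
  have "(\<Sum>x\<in>S. K + of_bool (P x) * a * b) = real (card S) * K + (\<Sum>x\<in>S. of_bool (P x)) * (a * b)"
    by (simp only: sum.distrib sum_distrib_right mult.assoc) simp
  then show ?thesis using assms by (simp add: sum_of_bool_eq Int_def)
qed

context sumdiff_params
begin

definition pair_value :: "int set \<times> int set \<Rightarrow> int" where "pair_value \<rho> = \<Sum> (fst \<rho>) - \<Sum> (snd \<rho>)"

definition new_positions :: "int set \<Rightarrow> (nat \<Rightarrow> int) \<Rightarrow> nat set" where
  "new_positions R f = {i\<in>{..<h}. f i \<notin> R}"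

text \<open>The correction term of Janson's inequality; the mixed case of two values is needed for
  second moments.\<close>

definition overlap :: "nat \<Rightarrow> real \<Rightarrow> int \<Rightarrow> int \<Rightarrow> real" where
  "overlap N q k l = (\<Sum>\<rho>\<in>rep_pairs N k. \<Sum>\<rho>'\<in>{\<rho>'\<in>rep_pairs N l. \<rho>' \<noteq> \<rho> \<and> supp \<rho> \<inter> supp \<rho>' \<noteq> {}}. q ^ card (supp \<rho> \<union> supp \<rho>'))"

lemma new_positions_sub: "new_positions R f \<subseteq> {..<h}" by (auto simp: new_positions_def)

lemma finite_new_positions [simp]: "finite (new_positions R f)" using new_positions_sub finite_subset by blast

lemma card_Un_new_positions:
  assumes "finite R" "inj_on f {..<h}"
  shows "card (R \<union> f ` {..<h}) = card R + card (new_positions R f)"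
proof -
  have "R \<union> f ` {..<h} = R \<union> f ` new_positions R f" by (auto simp: new_positions_def)
  moreover have "R \<inter> f ` new_positions R f = {}" by (auto simp: new_positions_def)
  moreover have "card (f ` new_positions R f) = card (new_positions R f)"
    using assms(2) new_positions_sub by (meson card_image inj_on_subset)
  ultimately show ?thesis using assms(1) by (simp add: card_Un_disjoint)
qed

lemma inj_tuplesD: "f \<in> inj_tuples N \<Longrightarrow> inj_on f {..<h}" "f \<in> inj_tuples N \<Longrightarrow> f ` {..<h} \<subseteq> {0..int N}"
  "f \<in> inj_tuples N \<Longrightarrow> card (f ` {..<h}) = h"
  by (auto simp: inj_tuples_def card_image)

lemma inj_repsD: "f \<in> inj_reps N k \<Longrightarrow> f \<in> inj_tuples N" "f \<in> inj_reps N k \<Longrightarrow> signed_sum f = k"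
  by (auto simp: inj_reps_def)

lemma pair_value_blocks: "f \<in> inj_tuples N \<Longrightarrow> pair_value (blocks f) = signed_sum f"
  using signed_sum_blocks inj_tuplesD(1) by (simp add: pair_value_def)

text \<open>Group the tuples by the set \<open>J\<close> of positions with elements outside
  \<open>R\<close>. With \<open>y = (B + 1) q\<close>, each nonempty \<open>J\<close> contributes at
  most \<open>h ^ h * q ^ h * y ^ card J / (B + 1)\<close>; as \<open>y \<ge> 1\<close>, the
  exponent may be raised to \<open>e\<close>. There are at most \<open>2 ^ h\<close> sets
  \<open>J\<close>.\<close>

lemma weighted_new_positions:
  fixes q :: real
  assumes R: "finite R" "card R = h" and q: "0 \<le> q" and y: "1 \<le> real (Suc B) * q"
    and X: "X \<subseteq> PiE {..<h} (box N B)" "\<And>f. f \<in> X \<Longrightarrow> inj_on f {..<h} \<and> signed_sum f = l \<and> new_positions R f \<noteq> {} \<and> card (new_positions R f) \<le> e"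
  shows "(\<Sum>f\<in>X. q ^ card (R \<union> f ` {..<h})) \<le> 2 ^ h * real h ^ h * q ^ h * (real (Suc B) * q) ^ e / real (Suc B)"
proof -
  let ?y = "real (Suc B) * q"
  have finX: "finite X" by (rule finite_subset[OF X(1)]) (auto intro!: finite_PiE)
  let ?P = "Pow {..<h}"
  have "(\<Sum>f\<in>X. q ^ card (R \<union> f ` {..<h})) = (\<Sum>f\<in>X. q ^ (h + card (new_positions R f)))"
    using X(2) R by (intro sum.cong) (auto simp: card_Un_new_positions)
  also have "\<dots> = (\<Sum>J\<in>?P. \<Sum>f\<in>{f\<in>X. new_positions R f = J}. q ^ (h + card (new_positions R f)))"
    using finX new_positions_sub by (intro sum.group[symmetric]) auto
  also have "\<dots> \<le> (\<Sum>J\<in>?P. real h ^ h * q ^ h * ?y ^ e / real (Suc B))"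
  proof (intro sum_mono)
    fix J assume J: "J \<in> ?P"
    show "(\<Sum>f\<in>{f\<in>X. new_positions R f = J}. q ^ (h + card (new_positions R f))) \<le> real h ^ h * q ^ h * ?y ^ e / real (Suc B)"
    proof (cases "{f\<in>X. new_positions R f = J} = {}")
      case True
      then show ?thesis unfolding True using q by simp
    next
      case False
      then have Je: "J \<noteq> {}" "card J \<le> e" using X(2) by auto
      have J1: "1 \<le> card J" using Je(1) J finite_subset[of J "{..<h}"] by (simp add: Suc_leI card_gt_0_iff)
      have "(\<Sum>f\<in>{f\<in>X. new_positions R f = J}. q ^ (h + card (new_positions R f))) = real (card {f\<in>X. new_positions R f = J}) * q ^ (h + card J)"
        by simp
      also have "\<dots> \<le> real (h ^ h * Suc B ^ (card J - 1)) * q ^ (h + card J)"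
      proof (intro mult_right_mono of_nat_mono)
        have "card {f\<in>X. new_positions R f = J} \<le> card {f \<in> PiE {..<h} (box N B). signed_sum f = l \<and> {i\<in>{..<h}. f i \<notin> R} = J}"
          using X by (intro card_mono finite_subset[OF _ finite_PiE[of "{..<h}" "box N B"]]) (auto simp: new_positions_def)
        also have "\<dots> \<le> h ^ h * Suc B ^ (card J - 1)"
          using R J Je by (intro card_new_positions) auto
        finally show "card {f\<in>X. new_positions R f = J} \<le> h ^ h * Suc B ^ (card J - 1)" .
      qed (use q in auto)
      also have "\<dots> = real h ^ h * q ^ h * ?y ^ card J / real (Suc B)"
      proof -
        have "real (Suc B) ^ card J = real (Suc B) * real (Suc B) ^ (card J - 1)"
          using J1 by (simp flip: power_Suc)
        then show ?thesis by (simp add: power_mult_distrib power_add del: of_nat_Suc)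
      qed
      also have "\<dots> \<le> real h ^ h * q ^ h * ?y ^ e / real (Suc B)"
        using y q Je by (intro divide_right_mono mult_left_mono power_increasing) auto
      finally show ?thesis .
    qed
  qed
  also have "\<dots> = 2 ^ h * real h ^ h * q ^ h * ?y ^ e / real (Suc B)"
    by (simp add: card_Pow)
  finally show ?thesis .
qed

lemma card_le_flip_patterns:
  assumes X: "\<And>f. f \<in> X \<Longrightarrow> \<exists>W\<subseteq>{..<h}. W \<noteq> {} \<and> f \<in> Y W"
    and Y: "\<And>W. W \<subseteq> {..<h} \<Longrightarrow> W \<noteq> {} \<Longrightarrow> finite (Y W) \<and> card (Y W) \<le> c"
  shows "card X \<le> 2 ^ h * c"
proof -
  let ?P = "Pow {..<h} - {{}}"
  have "X \<subseteq> (\<Union>W\<in>?P. Y W)" using X by blast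
  then have "card X \<le> card (\<Union>W\<in>?P. Y W)" using Y by (intro card_mono finite_UN_I) auto
  also have "\<dots> \<le> (\<Sum>W\<in>?P. card (Y W))" by (intro card_UN_le) auto
  also have "\<dots> \<le> (\<Sum>W\<in>?P. c)" using Y by (intro sum_mono) auto
  also have "\<dots> \<le> 2 ^ h * c"
  proof -
    have "card ?P \<le> card (Pow {..<h})" by (intro card_mono) auto
    then show ?thesis by (simp add: card_Pow mult_right_mono)
  qed
  finally show ?thesis .
qed

text \<open>The flipped positions satisfy one linear relation and their complement another, which
  saves two powers of the box size.\<close>

lemma card_flipped:
  assumes "inj_reps N k \<subseteq> PiE {..<h} (box N B)" "k + l \<noteq> 0"
  shows "card {f\<in>inj_reps N k. \<exists>f'\<in>inj_reps N l. f ` {..<h} = f' ` {..<h} \<and> blocks f \<noteq> blocks f'} \<le> 2 ^ h * Suc B ^ (h - 2)"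
proof (rule card_le_flip_patterns)
  let ?Y = "\<lambda>W. {f\<in>PiE {..<h} (box N B). 2 * (\<Sum>i\<in>W. sgn_at i * f i) = k - l \<and> 2 * (\<Sum>i\<in>{..<h}-W. sgn_at i * f i) = k + l}"
  fix W :: "nat set" assume W: "W \<subseteq> {..<h}" "W \<noteq> {}"
  have fin: "finite (?Y W)" by (rule finite_subset[OF _ finite_PiE[of "{..<h}" "box N B"]]) auto
  show "finite (?Y W) \<and> card (?Y W) \<le> Suc B ^ (h - 2)"
  proof (cases "W = {..<h}")
    case True
    \<comment> \<open>All signs flipped: the relation on the empty complement reads
      \<open>0 = k + l\<close>.\<close>
    then have "?Y W = {}" using assms(2) by auto
    then show ?thesis by (simp only: card.empty finite.emptyI le0 simp_thms)
  next
    case False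
    have "card (?Y W) \<le> Suc B ^ (h - 2)"
      by (rule card_two_linear[where W = W and k = "(k-l) div 2" and l = "(k+l) div 2" and N = N]) (use W False in auto)
    then show ?thesis using fin by blast
  qed
next
  fix f assume "f \<in> {f\<in>inj_reps N k. \<exists>f'\<in>inj_reps N l. f ` {..<h} = f' ` {..<h} \<and> blocks f \<noteq> blocks f'}"
  then obtain f' where f: "f \<in> inj_reps N k" and f': "f' \<in> inj_reps N l" and eq: "f ` {..<h} = f' ` {..<h}" "blocks f \<noteq> blocks f'" by auto
  show "\<exists>W\<subseteq>{..<h}. W \<noteq> {} \<and> f \<in> {f\<in>PiE {..<h} (box N B). 2 * (\<Sum>i\<in>W. sgn_at i * f i) = k - l \<and> 2 * (\<Sum>i\<in>{..<h}-W. sgn_at i * f i) = k + l}"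
    using flipped_positions[OF inj_tuplesD(1)[OF inj_repsD(1)[OF f]] inj_tuplesD(1)[OF inj_repsD(1)[OF f']] eq] f assms(1)
    unfolding inj_repsD(2)[OF f] inj_repsD(2)[OF f'] by blast
qed

text \<open>The common value is not prescribed here, so only the relation on \<open>W\<close>
  remains and one power is saved.\<close>

lemma card_flipped_same_value:
  "card {f\<in>inj_tuples N. \<exists>f'\<in>inj_tuples N. f ` {..<h} = f' ` {..<h} \<and> blocks f \<noteq> blocks f' \<and> signed_sum f = signed_sum f'} \<le> 2 ^ h * Suc N ^ (h - 1)"
proof (rule card_le_flip_patterns)
  let ?Y = "\<lambda>W. {f\<in>PiE {..<h} (box N N). 2 * (\<Sum>i\<in>W. sgn_at i * f i) = 0}"
  fix W :: "nat set" assume W: "W \<subseteq> {..<h}" "W \<noteq> {}"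
  have "finite (?Y W)" by (rule finite_subset[OF _ finite_PiE[of "{..<h}" "box N N"]]) auto
  moreover have "card (?Y W) \<le> Suc N ^ (h - 1)"
    by (rule card_linear[where W = W and k = 0 and N = N]) (use W in auto)
  ultimately show "finite (?Y W) \<and> card (?Y W) \<le> Suc N ^ (h - 1)" ..
next
  fix f assume "f \<in> {f\<in>inj_tuples N. \<exists>f'\<in>inj_tuples N. f ` {..<h} = f' ` {..<h} \<and> blocks f \<noteq> blocks f' \<and> signed_sum f = signed_sum f'}"
  then obtain f' where f: "f \<in> inj_tuples N" and f': "f' \<in> inj_tuples N" and eq: "f ` {..<h} = f' ` {..<h}" "blocks f \<noteq> blocks f'"
    and v: "signed_sum f = signed_sum f'" by auto
  have "f \<in> PiE {..<h} (box N N)" using f by (auto simp: inj_tuples_def box_def PiE_iff)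
  then show "\<exists>W\<subseteq>{..<h}. W \<noteq> {} \<and> f \<in> {f\<in>PiE {..<h} (box N N). 2 * (\<Sum>i\<in>W. sgn_at i * f i) = 0}"
    using flipped_positions[OF inj_tuplesD(1)[OF f] inj_tuplesD(1)[OF f'] eq] unfolding v by auto
qed

lemma card_same_supp:
  assumes "finite R" "card R = h"
  shows "card {\<rho> \<in> rep_pairs N l. supp \<rho> = R} \<le> 4 ^ h"
proof -
  have "card {\<rho> \<in> rep_pairs N l. supp \<rho> = R} \<le> card (Pow R \<times> Pow R)"
    using assms by (intro card_mono) (auto simp: supp_def)
  also have "\<dots> = 4 ^ h" using assms by (simp add: card_cartesian_product card_Pow flip: power_mult_distrib)
  finally show ?thesis .
qed

lemma rep_pairs_supp:
  assumes "\<rho> \<in> rep_pairs N k"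
  shows "finite (supp \<rho>)" "card (supp \<rho>) = h" "supp \<rho> \<subseteq> {0..int N}" "pair_value \<rho> = k"
proof -
  obtain f where f: "f \<in> inj_reps N k" "\<rho> = blocks f" using assms by (auto simp: rep_pairs_def)
  show "finite (supp \<rho>)" "card (supp \<rho>) = h" "supp \<rho> \<subseteq> {0..int N}" "pair_value \<rho> = k"
    using inj_tuplesD[OF inj_repsD(1)[OF f(1)]] inj_repsD(2)[OF f(1)] inj_repsD(1)[OF f(1)] f(2) by (simp_all add: supp_blocks pair_value_blocks)
qed

text \<open>A support different from \<open>R\<close>, but of the same size, has at least one new
  element. It has at most \<open>h\<close> new ones, and at most \<open>h - 1\<close> if it meets
  \<open>R\<close>; the two choices of \<open>e\<close> serve collisions and overlaps
  respectively.\<close>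

lemma sum_new_supp:
  fixes q :: real
  assumes \<rho>: "finite R" "card R = h" and q: "0 \<le> q" and y: "1 \<le> real (Suc B) * q"
    and box: "inj_reps N l \<subseteq> PiE {..<h} (box N B)"
    and Y: "Y \<subseteq> {\<rho>'\<in>rep_pairs N l. supp \<rho>' \<noteq> R}" 
    and e: "e \<ge> h \<or> e = h - 1 \<and> (\<forall>\<rho>'\<in>Y. R \<inter> supp \<rho>' \<noteq> {})"
  shows "(\<Sum>\<rho>'\<in>Y. q ^ card (R \<union> supp \<rho>')) \<le> 2 ^ h * real h ^ h * q ^ h * (real (Suc B) * q) ^ e / real (Suc B)"
proof -
  let ?X = "{f\<in>inj_reps N l. blocks f \<in> Y}"
  have Yim: "Y = blocks ` ?X" using Y by (auto simp: rep_pairs_def)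
  have "(\<Sum>\<rho>'\<in>Y. q ^ card (R \<union> supp \<rho>')) \<le> (\<Sum>f\<in>?X. q ^ card (R \<union> supp (blocks f)))"
    using q by (subst Yim) (intro sum_image_le[THEN order.trans], auto)
  also have "\<dots> = (\<Sum>f\<in>?X. q ^ card (R \<union> f ` {..<h}))" by (simp add: supp_blocks)
  also have "\<dots> \<le> 2 ^ h * real h ^ h * q ^ h * (real (Suc B) * q) ^ e / real (Suc B)"
  proof (rule weighted_new_positions[OF \<rho> q y, where l = l and N = N])
    show "?X \<subseteq> PiE {..<h} (box N B)" using box by auto
    fix f assume f: "f \<in> ?X"
    then have fN: "f \<in> inj_tuples N" "signed_sum f = l" using inj_repsD by auto
    have c: "card (f ` {..<h}) = h" using inj_tuplesD(3)[OF fN(1)] .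
    have "f ` {..<h} \<noteq> R" using f Y supp_blocks by auto
    then have "\<not> f ` {..<h} \<subseteq> R" using card_subset_eq[OF \<rho>(1), of "f ` {..<h}"] c \<rho>(2) by auto
    then have "new_positions R f \<noteq> {}" by (auto simp: new_positions_def)
    moreover have "card (new_positions R f) \<le> e"
    proof (cases "e \<ge> h")
      case True
      have "card (new_positions R f) \<le> card {..<h}" using new_positions_sub by (intro card_mono) auto
      then show ?thesis using True by simp
    next
      case False
      then have "R \<inter> supp (blocks f) \<noteq> {}" "e = h - 1" using e f by blast+
      then have "R \<inter> f ` {..<h} \<noteq> {}" "e = h - 1" by (simp_all add: supp_blocks)
      then have "new_positions R f \<noteq> {..<h}" by (auto simp: new_positions_def)
      then have "card (new_positions R f) < card {..<h}" using new_positions_sub by (intro psubset_card_mono) auto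
      then show ?thesis using \<open>e = h - 1\<close> by simp
    qed
    ultimately show "inj_on f {..<h} \<and> signed_sum f = l \<and> new_positions R f \<noteq> {} \<and> card (new_positions R f) \<le> e"
      using fN inj_tuplesD(1) by simp
  qed
  finally show ?thesis .
qed

section \<open>Bounds for overlaps and for collisions of values\<close>

definition all_pairs :: "nat \<Rightarrow> (int set \<times> int set) set" where "all_pairs N = blocks ` inj_tuples N"

definition collision_mean :: "nat \<Rightarrow> real \<Rightarrow> real" where
  "collision_mean N q = (\<Sum>\<rho>\<in>all_pairs N. \<Sum>\<rho>'\<in>{\<rho>'\<in>rep_pairs N (pair_value \<rho>). \<rho>' \<noteq> \<rho>}. q ^ card (supp \<rho> \<union> supp \<rho>'))"

lemma rep_pairs_all_pairs: "rep_pairs N k = {\<rho>\<in>all_pairs N. pair_value \<rho> = k}"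
  by (auto simp: rep_pairs_def all_pairs_def inj_reps_def pair_value_blocks)

lemma finite_all_pairs [simp]: "finite (all_pairs N)" by (simp add: all_pairs_def)

lemma inj_reps_box_full: "inj_reps N k \<subseteq> PiE {..<h} (box N N)"
  by (auto simp: inj_reps_def inj_tuples_def box_def PiE_iff extensional_def)

text \<open>Partners with another support are covered by \<open>sum_new_supp\<close>. Partners with
  the same support number at most \<open>4 ^ h\<close>, each of weight \<open>q ^ h\<close>, and are
  charged only to those pairs that have one; these are rare because of the sign flip
  relations.\<close>

lemma weighted_pairs:
  fixes q :: real
  assumes q: "0 \<le> q" and y: "1 \<le> real (Suc B) * q" and S: "S \<subseteq> all_pairs N"
    and Q: "\<And>\<rho>. \<rho> \<in> S \<Longrightarrow> Q \<rho> \<subseteq> rep_pairs N (v \<rho>)" and box: "\<And>\<rho>. \<rho> \<in> S \<Longrightarrow> inj_reps N (v \<rho>) \<subseteq> PiE {..<h} (box N B)"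
    and e: "e \<ge> h \<or> e = h - 1 \<and> (\<forall>\<rho>\<in>S. \<forall>\<rho>'\<in>Q \<rho>. supp \<rho> \<inter> supp \<rho>' \<noteq> {})"
  shows "(\<Sum>\<rho>\<in>S. \<Sum>\<rho>'\<in>Q \<rho>. q ^ card (supp \<rho> \<union> supp \<rho>'))
     \<le> real (card S) * (2 ^ h * real h ^ h * q ^ h * (real (Suc B) * q) ^ e / real (Suc B))
       + real (card {\<rho>\<in>S. \<exists>\<rho>'\<in>Q \<rho>. supp \<rho>' = supp \<rho>}) * (4 ^ h * q ^ h)"
proof -
  let ?K = "2 ^ h * real h ^ h * q ^ h * (real (Suc B) * q) ^ e / real (Suc B)"
  let ?w = "\<lambda>\<rho> \<rho>'. q ^ card (supp \<rho> \<union> supp \<rho>')"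
  have finS: "finite S" using S finite_subset finite_all_pairs by blast
  have "(\<Sum>\<rho>'\<in>Q \<rho>. ?w \<rho> \<rho>') \<le> ?K + of_bool (\<exists>\<rho>'\<in>Q \<rho>. supp \<rho>' = supp \<rho>) * 4 ^ h * q ^ h" if "\<rho> \<in> S" for \<rho>
  proof -
    let ?A1 = "{\<rho>'\<in>Q \<rho>. supp \<rho>' \<noteq> supp \<rho>}" and ?A2 = "{\<rho>'\<in>Q \<rho>. supp \<rho>' = supp \<rho>}"
    have \<rho>: "\<rho> \<in> rep_pairs N (pair_value \<rho>)" using that S by (auto simp: rep_pairs_all_pairs)
    have finQ: "finite (Q \<rho>)" using Q[OF that] finite_subset finite_rep_pairs by blast
    have "Q \<rho> = ?A1 \<union> ?A2" by blast
    then have "(\<Sum>\<rho>'\<in>Q \<rho>. ?w \<rho> \<rho>') = (\<Sum>\<rho>'\<in>?A1 \<union> ?A2. ?w \<rho> \<rho>')" by simp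
    also have "\<dots> = (\<Sum>\<rho>'\<in>?A1. ?w \<rho> \<rho>') + (\<Sum>\<rho>'\<in>?A2. ?w \<rho> \<rho>')"
      using finQ by (intro sum.union_disjoint) auto
    also have "(\<Sum>\<rho>'\<in>?A1. ?w \<rho> \<rho>') \<le> ?K"
      by (rule sum_new_supp[OF rep_pairs_supp(1,2)[OF \<rho>] q y box[OF that]]) (use Q[OF that] that e in auto)
    also have "(\<Sum>\<rho>'\<in>?A2. ?w \<rho> \<rho>') = real (card ?A2) * q ^ h"
      using rep_pairs_supp[OF \<rho>] by simp
    also have "\<dots> \<le> of_bool (\<exists>\<rho>'\<in>Q \<rho>. supp \<rho>' = supp \<rho>) * 4 ^ h * q ^ h"
    proof (cases "?A2 = {}")
      case False
      have "card ?A2 \<le> card {\<rho>' \<in> rep_pairs N (v \<rho>). supp \<rho>' = supp \<rho>}" using Q[OF that] by (intro card_mono) auto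
      also have "\<dots> \<le> 4 ^ h" by (rule card_same_supp[OF rep_pairs_supp(1,2)[OF \<rho>]])
      finally have "real (card ?A2) \<le> real (4 ^ h)" by (rule of_nat_mono)
      then have "real (card ?A2) * q ^ h \<le> 4 ^ h * q ^ h" using q by (intro mult_right_mono) auto
      then show ?thesis using False by auto
    next
      case True
      then show ?thesis using q by (simp only: True) simp
    qed
    finally show ?thesis by simp
  qed
  then have "(\<Sum>\<rho>\<in>S. \<Sum>\<rho>'\<in>Q \<rho>. ?w \<rho> \<rho>') \<le> (\<Sum>\<rho>\<in>S. ?K + of_bool (\<exists>\<rho>'\<in>Q \<rho>. supp \<rho>' = supp \<rho>) * 4 ^ h * q ^ h)"
    by (rule sum_mono)
  also have "\<dots> = real (card S) * ?K + real (card {\<rho>\<in>S. \<exists>\<rho>'\<in>Q \<rho>. supp \<rho>' = supp \<rho>}) * (4 ^ h * q ^ h)"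
    by (rule sum_add_of_bool[OF finS])
  finally show ?thesis .
qed

text \<open>Large enough for both contributions: \<open>2 ^ h * h ^ h\<close> from different
  supports, and \<open>8 ^ h = 2 ^ h * 4 ^ h\<close> from flip patterns times partners on the same
  support.\<close>

definition overlap_const :: real where "overlap_const = 2 * 8 ^ h * real h ^ h"

lemma overlap_const_pos: "overlap_const > 0" using h2 by (simp add: overlap_const_def)

lemma overlap_const_absorb:
  assumes z: "1 \<le> z" and b: "0 < b" and n: "h \<le> n"
  shows "2 ^ h * real h ^ h * z ^ n / b + 8 ^ h * z ^ h / b \<le> overlap_const * z ^ n / b"
proof -
  have "2 ^ h * real h ^ h * z ^ n / b + 8 ^ h * z ^ h / b \<le> (8 ^ h * real h ^ h) * z ^ n / b + (8 ^ h * real h ^ h) * z ^ n / b"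
  proof (intro add_mono divide_right_mono mult_mono)
    show "z ^ h \<le> z ^ n" using z n by (rule power_increasing[rotated])
    show "(8::real) ^ h \<le> 8 ^ h * real h ^ h" using h2 by simp
    show "(2::real) ^ h \<le> 8 ^ h" by (intro power_mono) auto
  qed (use z b in auto)
  also have "\<dots> = overlap_const * z ^ n / b" by (simp add: overlap_const_def)
  finally show ?thesis .
qed

lemma eight_power: "(8::real) ^ h = 2 ^ h * 4 ^ h" by (simp flip: power_mult_distrib)

text \<open>With \<open>b = B + 1\<close> and \<open>y = b q\<close>: \<open>b ^ (h - 1)\<close>
  representations, each with partners of weight \<open>q ^ h * y ^ (h - 1) / b\<close>, give
  \<open>y ^ (2 * h - 1) / b\<^sup>2\<close>. Equal supports add only
  \<open>y ^ h / b\<^sup>2\<close>.\<close>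

lemma overlap_le:
  assumes q: "0 \<le> q" and y: "1 \<le> real (Suc B) * q" and kl: "k + l \<noteq> 0"
    and bk: "inj_reps N k \<subseteq> PiE {..<h} (box N B)" and bl: "inj_reps N l \<subseteq> PiE {..<h} (box N B)"
  shows "overlap N q k l \<le> overlap_const * (real (Suc B) * q) ^ (2 * h - 1) / (real (Suc B))\<^sup>2"
proof -
  let ?b = "real (Suc B)"
  let ?y = "?b * q"
  let ?K = "2 ^ h * real h ^ h * q ^ h * ?y ^ (h - 1) / ?b"
  let ?Q = "\<lambda>\<rho>. {\<rho>'\<in>rep_pairs N l. \<rho>' \<noteq> \<rho> \<and> supp \<rho> \<inter> supp \<rho>' \<noteq> {}}"
  let ?bad = "{\<rho>\<in>rep_pairs N k. \<exists>\<rho>'\<in>?Q \<rho>. supp \<rho>' = supp \<rho>}"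
  let ?F = "{f\<in>inj_reps N k. \<exists>f'\<in>inj_reps N l. f ` {..<h} = f' ` {..<h} \<and> blocks f \<noteq> blocks f'}"
  have b0: "?b > 0" by simp
  have "overlap N q k l \<le> real (card (rep_pairs N k)) * ?K + real (card ?bad) * (4 ^ h * q ^ h)"
    unfolding overlap_def by (rule weighted_pairs[where v = "\<lambda>_. l", OF q y _ _ bl]) (auto simp: rep_pairs_all_pairs)
  also have "\<dots> \<le> ?b ^ (h - 1) * ?K + (2 ^ h * ?b ^ (h - 2)) * (4 ^ h * q ^ h)"
  proof (intro add_mono mult_right_mono)
    show "real (card (rep_pairs N k)) \<le> ?b ^ (h - 1)" using of_nat_mono[OF card_rep_pairs_le[OF bk], where 'a = real] by (simp del: of_nat_Suc)
    have "card ?bad \<le> card (blocks ` ?F)"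
    proof (intro card_mono finite_imageI subsetI)
      fix \<rho> assume "\<rho> \<in> ?bad"
      then obtain \<rho>' where r: "\<rho> \<in> rep_pairs N k" "\<rho>' \<in> rep_pairs N l" "\<rho>' \<noteq> \<rho>" "supp \<rho>' = supp \<rho>" by auto
      then obtain f f' where "f \<in> inj_reps N k" "\<rho> = blocks f" "f' \<in> inj_reps N l" "\<rho>' = blocks f'" unfolding rep_pairs_def by auto
      with r show "\<rho> \<in> blocks ` ?F"
        by (intro image_eqI[of _ _ f] CollectI conjI bexI[of _ f']) (auto simp: supp_blocks)
    qed auto
    also have "\<dots> \<le> card ?F" by (intro card_image_le) auto
    also have "\<dots> \<le> 2 ^ h * Suc B ^ (h - 2)" by (rule card_flipped[OF bk kl])
    finally have "real (card ?bad) \<le> real (2 ^ h * Suc B ^ (h - 2))" by (rule of_nat_mono)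
    then show "real (card ?bad) \<le> 2 ^ h * ?b ^ (h - 2)" by (simp del: of_nat_Suc)
  qed (use q in auto)
  also have "?b ^ (h - 1) * ?K = 2 ^ h * real h ^ h * ?y ^ (2 * h - 1) / ?b\<^sup>2"
  proof -
    have "?b ^ h = ?b * ?b ^ (h - 1)" using h2 by (simp flip: power_Suc)
    moreover have "2 * h - 1 = h + (h - 1)" using h2 by simp
    ultimately show ?thesis using b0 by (simp add: power_add power_mult_distrib power2_eq_square field_simps del: of_nat_Suc)
  qed
  also have "(2 ^ h * ?b ^ (h - 2)) * (4 ^ h * q ^ h) = 8 ^ h * ?y ^ h / ?b\<^sup>2"
  proof -
    have "?b ^ h = ?b\<^sup>2 * ?b ^ (h - 2)" using power_add[of ?b 2 "h - 2"] h2 by (simp only: le_add_diff_inverse)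
    then show ?thesis using b0 by (simp add: eight_power power_mult_distrib field_simps del: of_nat_Suc)
  qed
  also have "2 ^ h * real h ^ h * ?y ^ (2 * h - 1) / ?b\<^sup>2 + 8 ^ h * ?y ^ h / ?b\<^sup>2 \<le> overlap_const * ?y ^ (2 * h - 1) / ?b\<^sup>2"
    by (rule overlap_const_absorb[OF y]) (use h2 in auto)
  finally show ?thesis .
qed

text \<open>Colliding pairs may have disjoint supports, so the exponent is \<open>h\<close> where
  overlaps have \<open>h - 1\<close>. If \<open>y ^ h\<close> is small against \<open>N\<close>, the
  bound \<open>y ^ (2 * h) / N\<close> is small against \<open>y ^ h\<close>.\<close>

lemma collision_mean_le:
  assumes q: "0 \<le> q" and y: "1 \<le> real (Suc N) * q"
  shows "collision_mean N q \<le> overlap_const * (real (Suc N) * q) ^ (2 * h) / real (Suc N)"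
proof -
  let ?b = "real (Suc N)"
  let ?y = "?b * q"
  let ?K = "2 ^ h * real h ^ h * q ^ h * ?y ^ h / ?b"
  let ?Q = "\<lambda>\<rho>. {\<rho>'\<in>rep_pairs N (pair_value \<rho>). \<rho>' \<noteq> \<rho>}"
  let ?bad = "{\<rho>\<in>all_pairs N. \<exists>\<rho>'\<in>?Q \<rho>. supp \<rho>' = supp \<rho>}"
  let ?F = "{f\<in>inj_tuples N. \<exists>f'\<in>inj_tuples N. f ` {..<h} = f' ` {..<h} \<and> blocks f \<noteq> blocks f' \<and> signed_sum f = signed_sum f'}"
  have b0: "?b > 0" by simp
  have "collision_mean N q \<le> real (card (all_pairs N)) * ?K + real (card ?bad) * (4 ^ h * q ^ h)"
    unfolding collision_mean_def by (rule weighted_pairs[where v = pair_value, OF q y _ _ inj_reps_box_full]) auto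
  also have "\<dots> \<le> ?b ^ h * ?K + (2 ^ h * ?b ^ (h - 1)) * (4 ^ h * q ^ h)"
  proof (intro add_mono mult_right_mono)
    have "card (all_pairs N) \<le> card (inj_tuples N)" unfolding all_pairs_def by (rule card_image_le) simp
    also have "\<dots> \<le> card ({..<h} \<rightarrow>\<^sub>E {0..int N})" unfolding inj_tuples_def
      by (intro card_mono finite_PiE) auto
    also have "\<dots> = Suc N ^ h" by (simp add: card_funcsetE nat_add_distrib)
    finally have "real (card (all_pairs N)) \<le> real (Suc N ^ h)" by (rule of_nat_mono)
    then show "real (card (all_pairs N)) \<le> ?b ^ h" by (simp del: of_nat_Suc)
    have "card ?bad \<le> card (blocks ` ?F)"
    proof (intro card_mono finite_imageI subsetI)
      fix \<rho> assume "\<rho> \<in> ?bad"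
      then obtain \<rho>' where r: "\<rho> \<in> all_pairs N" "\<rho>' \<in> all_pairs N" "pair_value \<rho>' = pair_value \<rho>" "\<rho>' \<noteq> \<rho>" "supp \<rho>' = supp \<rho>"
        by (auto simp: rep_pairs_all_pairs)
      then obtain f f' where "f \<in> inj_tuples N" "\<rho> = blocks f" "f' \<in> inj_tuples N" "\<rho>' = blocks f'" unfolding all_pairs_def by auto
      with r show "\<rho> \<in> blocks ` ?F"
        by (intro image_eqI[of _ _ f] CollectI conjI bexI[of _ f']) (auto simp: supp_blocks pair_value_blocks)
    qed auto
    also have "\<dots> \<le> card ?F" by (intro card_image_le) auto
    also have "\<dots> \<le> 2 ^ h * Suc N ^ (h - 1)" by (rule card_flipped_same_value)
    finally have "real (card ?bad) \<le> real (2 ^ h * Suc N ^ (h - 1))" by (rule of_nat_mono)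
    then show "real (card ?bad) \<le> 2 ^ h * ?b ^ (h - 1)" by (simp del: of_nat_Suc)
  qed (use q in auto)
  also have "?b ^ h * ?K = 2 ^ h * real h ^ h * ?y ^ (2 * h) / ?b"
  proof -
    have "?y ^ (2 * h) = ?y ^ h * ?y ^ h" by (simp add: mult_2 power_add del: of_nat_Suc)
    then show ?thesis by (simp add: power_mult_distrib del: of_nat_Suc)
  qed
  also have "(2 ^ h * ?b ^ (h - 1)) * (4 ^ h * q ^ h) = 8 ^ h * ?y ^ h / ?b"
  proof -
    have "?b ^ h = ?b * ?b ^ (h - 1)" using h2 by (simp flip: power_Suc)
    then show ?thesis using b0 by (simp add: eight_power power_mult_distrib field_simps del: of_nat_Suc)
  qed
  also have "2 ^ h * real h ^ h * ?y ^ (2 * h) / ?b + 8 ^ h * ?y ^ h / ?b \<le> overlap_const * ?y ^ (2 * h) / ?b"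
    by (rule overlap_const_absorb[OF y b0]) simp
  finally show ?thesis .
qed

text \<open>Only representations by distinct elements are considered, so a missing value is avoided,
  but an avoided value may still occur through a repeated element.\<close>

definition avoids :: "nat \<Rightarrow> int \<Rightarrow> int set \<Rightarrow> bool" where
  "avoids N k A \<longleftrightarrow> (\<forall>\<rho>\<in>rep_pairs N k. \<not> supp \<rho> \<subseteq> A)"

lemma avoids_lower:
  assumes "0 \<le> q" "q \<le> 1"
  shows "(1 - q ^ h) ^ card (rep_pairs N k) \<le> subset_expect q {0..int N} (\<lambda>A. of_bool (avoids N k A))"
  unfolding avoids_def using assms rep_pairs_supp by (intro subset_expect_avoid_lower) auto

lemma avoids_upper:
  assumes "0 \<le> q" "q \<le> 1"
  shows "subset_expect q {0..int N} (\<lambda>A. of_bool (avoids N k A)) \<le> exp (- real (card (rep_pairs N k)) * q ^ h + overlap N q k k)"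
proof -
  have "subset_expect q {0..int N} (\<lambda>A. of_bool (avoids N k A))
    \<le> exp (- (\<Sum>i\<in>rep_pairs N k. q ^ card (supp i))
        + (\<Sum>i\<in>rep_pairs N k. \<Sum>j\<in>{j\<in>rep_pairs N k. j \<noteq> i \<and> supp i \<inter> supp j \<noteq> {}}. q ^ card (supp i \<union> supp j)))"
    unfolding avoids_def using assms rep_pairs_supp by (intro janson_inequality) auto
  then show ?thesis by (simp add: overlap_def rep_pairs_supp cong: sum.cong)
qed

text \<open>Different values have disjoint families of representations, so Janson's inequality for
  the union gives the sum of the means and all four overlaps.\<close>

lemma avoids_upper2:
  assumes "0 \<le> q" "q \<le> 1" "k \<noteq> l"
  shows "subset_expect q {0..int N} (\<lambda>A. of_bool (avoids N k A) * of_bool (avoids N l A))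
    \<le> exp (- real (card (rep_pairs N k) + card (rep_pairs N l)) * q ^ h + (overlap N q k k + overlap N q k l + overlap N q l k + overlap N q l l))"
proof -
  have dj: "rep_pairs N k \<inter> rep_pairs N l = {}" using assms(3) by (auto simp: rep_pairs_all_pairs)
  let ?I = "rep_pairs N k \<union> rep_pairs N l"
  have "subset_expect q {0..int N} (\<lambda>A. of_bool (avoids N k A) * of_bool (avoids N l A))
    = subset_expect q {0..int N} (\<lambda>A. of_bool (\<forall>\<rho>\<in>?I. \<not> supp \<rho> \<subseteq> A))"
    by (intro subset_expect_cong) (auto simp: avoids_def)
  also have "\<dots> \<le> exp (- (\<Sum>i\<in>?I. q ^ card (supp i))
        + (\<Sum>i\<in>?I. \<Sum>j\<in>{j\<in>?I. j \<noteq> i \<and> supp i \<inter> supp j \<noteq> {}}. q ^ card (supp i \<union> supp j)))"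
    using assms by (intro janson_inequality) (auto dest: rep_pairs_supp(3)[THEN subsetD])
  also have "(\<Sum>i\<in>?I. q ^ card (supp i)) = real (card (rep_pairs N k) + card (rep_pairs N l)) * q ^ h"
    using dj by (simp add: sum.union_disjoint rep_pairs_supp algebra_simps cong: sum.cong)
  also have "(\<Sum>i\<in>?I. \<Sum>j\<in>{j\<in>?I. j \<noteq> i \<and> supp i \<inter> supp j \<noteq> {}}. q ^ card (supp i \<union> supp j))
     = overlap N q k k + overlap N q k l + overlap N q l k + overlap N q l l"
  proof -
    have "(\<Sum>j\<in>{j\<in>?I. j \<noteq> i \<and> supp i \<inter> supp j \<noteq> {}}. q ^ card (supp i \<union> supp j))
      = (\<Sum>j\<in>{j\<in>rep_pairs N k. j \<noteq> i \<and> supp i \<inter> supp j \<noteq> {}}. q ^ card (supp i \<union> supp j))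
      + (\<Sum>j\<in>{j\<in>rep_pairs N l. j \<noteq> i \<and> supp i \<inter> supp j \<noteq> {}}. q ^ card (supp i \<union> supp j))" for i
      using dj by (subst sum.union_disjoint[symmetric]) (auto intro!: sum.cong)
    then show ?thesis using dj by (simp add: sum.union_disjoint sum.distrib overlap_def)
  qed
  finally show ?thesis by (simp only: mult_minus_left)
qed

end

section \<open>Counting representations\<close>

text \<open>The number of \<open>h\<close>-tuples from \<open>{0..N}\<close> with sum
  \<open>m\<close>, that is, the coefficient of \<open>x ^ m\<close> in the \<open>h\<close>-th
  power of \<open>1 + x + ... + x ^ N\<close>.\<close>

primrec box_count :: "nat \<Rightarrow> nat \<Rightarrow> int \<Rightarrow> nat" where
  "box_count 0 N m = (if m = 0 then 1 else 0)"
| "box_count (Suc h) N m = (\<Sum>j\<in>{0..N}. box_count h N (m - int j))"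

text \<open>Stars and bars: the number of ways to write \<open>n\<close> as a sum of
  \<open>h + 1\<close> nonnegative integers, hence 0 for negative \<open>n\<close>.\<close>

definition stars :: "nat \<Rightarrow> int \<Rightarrow> real" where
  "stars h n = (if n < 0 then 0 else real (nat n + h choose h))"

lemma stars_diff: "stars (Suc h) n - stars (Suc h) (n - 1) = stars h n"
proof (cases "n \<le> 0")
  case True
  then show ?thesis by (cases "n = 0") (auto simp: stars_def)
next
  case False
  then obtain k where "n = int (Suc k)" by (metis not_le zero_less_imp_eq_int Suc_pred of_nat_0_less_iff)
  then have n: "nat n = Suc k" "nat (n - 1) = k" "\<not> n < 0" "\<not> n - 1 < 0" by auto
  have "(Suc k + Suc h choose Suc h) = (k + Suc h choose Suc h) + (Suc k + h choose h)"
    by simp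
  then show ?thesis unfolding stars_def n(1,2) if_not_P[OF n(3)] if_not_P[OF n(4)] by simp
qed

lemma sum_stars: "(\<Sum>j\<in>{0..N}. stars h (n - int j)) = stars (Suc h) n - stars (Suc h) (n - int N - 1)"
proof (induction N)
  case 0
  show ?case using stars_diff[of h n] by simp
next
  case (Suc N)
  have "(\<Sum>j\<in>{0..Suc N}. stars h (n - int j)) = stars (Suc h) n - stars (Suc h) (n - int N - 1) + stars h (n - int N - 1)"
    using Suc by (simp add: algebra_simps)
  also have "stars h (n - int N - 1) = stars (Suc h) (n - int N - 1) - stars (Suc h) (n - int N - 1 - 1)"
    using stars_diff[of h "n - int N - 1"] by simp
  finally show ?case by (simp add: algebra_simps)
qed

text \<open>Inclusion-exclusion over the coordinates that exceed \<open>N\<close>, the discrete form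
  of the Irwin--Hall formula. By induction: summing over one coordinate telescopes
  \<open>stars\<close>, and Pascal's rule merges the two resulting sums.\<close>

lemma box_count_formula:
  "real (box_count (Suc h) N m) = (\<Sum>j\<in>{0..Suc h}. (-1) ^ j * real (Suc h choose j) * stars h (m - int j * (int N + 1)))"
proof (induction h arbitrary: m)
  case 0
  have "(\<Sum>j\<in>{0..N}. if m = int j then 1 else 0) = (if 0 \<le> m \<and> m \<le> int N then 1 else (0::nat))"
  proof (cases "0 \<le> m \<and> m \<le> int N")
    case True
    then have "(\<Sum>j\<in>{0..N}. if m = int j then 1 else 0) = (\<Sum>j\<in>{0..N}. if j = nat m then 1 else (0::nat))"
      by (intro sum.cong) auto
    also have "\<dots> = 1" using True by (simp add: sum.delta nat_le_iff)
    finally show ?thesis using True by simp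
  next
    case False
    then show ?thesis by (intro trans[OF sum.neutral]) auto
  qed
  then show ?case by (auto simp: stars_def)
next
  case (Suc h)
  let ?M = "int N + 1"
  define F where "F j = stars (Suc h) (m - int j * ?M)" for j
  let ?c = "\<lambda>j. (-1) ^ j * real (Suc h choose j)"
  have "real (box_count (Suc (Suc h)) N m) = (\<Sum>i\<in>{0..N}. real (box_count (Suc h) N (m - int i)))" by simp
  also have "\<dots> = (\<Sum>i\<in>{0..N}. \<Sum>j\<in>{0..Suc h}. ?c j * stars h (m - int i - int j * ?M))"
    by (intro sum.cong refl Suc.IH)
  also have "\<dots> = (\<Sum>j\<in>{0..Suc h}. ?c j * (\<Sum>i\<in>{0..N}. stars h ((m - int j * ?M) - int i)))"
    by (subst sum.swap) (simp add: sum_distrib_left algebra_simps)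
  also have "\<dots> = (\<Sum>j\<in>{0..Suc h}. ?c j * (F j - F (Suc j)))"
    unfolding sum_stars F_def by (simp add: algebra_simps)
  also have "\<dots> = (\<Sum>j\<in>{0..Suc h}. ?c j * F j) - (\<Sum>j\<in>{0..Suc h}. ?c j * F (Suc j))"
    by (simp add: sum_subtractf right_diff_distrib)
  \<comment> \<open>A term with binomial coefficient 0 is appended so that the index can be shifted
    to match the second sum.\<close>
  also have "(\<Sum>j\<in>{0..Suc h}. ?c j * F j) = F 0 + (\<Sum>j\<in>{0..Suc h}. (-1) ^ Suc j * real (Suc h choose Suc j) * F (Suc j))"
  proof -
    have "(\<Sum>j\<in>{0..Suc h}. ?c j * F j) = (\<Sum>j\<in>{0..Suc (Suc h)}. ?c j * F j)" by (simp add: binomial_eq_0)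
    also have "\<dots> = ?c 0 * F 0 + (\<Sum>j\<in>{0..Suc h}. ?c (Suc j) * F (Suc j))"
      by (simp only: sum.atLeast0_atMost_Suc_shift o_def)
    finally show ?thesis by simp
  qed
  also have "F 0 + (\<Sum>j\<in>{0..Suc h}. (-1) ^ Suc j * real (Suc h choose Suc j) * F (Suc j)) - (\<Sum>j\<in>{0..Suc h}. ?c j * F (Suc j))
     = F 0 + (\<Sum>j\<in>{0..Suc h}. (-1) ^ Suc j * real (Suc (Suc h) choose Suc j) * F (Suc j))"
    unfolding add_diff_eq[symmetric] sum_subtractf[symmetric]
    by (intro arg_cong2[where f = "(+)"] sum.cong refl) (simp add: algebra_simps)
  also have "\<dots> = (\<Sum>j\<in>{0..Suc (Suc h)}. (-1) ^ j * real (Suc (Suc h) choose j) * F j)"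
    by (simp only: sum.atLeast0_atMost_Suc_shift o_def) simp
  finally show ?case by (simp add: F_def)
qed

lemma power_diff_le:
  fixes a b c :: real
  assumes "0 \<le> a" "0 \<le> b" "a \<le> c" "b \<le> c" "\<bar>a - b\<bar> \<le> e"
  shows "\<bar>a ^ n - b ^ n\<bar> \<le> real n * e * c ^ (n - 1)"
proof (induction n)
  case (Suc n)
  have c0: "0 \<le> c" and e0: "0 \<le> e" using assms by auto
  have "a ^ Suc n - b ^ Suc n = a * (a ^ n - b ^ n) + (a - b) * b ^ n" by (simp add: algebra_simps)
  also have "\<bar>\<dots>\<bar> \<le> a * \<bar>a ^ n - b ^ n\<bar> + \<bar>a - b\<bar> * b ^ n"
    using assms by (intro order.trans[OF abs_triangle_ineq]) (simp add: abs_mult)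
  also have "\<dots> \<le> c * (real n * e * c ^ (n - 1)) + e * c ^ n"
    using assms Suc c0 e0 by (intro add_mono mult_mono power_mono) auto
  also have "c * (real n * e * c ^ (n - 1)) = real n * e * c ^ n"
    by (cases n) auto
  finally show ?case by (simp add: algebra_simps)
qed simp

lemma stars_approx:
  assumes "n \<ge> 0"
  shows "real_of_int n ^ h / fact h \<le> stars h n" "stars h n \<le> (real_of_int n + real h) ^ h / fact h"
proof -
  define k where "k = nat n"
  have n: "real_of_int n = real k" using assms by (simp add: k_def)
  have st: "stars h n = real (k + h choose h)" using assms by (simp add: stars_def k_def)
  have A: "(k + h choose h) * fact h \<le> (k + h) ^ h"
    using binomial_fact_pow[of "k + h" h] by simp
  have B: "k ^ h \<le> (k + h choose h) * fact h"
  proof -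
    have "k ^ h * fact k \<le> fact (k + h)"
    proof (induction h)
      case (Suc h)
      have "k ^ Suc h * fact k = k * (k ^ h * fact k)" by simp
      also have "\<dots> \<le> Suc (k + h) * fact (k + h)" by (rule mult_le_mono[OF _ Suc]) simp
      finally show ?case by simp
    qed simp
    also have "fact (k + h) = (k + h choose h) * fact h * fact k"
      using binomial_fact_lemma[of h "k + h"] by (simp add: algebra_simps)
    finally show ?thesis by simp
  qed
  have "real (k ^ h) \<le> real ((k + h choose h) * fact h)" "real ((k + h choose h) * fact h) \<le> real ((k + h) ^ h)"
    using A B by (simp_all only: of_nat_le_iff)
  then show "real_of_int n ^ h / fact h \<le> stars h n" "stars h n \<le> (real_of_int n + real h) ^ h / fact h"
    by (simp_all add: n st field_simps)
qed

text \<open>Both the passage from binomial coefficient to power and the shift by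
  \<open>j * (N + 1)\<close> in place of \<open>j * N\<close> change the base by at most
  \<open>h + 1\<close>, which costs one power of \<open>m + h\<close>.\<close>

lemma stars_approx_shift:
  fixes m :: int
  assumes m: "0 \<le> m" and h: "h \<ge> 1" and j: "j \<le> Suc h"
  shows "\<bar>stars h (m - int j * (int N + 1)) - max 0 (real_of_int m - real j * real N) ^ h / fact h\<bar>
    \<le> real h * (2 * real h + 2) * (real_of_int m + real h) ^ (h - 1)"
proof -
  let ?n = "m - int j * (int N + 1)"
  define u where "u = max 0 (real_of_int m - real j * real N)"
  have u: "0 \<le> u" "u \<le> real_of_int m" using m by (auto simp: u_def)
  let ?R = "real h * (real h + 1) * (real_of_int m + real h) ^ (h - 1)"
  have R0: "0 \<le> ?R" using m by simp
  have jr: "real j \<le> real h + 1" using j by linarith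
  have rn: "real_of_int ?n = real_of_int m - real j * real N - real j" by (simp add: algebra_simps)
  have "fact h * stars h ?n \<le> u ^ h + ?R \<and> u ^ h - ?R \<le> fact h * stars h ?n"
  proof (cases "?n < 0")
    case True
    then have st: "stars h ?n = 0" by (simp add: stars_def)
    have "real_of_int ?n \<le> 0" using True by linarith
    \<comment> \<open>The two truncations differ: \<open>stars\<close> vanishes below
      \<open>j * (N + 1)\<close>, the power below \<open>j * N\<close>. In between, \<open>u\<close>
      is at most \<open>j\<close>.\<close>
    then have "u \<le> real h + 1" using jr rn by (simp add: u_def)
    then have "\<bar>u ^ h - 0 ^ h\<bar> \<le> real h * (real h + 1) * (real_of_int m + real h) ^ (h - 1)"
      using u m by (intro power_diff_le) auto
    moreover have "(0::real) ^ h = 0" using h by simp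
    ultimately show ?thesis using st u by auto
  next
    case False
    then have n0: "0 \<le> ?n" by simp
    have n0': "0 \<le> real_of_int ?n" using n0 by linarith
    have uu: "u = real_of_int m - real j * real N" unfolding u_def using n0' rn by simp
    have a: "real_of_int ?n = u - real j" using rn uu by simp
    have j0: "0 \<le> real j" "0 \<le> real h" by simp_all
    have "\<bar>real_of_int ?n ^ h - u ^ h\<bar> \<le> ?R"
      by (rule power_diff_le) (use u jr a n0' j0 in linarith)+
    moreover have "\<bar>(real_of_int ?n + real h) ^ h - u ^ h\<bar> \<le> ?R"
      by (rule power_diff_le) (use u jr a n0' j0 in linarith)+
    moreover have "real_of_int ?n ^ h \<le> fact h * stars h ?n" "fact h * stars h ?n \<le> (real_of_int ?n + real h) ^ h"
      using stars_approx[OF n0, of h] by (simp_all add: field_simps)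
    ultimately show ?thesis by linarith
  qed
  then have "\<bar>fact h * stars h ?n - u ^ h\<bar> \<le> ?R" by (simp add: abs_le_iff)
  have "\<bar>stars h ?n - u ^ h / fact h\<bar> = \<bar>fact h * stars h ?n - u ^ h\<bar> / fact h"
  proof -
    have "stars h ?n - u ^ h / fact h = (fact h * stars h ?n - u ^ h) / fact h" by (simp add: diff_divide_distrib)
    then show ?thesis by (simp only: abs_divide) simp
  qed
  also have "\<dots> \<le> ?R / 1"
    using \<open>\<bar>fact h * stars h ?n - u ^ h\<bar> \<le> ?R\<close> R0 by (intro frac_le) (auto simp: fact_ge_1)
  also have "\<dots> \<le> real h * (2 * real h + 2) * (real_of_int m + real h) ^ (h - 1)"
  proof -
    have "real h * (real h + 1) \<le> real h * (2 * real h + 2)" by (simp add: algebra_simps)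
    then show ?thesis using m by (simp only: div_by_1, intro mult_right_mono) auto
  qed
  finally show ?thesis by (simp add: u_def)
qed

text \<open>The Irwin--Hall formula without the cut-off at \<open>h\<close>, so that continuity can
  be read off; only arguments at most \<open>h\<close> matter for the theorem.\<close>

definition ihpoly :: "nat \<Rightarrow> real \<Rightarrow> real" where
  "ihpoly h x = 1 / fact (h - 1) * (\<Sum>j=0..h. (- 1) ^ j * real (h choose j) * (max 0 (x - real j)) ^ (h - 1))"

lemma continuous_on_ihpoly: "continuous_on S (ihpoly h)"
  unfolding ihpoly_def by (intro continuous_intros)

text \<open>The inclusion-exclusion terms are compared one by one; the binomial weights add up to
  \<open>2 ^ h\<close>. The error has one power less than the main term.\<close>

lemma box_count_approx:
  fixes m :: int
  assumes m: "0 \<le> m" and h: "2 \<le> h" and N: "N > 0"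
  shows "\<bar>real (box_count h N m) - real N ^ (h - 1) * ihpoly h (m / real N)\<bar> \<le> 2 ^ h * (2 * (real h)\<^sup>2) * (real_of_int m + real h) ^ (h - 2)"
proof -
  obtain g where g: "h = Suc g" "g \<ge> 1" using h by (cases h) auto
  let ?c = "\<lambda>j. (-1) ^ j * real (h choose j)"
  let ?U = "\<lambda>j. max 0 (real_of_int m - real j * real N) ^ g / fact g"
  have 1: "real N ^ g * ihpoly h (m / real N) = (\<Sum>j\<in>{0..h}. ?c j * ?U j)"
  proof -
    have "real N * max 0 (m / real N - real j) = max 0 (real_of_int m - real j * real N)" for j
      using N by (simp add: max_def field_simps)
    then have "real N ^ g * max 0 (m / real N - real j) ^ g = max 0 (real_of_int m - real j * real N) ^ g" for j
      by (simp flip: power_mult_distrib)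
    then have "real N ^ g * (?c j * max 0 (m / real N - real j) ^ g) = ?c j * max 0 (real_of_int m - real j * real N) ^ g" for j
      by (simp add: mult.left_commute)
    then have *: "real N ^ g * (?c j * max 0 (m / real N - real j) ^ g) / fact g = ?c j * ?U j" for j
      by simp
    have "h - 1 = g" using g(1) by simp
    then have "real N ^ g * ihpoly h (m / real N) = (\<Sum>j\<in>{0..h}. real N ^ g * (?c j * max 0 (m / real N - real j) ^ g) / fact g)"
      by (simp add: ihpoly_def sum_distrib_left sum_divide_distrib)
    then show ?thesis by (simp only: *)
  qed
  have 2: "real (box_count h N m) = (\<Sum>j\<in>{0..h}. ?c j * stars g (m - int j * (int N + 1)))"
    unfolding g(1) by (rule box_count_formula)
  have "\<bar>real (box_count h N m) - real N ^ g * ihpoly h (m / real N)\<bar>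
    = \<bar>\<Sum>j\<in>{0..h}. ?c j * (stars g (m - int j * (int N + 1)) - ?U j)\<bar>"
    unfolding 1 2 by (simp add: sum_subtractf right_diff_distrib)
  also have "\<dots> \<le> (\<Sum>j\<in>{0..h}. real (h choose j) * (2 * (real h)\<^sup>2 * (real_of_int m + real h) ^ (g - 1)))"
  proof (rule order.trans[OF sum_abs sum_mono])
    fix j assume "j \<in> {0..h}"
    then have "\<bar>stars g (m - int j * (int N + 1)) - ?U j\<bar> \<le> real g * (2 * real g + 2) * (real_of_int m + real g) ^ (g - 1)"
      using g by (intro stars_approx_shift[OF m]) auto
    also have "\<dots> \<le> (2 * (real h)\<^sup>2) * (real_of_int m + real h) ^ (g - 1)"
    proof (rule mult_mono)
      show "real g * (2 * real g + 2) \<le> 2 * (real h)\<^sup>2" by (simp add: g(1) power2_eq_square algebra_simps)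
    qed (use m g(1) in \<open>auto intro!: power_mono\<close>)
    finally have "\<bar>stars g (m - int j * (int N + 1)) - ?U j\<bar> \<le> (2 * (real h)\<^sup>2) * (real_of_int m + real h) ^ (g - 1)" .
    then have "real (h choose j) * \<bar>stars g (m - int j * (int N + 1)) - ?U j\<bar> \<le> real (h choose j) * (2 * (real h)\<^sup>2 * (real_of_int m + real h) ^ (g - 1))"
      by (intro mult_left_mono) auto
    then show "\<bar>?c j * (stars g (m - int j * (int N + 1)) - ?U j)\<bar> \<le> real (h choose j) * (2 * (real h)\<^sup>2 * (real_of_int m + real h) ^ (g - 1))"
      by (simp add: abs_mult power_abs)
  qed
  also have "\<dots> = 2 ^ h * (2 * (real h)\<^sup>2) * (real_of_int m + real h) ^ (g - 1)"
  proof -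
    have "(\<Sum>j\<in>{0..h}. real (h choose j)) = real (\<Sum>j\<le>h. h choose j)" by (simp add: atMost_atLeast0)
    also have "\<dots> = 2 ^ h" by (simp only: choose_row_sum) simp
    finally show ?thesis by (simp flip: sum_distrib_right)
  qed
  finally show ?thesis using g(1) by simp
qed

lemma irwin_hall_eq_ihpoly: "x \<le> real h \<Longrightarrow> irwin_hall h x = ihpoly h x"
  by (simp add: irwin_hall_def ihpoly_def)

text \<open>Only the term \<open>j = 0\<close> survives. This monomial is the source of the Gamma
  integral in the dense regime.\<close>

lemma ihpoly_small:
  assumes "0 \<le> x" "x \<le> 1" "2 \<le> h"
  shows "ihpoly h x = x ^ (h - 1) / fact (h - 1)"
proof -
  have "(\<Sum>j=0..h. (- 1) ^ j * real (h choose j) * (max 0 (x - real j)) ^ (h - 1))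
     = (\<Sum>j\<in>{0}. (- 1) ^ j * real (h choose j) * (max 0 (x - real j)) ^ (h - 1))"
    using assms by (intro sum.mono_neutral_right) (auto simp: max_def)
  then show ?thesis using assms by (simp add: ihpoly_def)
qed

text \<open>Reflecting the coordinates with negative sign turns \<open>signed_sum f = k\<close> into a plain composition
  of \<open>k + d N\<close>.\<close>

lemma card_signed_compositions:
  fixes c :: "nat \<Rightarrow> int"
  assumes "\<And>i. c i = 1 \<or> c i = -1"
  shows "card {f \<in> {..<h} \<rightarrow>\<^sub>E {0..int N}. (\<Sum>i<h. c i * f i) = k} = box_count h N (k + int N * int (card {i\<in>{..<h}. c i = -1}))"
proof (induction h arbitrary: k)
  case 0
  then show ?case by simp
next
  case (Suc h)
  let ?S = "\<lambda>h k. {f \<in> {..<h} \<rightarrow>\<^sub>E {0..int N}. (\<Sum>i<h. c i * f i) = k}"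
  let ?v = "\<lambda>h. int (card {i\<in>{..<h}. c i = -1})"
  \<comment> \<open>\<open>x j\<close> is chosen so that \<open>c h * x j\<close> equals
    \<open>j\<close> or \<open>j - N\<close>: the last coordinate contributes \<open>j\<close> once
    each negative sign has been compensated by \<open>N\<close>.\<close>
  define x where "x j = (if c h = 1 then int j else int N - int j)" for j :: nat
  have fin: "finite (?S h k)" for h k by (rule finite_subset[OF _ finite_PiE[of "{..<h}" "\<lambda>_. {0..int N}"]]) auto
  have S: "?S (Suc h) k = (\<Union>j\<in>{0..N}. (\<lambda>f. f(h := x j)) ` ?S h (k - c h * x j))"
  proof (intro set_eqI iffI)
    fix f assume f: "f \<in> ?S (Suc h) k"
    then have fE: "f \<in> {..<Suc h} \<rightarrow>\<^sub>E {0..int N}" and fs: "(\<Sum>i<h. c i * f i) + c h * f h = k" by auto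
    have fh: "f h \<in> {0..int N}" using PiE_mem[OF fE, of h] by simp
    define j where "j = nat (if c h = 1 then f h else int N - f h)"
    have j: "j \<in> {0..N}" "x j = f h" using fh by (auto simp: j_def x_def)
    let ?g = "f(h := undefined)"
    have "?g \<in> {..<h} \<rightarrow>\<^sub>E {0..int N}" using fE by (auto simp: PiE_iff extensional_def)
    moreover have "(\<Sum>i<h. c i * ?g i) = k - c h * x j" unfolding j(2) using fs by simp
    moreover have "f = ?g(h := x j)" unfolding j(2) by simp
    ultimately show "f \<in> (\<Union>j\<in>{0..N}. (\<lambda>f. f(h := x j)) ` ?S h (k - c h * x j))"
      using j(1) by (intro UN_I[of j] image_eqI[of _ _ ?g]) auto
  next
    fix f assume "f \<in> (\<Union>j\<in>{0..N}. (\<lambda>f. f(h := x j)) ` ?S h (k - c h * x j))"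
    then obtain j g where j: "j \<in> {0..N}" and g: "g \<in> {..<h} \<rightarrow>\<^sub>E {0..int N}" "(\<Sum>i<h. c i * g i) = k - c h * x j"
      and f: "f = g(h := x j)" by auto
    have "x j \<in> {0..int N}" using j by (auto simp: x_def)
    then have "f \<in> {..<Suc h} \<rightarrow>\<^sub>E {0..int N}" using g(1) unfolding f by (auto simp: PiE_iff extensional_def less_Suc_eq)
    moreover have "(\<Sum>i<Suc h. c i * f i) = k" using g(2) by (simp add: f)
    ultimately show "f \<in> ?S (Suc h) k" by simp
  qed
  have "card (?S (Suc h) k) = (\<Sum>j\<in>{0..N}. card ((\<lambda>f. f(h := x j)) ` ?S h (k - c h * x j)))"
    unfolding S
  proof (rule card_UN_disjoint)
    show "\<forall>i\<in>{0..N}. \<forall>j\<in>{0..N}. i \<noteq> j \<longrightarrow>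
       (\<lambda>f. f(h := x i)) ` ?S h (k - c h * x i) \<inter> (\<lambda>f. f(h := x j)) ` ?S h (k - c h * x j) = {}"
    proof (intro ballI impI equals0I, elim IntE imageE)
      fix i j f g g' assume "i \<noteq> j" and 1: "f = g(h := x i)" and 2: "f = g'(h := x j)"
      have "f h = x i" unfolding 1 by simp
      moreover have "f h = x j" unfolding 2 by simp
      ultimately have "x i = x j" by simp
      then show False using \<open>i \<noteq> j\<close> by (auto simp: x_def split: if_splits)
    qed
  next
    show "\<forall>j\<in>{0..N}. finite ((\<lambda>f. f(h := x j)) ` ?S h (k - c h * x j))"
      by (intro ballI finite_imageI fin)
  qed simp
  also have "\<dots> = (\<Sum>j\<in>{0..N}. card (?S h (k - c h * x j)))"
  proof (rule sum.cong[OF refl], rule card_image, rule inj_onI)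
    fix j f g assume f: "f \<in> ?S h (k - c h * x j)" and g: "g \<in> ?S h (k - c h * x j)" and eq: "f(h := x j) = g(h := x j)"
    have "f h = g h"
      using PiE_arb[OF CollectD[OF f, THEN conjunct1], of h] PiE_arb[OF CollectD[OF g, THEN conjunct1], of h] by simp
    then have "f z = g z" for z using fun_cong[OF eq, of z] by (cases "z = h") simp_all
    then show "f = g" by blast
  qed
  also have "\<dots> = (\<Sum>j\<in>{0..N}. box_count h N (k + int N * ?v (Suc h) - int j))"
  proof (intro sum.cong refl)
    fix j
    have "{i\<in>{..<Suc h}. c i = -1} = (if c h = -1 then insert h {i\<in>{..<h}. c i = -1} else {i\<in>{..<h}. c i = -1})"
      by (auto simp: less_Suc_eq)
    then have v: "?v (Suc h) = ?v h + (if c h = -1 then 1 else 0)" by simp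
    show "card (?S h (k - c h * x j)) = box_count h N (k + int N * ?v (Suc h) - int j)"
      unfolding Suc.IH v x_def using assms[of h] by (auto simp: algebra_simps)
  qed
  finally show ?case by simp
qed

context sumdiff_params
begin

lemma card_reps: "card (reps N k) = box_count h N (k + int d * int N)"
proof -
  have "{i\<in>{..<h}. sgn_at i = -1} = {s..<h}" by (auto simp: sgn_at_def)
  then have "card {i\<in>{..<h}. sgn_at i = -1} = d" using h_eq by simp
  then show ?thesis unfolding reps_def signed_sum_def
    using card_signed_compositions[of sgn_at h N k] by (simp add: sgn_at_def mult.commute)
qed

end

section \<open>Convergence in probability and moments of the number of missing values\<close>

lemma integral_piecewise:
  fixes G :: "real \<Rightarrow> real"
  assumes "continuous_on UNIV G" "T > 0"
  shows "integral {0..real n / T} G = (\<Sum>m<n. integral {real m / T..real (Suc m) / T} G)"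
proof (induction n)
  case (Suc n)
  have "G integrable_on {0..real (Suc n) / T}"
    by (intro integrable_continuous_real continuous_on_subset[OF assms(1)]) auto
  then have "integral {0..real (Suc n) / T} G = integral {0..real n / T} G + integral {real n / T..real (Suc n) / T} G"
    using assms(2) by (intro Henstock_Kurzweil_Integration.integral_combine[symmetric]) (auto simp: divide_right_mono)
  then show ?case using Suc by simp
qed simp

text \<open>The mesh \<open>1 / T N\<close> need not divide \<open>L\<close>, so the last cell may
  overshoot; it is shorter than the mesh and the integrand is bounded.\<close>

lemma riemann_sum_tendsto:
  fixes g :: "real \<Rightarrow> real" and T :: "nat \<Rightarrow> real"
  assumes g: "continuous_on {0..L} g" and L: "L > 0" and T: "filterlim T at_top sequentially"
  shows "(\<lambda>N. (\<Sum>m\<le>nat \<lfloor>L * T N\<rfloor>. g (real m / T N)) / T N) \<longlonglongrightarrow> integral {0..L} g"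
proof (rule LIMSEQ_I)
  fix e :: real assume e: "e > 0"
  \<comment> \<open>Constant continuation beyond the interval, to give meaning to the last
    cell.\<close>
  define G where "G x = g (max 0 (min L x))" for x
  have cG: "continuous_on UNIV G"
    unfolding G_def using L by (intro continuous_on_compose2[OF g]) (auto intro!: continuous_intros)
  have Gg: "G x = g x" if "0 \<le> x" "x \<le> L" for x using that by (simp add: G_def)
  have "uniformly_continuous_on {0..L+1} G"
    by (intro compact_uniformly_continuous continuous_on_subset[OF cG]) auto
  \<comment> \<open>The cells have total length at most \<open>L + 1\<close>, so an oscillation of
    \<open>e'\<close> costs \<open>e / 4\<close>.\<close>
  moreover define e' where "e' = e / (4 * (L + 1))"
  have e': "e' > 0" using e L by (simp add: e'_def)
  ultimately obtain r where r: "r > 0" "\<And>x x'. x \<in> {0..L+1} \<Longrightarrow> x' \<in> {0..L+1} \<Longrightarrow> dist x' x < r \<Longrightarrow> dist (G x') (G x) < e'"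
    unfolding uniformly_continuous_on_def by metis
  obtain K where K: "\<And>x. x \<in> {0..L+1} \<Longrightarrow> \<bar>G x\<bar> \<le> K"
    using compact_imp_bounded[OF compact_continuous_image[OF continuous_on_subset[OF cG], of "{0..L+1}"]]
    by (auto simp: bounded_iff) fastforce
  have K0: "K \<ge> 0" using K[of 0] L by auto
  have "eventually (\<lambda>N. T N > max (max 1 (2 / r)) (4 * K / e)) sequentially"
    using T unfolding filterlim_at_top_dense by blast
  then obtain N0 where N0: "\<And>N. N \<ge> N0 \<Longrightarrow> T N > max (max 1 (2 / r)) (4 * K / e)"
    by (auto simp: eventually_sequentially)
  show "\<exists>no. \<forall>n\<ge>no. norm ((\<Sum>m\<le>nat \<lfloor>L * T n\<rfloor>. g (real m / T n)) / T n - integral {0..L} g) < e"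
  proof (intro exI[of _ N0] allI impI)
    fix N assume "N \<ge> N0"
    define t where "t = T N"
    define M where "M = nat \<lfloor>L * t\<rfloor>"
    have t: "t > 1" "t > 2 / r" "t > 4 * K / e" using N0[OF \<open>N \<ge> N0\<close>] by (auto simp: t_def)
    have t0: "t > 0" using t by simp
    have M: "real M \<le> L * t" "L * t < real (Suc M)"
    proof -
      have f0: "0 \<le> \<lfloor>L * t\<rfloor>" using L t0 by simp
      then have fM: "real M = real_of_int \<lfloor>L * t\<rfloor>" by (simp add: M_def)
      show "real M \<le> L * t" unfolding fM by linarith
      show "L * t < real (Suc M)" unfolding of_nat_Suc fM by linarith
    qed
    have M1: "real (Suc M) / t \<le> L + 1" using M t by (simp add: field_simps)
    have LM: "L \<le> real (Suc M) / t" using M(2) t0 by (simp add: field_simps)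
    have 1: "(\<Sum>m\<le>M. g (real m / t)) / t = (\<Sum>m<Suc M. G (real m / t) / t)"
    proof -
      have "g (real m / t) = G (real m / t)" if "m \<le> M" for m
      proof -
        have "real m \<le> L * t" using that M(1) by (meson of_nat_mono order.trans)
        then show ?thesis using t0 by (intro Gg[symmetric]) (auto simp: field_simps)
      qed
      then show ?thesis by (simp add: sum_divide_distrib lessThan_Suc_atMost)
    qed
    have 2: "\<bar>G (real m / t) / t - integral {real m / t..real (Suc m) / t} G\<bar> \<le> e' / t" if m: "m < Suc M" for m
    proof -
      let ?a = "real m / t" and ?b = "real (Suc m) / t"
      have ab: "?a \<le> ?b" "?b - ?a = 1 / t" using t0 by (auto simp: field_simps)
      have b1: "?b \<le> L + 1"
      proof -
        have "real (Suc m) \<le> real (Suc M)" using m by simp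
        then have "?b \<le> real (Suc M) / t" using t0 by (intro divide_right_mono) auto
        then show ?thesis using M1 by linarith
      qed
      have a0: "0 \<le> ?a" using t0 by simp
      have intG: "G integrable_on {?a..?b}"
        by (intro integrable_continuous_real continuous_on_subset[OF cG]) auto
      have "integral {?a..?b} (\<lambda>x. G ?a - G x) = integral {?a..?b} (\<lambda>x. G ?a) - integral {?a..?b} G"
        by (intro integral_diff intG) auto
      also have "integral {?a..?b} (\<lambda>x. G ?a) = G ?a / t" using ab by simp
      finally have eq: "G ?a / t - integral {?a..?b} G = integral {?a..?b} (\<lambda>x. G ?a - G x)" by simp
      have "norm (integral {?a..?b} (\<lambda>x. G ?a - G x)) \<le> e' * (?b - ?a)"
      proof (rule integral_bound)
        show "continuous_on {?a..?b} (\<lambda>x. G ?a - G x)"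
          by (intro continuous_intros continuous_on_subset[OF cG]) auto
        fix x assume x: "x \<in> {?a..?b}"
        have "\<bar>?a - x\<bar> \<le> 1 / t" using x ab(2) by auto
        also have "1 / t < r" using t(2) t0 r(1) by (simp add: field_simps)
        finally have "dist (G ?a) (G x) < e'" using x a0 b1 by (intro r(2)) (auto simp: dist_real_def)
        then show "norm (G ?a - G x) \<le> e'" by (simp add: dist_real_def)
      qed (use ab in auto)
      then show ?thesis using eq ab by simp
    qed
    have "(\<Sum>m<Suc M. G (real m / t) / t) - integral {0..real (Suc M) / t} G
       = (\<Sum>m<Suc M. G (real m / t) / t - integral {real m / t..real (Suc m) / t} G)"
      by (simp only: integral_piecewise[OF cG t0] sum_subtractf)
    also have "\<bar>\<dots>\<bar> \<le> (\<Sum>m<Suc M. e' / t)"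
      by (rule order.trans[OF sum_abs sum_mono]) (use 2 in auto)
    also have "\<dots> = e' * (real (Suc M) / t)" by simp
    also have "\<dots> \<le> e' * (L + 1)" using M1 e' by (intro mult_left_mono) auto
    also have "\<dots> = e / 4" using L by (simp add: e'_def field_simps)
    finally have 3: "\<bar>(\<Sum>m<Suc M. G (real m / t) / t) - integral {0..real (Suc M) / t} G\<bar> \<le> e / 4" .
    have "integral {0..real (Suc M) / t} G = integral {0..L} G + integral {L..real (Suc M) / t} G"
      using L LM by (intro Henstock_Kurzweil_Integration.integral_combine[symmetric]
        integrable_continuous_real continuous_on_subset[OF cG]) auto
    moreover have "norm (integral {L..real (Suc M) / t} G) \<le> K * (real (Suc M) / t - L)"
      using LM M1 L by (intro integral_bound continuous_on_subset[OF cG]) (auto intro!: K)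
    moreover have "K * (real (Suc M) / t - L) \<le> K * (1 / t)"
      using M(1) t0 K0 by (intro mult_left_mono) (auto simp: field_simps)
    moreover have "K * (1 / t) \<le> e / 4" using t(3) t0 e by (simp add: field_simps)
    ultimately have 4: "\<bar>integral {0..real (Suc M) / t} G - integral {0..L} G\<bar> \<le> e / 4" by auto
    have "integral {0..L} G = integral {0..L} g" by (intro integral_cong Gg) auto
    then have "\<bar>(\<Sum>m\<le>M. g (real m / t)) / t - integral {0..L} g\<bar> \<le> e / 4 + e / 4"
      unfolding 1 using 3 4 by linarith
    then show "norm ((\<Sum>m\<le>nat \<lfloor>L * T N\<rfloor>. g (real m / T N)) / T N - integral {0..L} g) < e"
      using e by (simp add: t_def M_def)
  qed
qed

section \<open>Convergence in probability at a given scale\<close>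

abbreviation dev_prob ::
  "(nat \<Rightarrow> real) \<Rightarrow> (nat \<Rightarrow> int set \<Rightarrow> real) \<Rightarrow> real \<Rightarrow> (nat \<Rightarrow> real) \<Rightarrow> real \<Rightarrow> nat \<Rightarrow> real" where
  "dev_prob p X c T e N \<equiv> subset_expect (p N) {0..int N} (\<lambda>A. of_bool (\<bar>X N A - c * T N\<bar> > e * T N))"

text \<open>\<open>X / T\<close> tends to \<open>c\<close> in probability, written without division.
  Unlike \<open>rv_asymp\<close> it has a meaningful limit 0, so error terms can be added as
  summands.\<close>

definition conv_prob :: "(nat \<Rightarrow> real) \<Rightarrow> (nat \<Rightarrow> real) \<Rightarrow> (nat \<Rightarrow> int set \<Rightarrow> real) \<Rightarrow> real \<Rightarrow> bool" where
  "conv_prob p T X c \<longleftrightarrow> (\<forall>e>0. dev_prob p X c T e \<longlonglongrightarrow> 0)"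

locale prob_seq =
  fixes p :: "nat \<Rightarrow> real"
  assumes p01: "0 < p N" "p N < 1"
begin

lemma p01': "0 \<le> p N" "p N \<le> 1" using p01[of N] by auto

lemma conv_probI:
  assumes "\<And>e \<delta>. e > 0 \<Longrightarrow> \<delta> > 0 \<Longrightarrow> \<forall>\<^sub>F N in sequentially.
      dev_prob p X c T e N \<le> \<delta>"
  shows "conv_prob p T X c"
  unfolding conv_prob_def
proof (intro allI impI)
  fix e :: real assume e: "e > 0"
  show "dev_prob p X c T e \<longlonglongrightarrow> 0"
  proof (rule tendstoI)
    fix r :: real assume r: "r > 0"
    have "\<forall>\<^sub>F N in sequentially. dev_prob p X c T e N \<le> r / 2"
      using assms[OF e, of "r/2"] r by simp
    then show "\<forall>\<^sub>F N in sequentially. dist (dev_prob p X c T e N) 0 < r"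
    proof (rule eventually_mono)
      fix N assume "dev_prob p X c T e N \<le> r / 2"
      moreover have "0 \<le> dev_prob p X c T e N"
        using p01' by (intro subset_expect_nonneg) auto
      ultimately show "dist (dev_prob p X c T e N) 0 < r"
        using r by simp
    qed
  qed
qed

lemma conv_probD:
  assumes "conv_prob p T X c" "e > 0" "\<delta> > 0"
  shows "\<forall>\<^sub>F N in sequentially. dev_prob p X c T e N \<le> \<delta>"
proof -
  have "\<forall>\<^sub>F N in sequentially. dist (dev_prob p X c T e N) 0 < \<delta>"
    using assms unfolding conv_prob_def by (intro tendstoD) auto
  then show ?thesis by (rule eventually_mono) auto
qed

lemma conv_prob_add:
  assumes X: "conv_prob p T X c" and Y: "conv_prob p T Y c'"
  shows "conv_prob p T (\<lambda>N A. X N A + Y N A) (c + c')"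
proof (rule conv_probI)
  fix e \<delta> :: real assume e: "e > 0" and d: "\<delta> > 0"
  have "e / 2 > 0" "\<delta> / 2 > 0" using e d by auto
  from conv_probD[OF X this] conv_probD[OF Y this]
  show "\<forall>\<^sub>F N in sequentially.
      subset_expect (p N) {0..int N} (\<lambda>A. of_bool (\<bar>X N A + Y N A - (c + c') * T N\<bar> > e * T N)) \<le> \<delta>"
  proof eventually_elim
    case (elim N)
    have "subset_expect (p N) {0..int N} (\<lambda>A. of_bool (\<bar>X N A + Y N A - (c + c') * T N\<bar> > e * T N))
      \<le> subset_expect (p N) {0..int N} (\<lambda>A. of_bool (\<bar>X N A - c * T N\<bar> > e / 2 * T N) + of_bool (\<bar>Y N A - c' * T N\<bar> > e / 2 * T N))"
    proof (intro subset_expect_mono p01')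
      fix A
      have "\<bar>X N A + Y N A - (c + c') * T N\<bar> \<le> \<bar>X N A - c * T N\<bar> + \<bar>Y N A - c' * T N\<bar>"
        by (simp add: algebra_simps)
      moreover have "e * T N = e / 2 * T N + e / 2 * T N" by simp
      ultimately show "of_bool (\<bar>X N A + Y N A - (c + c') * T N\<bar> > e * T N)
        \<le> (of_bool (\<bar>X N A - c * T N\<bar> > e / 2 * T N) + of_bool (\<bar>Y N A - c' * T N\<bar> > e / 2 * T N) :: real)"
        by (auto simp: of_bool_def)
    qed
    then show ?case using elim by (simp add: subset_expect_add)
  qed
qed

lemma conv_prob_mono0:
  assumes Y: "conv_prob p T Y 0" and XY: "\<forall>\<^sub>F N in sequentially. \<forall>A\<subseteq>{0..int N}. \<bar>X N A\<bar> \<le> \<bar>Y N A\<bar>"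
  shows "conv_prob p T X 0"
proof (rule conv_probI)
  fix e \<delta> :: real assume e: "e > 0" and d: "\<delta> > 0"
  from conv_probD[OF Y e d] XY
  show "\<forall>\<^sub>F N in sequentially. dev_prob p X 0 T e N \<le> \<delta>"
  proof eventually_elim
    case (elim N)
    have "dev_prob p X 0 T e N
        \<le> dev_prob p Y 0 T e N"
    proof (intro subset_expect_mono p01')
      fix A assume "A \<subseteq> {0..int N}"
      then have "\<bar>X N A\<bar> \<le> \<bar>Y N A\<bar>" using elim(2) by blast
      then show "of_bool (\<bar>X N A - 0 * T N\<bar> > e * T N) \<le> (of_bool (\<bar>Y N A - 0 * T N\<bar> > e * T N) :: real)"
        by (auto simp: of_bool_def)
    qed
    then show ?case using elim(1) by linarith
  qed
qed

lemma conv_prob_cong: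
  assumes "conv_prob p T X c" "\<forall>\<^sub>F N in sequentially. \<forall>A\<subseteq>{0..int N}. X N A = Y N A"
  shows "conv_prob p T Y c"
proof (rule conv_probI)
  fix e \<delta> :: real assume e: "e > 0" and d: "\<delta> > 0"
  from conv_probD[OF assms(1) e d] assms(2)
  show "\<forall>\<^sub>F N in sequentially. dev_prob p Y c T e N \<le> \<delta>"
  proof eventually_elim
    case (elim N)
    have "dev_prob p Y c T e N
       = dev_prob p X c T e N"
      using elim(2) by (intro subset_expect_cong) simp
    then show ?case using elim(1) by simp
  qed
qed

text \<open>The relative error \<open>e1\<close> becomes the absolute error \<open>e1 * c\<close> at
  scale \<open>T\<close>; here positivity of \<open>c\<close> enters.\<close>

lemma rv_asymp_conv_prob:
  assumes X: "conv_prob p T X c" and c: "c > 0" and T: "\<forall>\<^sub>F N in sequentially. T N > 0"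
    and f: "\<forall>\<^sub>F N in sequentially. f N = c * T N"
  shows "rv_asymp (\<lambda>N. random_subset N (p N)) X f"
  unfolding rv_asymp_def
proof (intro allI impI)
  fix e1 e2 :: real assume e: "e1 > 0" "e2 > 0"
  have "e1 * c > 0" "e2 / 2 > 0" using e c by auto
  from conv_probD[OF X this] T f
  show "\<forall>\<^sub>F N in sequentially. measure_pmf.prob (random_subset N (p N))
        {\<omega>. X N \<omega> \<notin> {(1 - e1) * f N..(1 + e1) * f N}} < e2"
  proof eventually_elim
    case (elim N)
    have "measure_pmf.prob (random_subset N (p N)) {\<omega>. X N \<omega> \<notin> {(1 - e1) * f N..(1 + e1) * f N}}
      = subset_expect (p N) {0..int N} (\<lambda>A. of_bool (X N A \<notin> {(1 - e1) * f N..(1 + e1) * f N}))"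
      by (rule prob_random_subset[OF p01'])
    also have "\<dots> \<le> subset_expect (p N) {0..int N} (\<lambda>A. of_bool (\<bar>X N A - c * T N\<bar> > e1 * c * T N))"
    proof (intro subset_expect_mono p01')
      fix A
      have "\<bar>X N A - c * T N\<bar> > e1 * c * T N" if "X N A \<notin> {(1 - e1) * f N..(1 + e1) * f N}"
        using that elim(3) by (auto simp: algebra_simps)
      then show "of_bool (X N A \<notin> {(1 - e1) * f N..(1 + e1) * f N}) \<le> (of_bool (\<bar>X N A - c * T N\<bar> > e1 * c * T N) :: real)"
        by auto
    qed
    also have "\<dots> < e2" using elim(1) e by simp
    finally show ?case .
  qed
qed

text \<open>Chebyshev around \<open>c * T N\<close> in place of the mean, so one-sided moment bounds
  are enough: \<open>u - 2 * c * l + c\<^sup>2\<close> tends to 0.\<close>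

lemma conv_prob_moments:
  assumes T: "filterlim T at_top sequentially"
    and b: "\<forall>\<^sub>F N in sequentially. subset_expect (p N) {0..int N} (\<lambda>A. (X N A)\<^sup>2) \<le> u N * (T N)\<^sup>2"
    and a: "\<forall>\<^sub>F N in sequentially. l N * T N \<le> subset_expect (p N) {0..int N} (X N)"
    and u: "u \<longlonglongrightarrow> c\<^sup>2" and l: "l \<longlonglongrightarrow> c" and c: "0 \<le> c"
  shows "conv_prob p T X c"
proof (rule conv_probI)
  fix e \<delta> :: real assume e: "e > 0" and d: "\<delta> > 0"
  have "(\<lambda>N. (u N - 2 * c * l N + c\<^sup>2) / e\<^sup>2) \<longlonglongrightarrow> (c\<^sup>2 - 2 * c * c + c\<^sup>2) / e\<^sup>2"
    using e by (intro tendsto_intros u l) auto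
  also have "(c\<^sup>2 - 2 * c * c + c\<^sup>2) / e\<^sup>2 = 0" by (simp add: power2_eq_square)
  finally have "\<forall>\<^sub>F N in sequentially. dist ((u N - 2 * c * l N + c\<^sup>2) / e\<^sup>2) 0 < \<delta>" using d by (rule tendstoD)
  moreover have "\<forall>\<^sub>F N in sequentially. T N > 0" using T unfolding filterlim_at_top_dense by blast
  ultimately show "\<forall>\<^sub>F N in sequentially. dev_prob p X c T e N \<le> \<delta>"
    using a b
  proof eventually_elim
    case (elim N)
    let ?E = "subset_expect (p N) {0..int N}"
    have "?E (\<lambda>A. of_bool (\<bar>X N A - c * T N\<bar> > e * T N))
      \<le> (?E (\<lambda>A. (X N A)\<^sup>2) - 2 * (c * T N) * ?E (X N) + (c * T N)\<^sup>2) / (e * T N)\<^sup>2"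
      using e elim by (intro subset_expect_chebyshev p01') auto
    also have "\<dots> \<le> (u N * (T N)\<^sup>2 - 2 * (c * T N) * (l N * T N) + (c * T N)\<^sup>2) / (e * T N)\<^sup>2"
      using elim c by (intro divide_right_mono add_mono diff_mono mult_left_mono) auto
    also have "\<dots> = (u N - 2 * c * l N + c\<^sup>2) / e\<^sup>2"
    proof -
      have "u N * (T N)\<^sup>2 - 2 * (c * T N) * (l N * T N) + (c * T N)\<^sup>2 = (u N - 2 * c * l N + c\<^sup>2) * (T N)\<^sup>2"
        by (simp add: power2_eq_square algebra_simps)
      then show ?thesis using elim(2) by (simp add: power_mult_distrib)
    qed
    also have "\<dots> \<le> \<delta>" using elim(1) unfolding dist_real_def by linarith
    finally show ?case .
  qed
qed

end

context sumdiff_params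
begin

definition value_at :: "nat \<Rightarrow> nat \<Rightarrow> int" where "value_at N m = int m - int d * int N"

text \<open>Counts all tuples, also those with repeated entries, as if each cost
  \<open>q ^ h\<close>. It thus bounds the mean over distinct elements from above, has an exact
  formula, and is off by a lower order term unless the value is 0.\<close>

definition rep_mean :: "nat \<Rightarrow> real \<Rightarrow> nat \<Rightarrow> real" where
  "rep_mean N q m = real (box_count h N (int m)) * q ^ h / (fact s * fact d)"

lemma value_at_box: "m \<le> B \<Longrightarrow> reps N (value_at N m) \<subseteq> PiE {..<h} (box N B)"
  by (rule reps_subset_box) (simp add: value_at_def)

lemma value_at_box_inj_reps: "m \<le> B \<Longrightarrow> inj_reps N (value_at N m) \<subseteq> PiE {..<h} (box N B)"
  using value_at_box inj_reps_subset_reps by blast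

lemma card_reps_value_at: "card (reps N (value_at N m)) = box_count h N (int m)"
  by (simp add: card_reps value_at_def)

lemma box_count_le: "m \<le> B \<Longrightarrow> box_count h N (int m) \<le> Suc B ^ (h - 1)"
  unfolding card_reps_value_at[symmetric]
  by (rule card_linear[where W = "{..<h}" and k = "value_at N m" and N = N, OF value_at_box])
     (use h2 in \<open>auto simp: reps_def signed_sum_def lessThan_empty_iff\<close>)

lemma card_rep_pairs_q_le: "0 \<le> q \<Longrightarrow> real (card (rep_pairs N (value_at N m))) * q ^ h \<le> rep_mean N q m"
proof -
  assume q: "0 \<le> q"
  have "fact s * fact d * card (rep_pairs N (value_at N m)) \<le> box_count h N (int m)"
    unfolding card_inj_reps[symmetric] card_reps_value_at[symmetric]
    by (rule card_mono) (use inj_reps_subset_reps in auto)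
  then have "real (fact s * fact d * card (rep_pairs N (value_at N m))) \<le> real (box_count h N (int m))" by (rule of_nat_mono)
  then have "real (card (rep_pairs N (value_at N m))) \<le> real (box_count h N (int m)) / (fact s * fact d)"
    by (simp add: field_simps)
  then have "real (card (rep_pairs N (value_at N m))) * q ^ h \<le> real (box_count h N (int m)) / (fact s * fact d) * q ^ h"
    using q by (intro mult_right_mono) auto
  then show ?thesis by (simp add: rep_mean_def)
qed

lemma card_rep_pairs_q_ge:
  assumes "0 \<le> q" "m \<le> B" "value_at N m \<noteq> 0"
  shows "rep_mean N q m - (real h)\<^sup>2 * real (Suc B) ^ (h - 2) * q ^ h \<le> real (card (rep_pairs N (value_at N m))) * q ^ h"
proof -
  let ?F = "fact s * fact d :: real"
  have F1: "1 \<le> ?F" using mult_mono[of 1 "fact s :: real" 1 "fact d"] by (simp add: fact_ge_1)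
  have "box_count h N (int m) \<le> fact s * fact d * card (rep_pairs N (value_at N m)) + h\<^sup>2 * Suc B ^ (h - 2)"
    unfolding card_inj_reps[symmetric] card_reps_value_at[symmetric]
    by (rule card_reps_le_inj_reps[OF assms(3)]) (use assms(2) in \<open>simp add: value_at_def\<close>)
  then have "real (box_count h N (int m)) \<le> real (fact s * fact d * card (rep_pairs N (value_at N m)) + h\<^sup>2 * Suc B ^ (h - 2))"
    by (rule of_nat_mono)
  then have "real (box_count h N (int m)) \<le> ?F * real (card (rep_pairs N (value_at N m))) + (real h)\<^sup>2 * real (Suc B) ^ (h - 2)"
    by (simp del: of_nat_Suc)
  also have "\<dots> \<le> ?F * real (card (rep_pairs N (value_at N m))) + ?F * ((real h)\<^sup>2 * real (Suc B) ^ (h - 2))"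
    using mult_right_mono[OF F1, of "(real h)\<^sup>2 * real (Suc B) ^ (h - 2)"] by (simp del: of_nat_Suc)
  finally have "real (box_count h N (int m)) / ?F \<le> real (card (rep_pairs N (value_at N m))) + (real h)\<^sup>2 * real (Suc B) ^ (h - 2)"
    using F1 by (simp add: pos_divide_le_eq algebra_simps del: of_nat_Suc)
  then have "real (box_count h N (int m)) / ?F * q ^ h \<le> (real (card (rep_pairs N (value_at N m))) + (real h)\<^sup>2 * real (Suc B) ^ (h - 2)) * q ^ h"
    using assms by (intro mult_right_mono) auto
  then show ?thesis by (simp add: rep_mean_def algebra_simps del: of_nat_Suc)
qed

lemma rep_mean_nonneg: "0 \<le> q \<Longrightarrow> 0 \<le> rep_mean N q m" by (simp add: rep_mean_def)

text \<open>Replacing the product bound by an exponential costs only the factor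
  \<open>exp (- 2 * \<Lambda> * q)\<close>, uniformly over values with mean at most
  \<open>\<Lambda>\<close>.\<close>

lemma avoids_expectation_lower:
  assumes q: "0 \<le> q" "q \<le> 1/2" and Lam: "\<And>m. m \<le> M \<Longrightarrow> rep_mean N q m \<le> \<Lambda>"
  shows "exp (- 2 * \<Lambda> * q) * (\<Sum>m\<le>M. exp (- rep_mean N q m))
     \<le> subset_expect q {0..int N} (\<lambda>A. \<Sum>m\<le>M. of_bool (avoids N (value_at N m) A))"
proof -
  have q1: "q \<le> 1" using q by simp
  let ?x = "q ^ h"
  have xq: "?x \<le> q" using power_decreasing[of 1 h q] q h2 by simp
  have x: "0 \<le> ?x" "?x \<le> 1/2" using q xq by auto
  have "exp (- 2 * \<Lambda> * q) * exp (- rep_mean N q m) \<le> subset_expect q {0..int N} (\<lambda>A. of_bool (avoids N (value_at N m) A))" if m: "m \<le> M" for m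
  proof -
    let ?n = "real (card (rep_pairs N (value_at N m)))"
    have nx: "?n * ?x \<le> rep_mean N q m" using card_rep_pairs_q_le[OF q(1)] .
    have L0: "0 \<le> rep_mean N q m" using rep_mean_nonneg[OF q(1)] .
    have "exp (- 2 * \<Lambda> * q) * exp (- rep_mean N q m) = exp (- (rep_mean N q m + 2 * \<Lambda> * q))"
      by (simp flip: exp_add)
    \<comment> \<open>Prepares for \<open>ln (1 - x) \<ge> - x - 2 * x\<^sup>2\<close> with
      \<open>x = q ^ h \<le> q\<close>: the quadratic term costs at most
      \<open>2 * \<Lambda> * q\<close>.\<close>
    also have "\<dots> \<le> exp (?n * (- ?x - 2 * ?x\<^sup>2))"
    proof -
      have "?n * (?x + 2 * ?x\<^sup>2) = ?n * ?x + 2 * (?n * ?x) * ?x"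
        by (simp add: power2_eq_square algebra_simps)
      also have "\<dots> \<le> rep_mean N q m + 2 * \<Lambda> * q"
        using nx xq x L0 Lam[OF m] q by (intro add_mono mult_mono) auto
      finally have "- (rep_mean N q m + 2 * \<Lambda> * q) \<le> ?n * (- ?x - 2 * ?x\<^sup>2)" by (simp add: algebra_simps)
      then show ?thesis by simp
    qed
    also have "\<dots> \<le> exp (?n * ln (1 - ?x))"
      using ln_one_minus_pos_lower_bound[OF x] by (simp add: mult_left_mono)
    also have "\<dots> = (1 - ?x) ^ card (rep_pairs N (value_at N m))"
      using x by (simp add: exp_of_nat_mult)
    also have "\<dots> \<le> subset_expect q {0..int N} (\<lambda>A. of_bool (avoids N (value_at N m) A))"
      by (rule avoids_lower[OF q(1) q1])
    finally show ?thesis .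
  qed
  then show ?thesis unfolding subset_expect_sum sum_distrib_left by (intro sum_mono) auto
qed

text \<open>The square is expanded into pairs. A generic pair almost factorizes:
  \<open>\<eta>\<close> pays for repeated entries and \<open>D\<close> for each of the four
  overlaps. Exceptional pairs are bounded by 1.\<close>

lemma avoids_expectation_upper:
  assumes q: "0 \<le> q" "q \<le> 1" and y: "1 \<le> real (Suc M) * q"
  defines "\<eta> \<equiv> (real h)\<^sup>2 * real (Suc M) ^ (h - 2) * q ^ h"
    and "D \<equiv> overlap_const * (real (Suc M) * q) ^ (2 * h - 1) / (real (Suc M))\<^sup>2"
  shows "subset_expect q {0..int N} (\<lambda>A. (\<Sum>m\<le>M. of_bool (avoids N (value_at N m) A))\<^sup>2)
     \<le> exp (2 * \<eta> + 4 * D) * (\<Sum>m\<le>M. exp (- rep_mean N q m))\<^sup>2 + 4 * real (Suc M)"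
proof -
  let ?a = "\<lambda>m A. of_bool (avoids N (value_at N m) A) :: real"
  \<comment> \<open>Two-value Janson needs different values, the overlap bounds need that no two of
    the values involved add up to 0, and the comparison with \<open>rep_mean\<close> needs nonzero
    values.\<close>
  let ?bad = "\<lambda>m l. m = l \<or> value_at N m + value_at N l = 0 \<or> value_at N m = 0 \<or> value_at N l = 0"
  let ?E = "exp (2 * \<eta> + 4 * D)"
  have pair: "subset_expect q {0..int N} (\<lambda>A. ?a m A * ?a l A) \<le> ?E * (exp (- rep_mean N q m) * exp (- rep_mean N q l)) + of_bool (?bad m l)"
    if m: "m \<le> M" and l: "l \<le> M" for m l
  proof (cases "?bad m l")
    case True
    have "subset_expect q {0..int N} (\<lambda>A. ?a m A * ?a l A) \<le> subset_expect q {0..int N} (\<lambda>A. 1)"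
      using q by (intro subset_expect_mono) auto
    also have "\<dots> = 1" by (simp add: subset_expect_const)
    also have "\<dots> \<le> ?E * (exp (- rep_mean N q m) * exp (- rep_mean N q l)) + of_bool (?bad m l)" using True by simp
    finally show ?thesis .
  next
    case False
    have ne: "value_at N m \<noteq> value_at N l" using False by (simp add: value_at_def)
    have dl: "overlap N q (value_at N u) (value_at N v) \<le> D" if "u \<le> M" "v \<le> M" "value_at N u + value_at N v \<noteq> 0" for u v
      unfolding D_def using that by (intro overlap_le q y value_at_box_inj_reps)
    have dd: "overlap N q (value_at N m) (value_at N m) + overlap N q (value_at N m) (value_at N l) + overlap N q (value_at N l) (value_at N m) + overlap N q (value_at N l) (value_at N l) \<le> 4 * D"
      using dl[OF m m] dl[OF m l] dl[OF l m] dl[OF l l] False by (simp add: add.commute)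
    have cc: "rep_mean N q m - \<eta> \<le> real (card (rep_pairs N (value_at N m))) * q ^ h" "rep_mean N q l - \<eta> \<le> real (card (rep_pairs N (value_at N l))) * q ^ h"
      unfolding \<eta>_def using False by (intro card_rep_pairs_q_ge q m l; blast)+
    have "subset_expect q {0..int N} (\<lambda>A. ?a m A * ?a l A)
       \<le> exp (- real (card (rep_pairs N (value_at N m)) + card (rep_pairs N (value_at N l))) * q ^ h + (overlap N q (value_at N m) (value_at N m) + overlap N q (value_at N m) (value_at N l) + overlap N q (value_at N l) (value_at N m) + overlap N q (value_at N l) (value_at N l)))"
      by (rule avoids_upper2[OF q ne])
    also have "\<dots> \<le> exp ((2 * \<eta> + 4 * D) + (- rep_mean N q m + - rep_mean N q l))"
      using dd cc by (simp add: algebra_simps)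
    also have "\<dots> = ?E * (exp (- rep_mean N q m) * exp (- rep_mean N q l))" by (simp only: exp_add)
    finally show ?thesis using False by simp
  qed
  have badcount: "(\<Sum>m\<le>M. \<Sum>l\<le>M. of_bool (?bad m l)) \<le> 4 * real (Suc M)"
  proof -
    have one: "card {l\<in>{..M}. int l = z} \<le> 1" for z
    proof -
      have "card {l\<in>{..M}. int l = z} \<le> card {nat z}" by (intro card_mono) auto
      then show ?thesis by simp
    qed
    have o: "(\<Sum>l\<le>M. of_bool (int l = z)) \<le> (1::real)" for z
      using one[of z] by (simp add: sum_of_bool_eq Int_def)
    have "(\<Sum>m\<le>M. \<Sum>l\<le>M. of_bool (?bad m l)) \<le>
      (\<Sum>m\<le>M. \<Sum>l\<le>M. of_bool (int l = int m) + of_bool (int l = 2 * (int d * int N) - int m)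
         + of_bool (int m = int d * int N) + (of_bool (int l = int d * int N) :: real))"
    proof (intro sum_mono)
      fix m l
      have "int l = int m \<or> int l = 2 * z - int m \<or> int m = z \<or> int l = z"
        if "m = l \<or> (int m - z) + (int l - z) = 0 \<or> int m - z = 0 \<or> int l - z = 0" for z
        using that by auto
      from this[of "int d * int N"]
      have bad: "?bad m l \<Longrightarrow> int l = int m \<or> int l = 2 * (int d * int N) - int m \<or> int m = int d * int N \<or> int l = int d * int N"
        by (simp only: value_at_def)
      have aux: "(P \<Longrightarrow> U1 \<or> U2 \<or> U3 \<or> U4) \<Longrightarrow> of_bool P \<le> of_bool U1 + of_bool U2 + of_bool U3 + (of_bool U4 :: real)"
        for P U1 U2 U3 U4 :: bool
        by (cases P; cases U1; cases U2; cases U3; cases U4) simp_all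
      show "of_bool (?bad m l) \<le> of_bool (int l = int m) + of_bool (int l = 2 * (int d * int N) - int m)
         + of_bool (int m = int d * int N) + (of_bool (int l = int d * int N) :: real)"
        by (rule aux, rule bad)
    qed
    \<comment> \<open>The third condition fixes \<open>m\<close>, not \<open>l\<close>; after
      swapping the sums the same one-point bound \<open>o\<close> applies.\<close>
    also have "\<dots> = (\<Sum>m\<le>M. (\<Sum>l\<le>M. of_bool (int l = int m))) + (\<Sum>m\<le>M. (\<Sum>l\<le>M. of_bool (int l = 2 * (int d * int N) - int m)))
         + (\<Sum>l\<le>M. (\<Sum>m\<le>M. of_bool (int m = int d * int N))) + (\<Sum>m\<le>M. (\<Sum>l\<le>M. of_bool (int l = int d * int N)))"
      by (subst (3) sum.swap) (simp only: sum.distrib)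
    also have "\<dots> \<le> (\<Sum>m\<le>M. 1) + (\<Sum>m\<le>M. 1) + (\<Sum>m\<le>M. 1) + (\<Sum>m\<le>M. 1)"
      by (intro add_mono sum_mono o)
    finally show ?thesis by simp
  qed
  have "subset_expect q {0..int N} (\<lambda>A. (\<Sum>m\<le>M. ?a m A)\<^sup>2) = subset_expect q {0..int N} (\<lambda>A. \<Sum>m\<le>M. \<Sum>l\<le>M. ?a m A * ?a l A)"
    by (simp only: power2_eq_square sum_product)
  also have "\<dots> = (\<Sum>m\<le>M. \<Sum>l\<le>M. subset_expect q {0..int N} (\<lambda>A. ?a m A * ?a l A))"
    by (simp only: subset_expect_sum)
  also have "\<dots> \<le> (\<Sum>m\<le>M. \<Sum>l\<le>M. ?E * (exp (- rep_mean N q m) * exp (- rep_mean N q l)) + of_bool (?bad m l))"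
    by (intro sum_mono pair) auto
  also have "\<dots> = ?E * (\<Sum>m\<le>M. exp (- rep_mean N q m))\<^sup>2 + (\<Sum>m\<le>M. \<Sum>l\<le>M. of_bool (?bad m l))"
  proof -
    have "(\<Sum>m\<le>M. exp (- rep_mean N q m))\<^sup>2 = (\<Sum>m\<le>M. \<Sum>l\<le>M. exp (- rep_mean N q m) * exp (- rep_mean N q l))"
      by (simp only: power2_eq_square sum_product)
    then show ?thesis by (simp only: sum.distrib sum_distrib_left)
  qed
  also have "\<dots> \<le> ?E * (\<Sum>m\<le>M. exp (- rep_mean N q m))\<^sup>2 + 4 * real (Suc M)"
    using badcount by simp
  finally show ?thesis .
qed

text \<open>If \<open>f i = f j\<close>, the value depends only on the remaining
  \<open>h - 1\<close> coordinates; there are at most \<open>h\<^sup>2\<close> choices of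
  \<open>i\<close> and \<open>j\<close>.\<close>

lemma card_noninj_values:
  assumes "finite A"
  shows "finite {k. \<exists>f\<in>{..<h} \<rightarrow>\<^sub>E A. \<not> inj_on f {..<h} \<and> signed_sum f = k}"
    "card {k. \<exists>f\<in>{..<h} \<rightarrow>\<^sub>E A. \<not> inj_on f {..<h} \<and> signed_sum f = k} \<le> h\<^sup>2 * card A ^ (h - 1)"
proof -
  let ?K = "{k. \<exists>f\<in>{..<h} \<rightarrow>\<^sub>E A. \<not> inj_on f {..<h} \<and> signed_sum f = k}"
  let ?P = "{..<h} \<times> {..<h}"
  let ?G = "\<lambda>(i,j). (\<lambda>g. signed_sum (g(j := g i))) ` (({..<h} - {j}) \<rightarrow>\<^sub>E A)"
  have sub: "?K \<subseteq> (\<Union>z\<in>?P. ?G z)"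
  proof clarify
    fix f assume f: "f \<in> {..<h} \<rightarrow>\<^sub>E A" "\<not> inj_on f {..<h}"
    then obtain i j where ij: "i < h" "j < h" "i \<noteq> j" "f i = f j" by (auto simp: inj_on_def)
    let ?g = "restrict f ({..<h} - {j})"
    have "?g \<in> ({..<h} - {j}) \<rightarrow>\<^sub>E A" using f(1) by (auto simp: PiE_iff)
    moreover have "signed_sum f = signed_sum (?g(j := ?g i))"
      unfolding signed_sum_def using ij by (intro sum.cong) auto
    ultimately show "signed_sum f \<in> (\<Union>z\<in>?P. ?G z)"
      using ij by (intro UN_I[of "(i,j)"]) (simp_all only: prod.case mem_Sigma_iff lessThan_iff, blast intro: image_eqI)
  qed
  have fin: "finite (?G z)" for z using assms by (cases z) (auto intro!: finite_imageI finite_PiE)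
  have finU: "finite (\<Union>z\<in>?P. ?G z)" by (rule finite_UN_I) (use fin in simp_all)
  show "finite ?K" by (rule finite_subset[OF sub finU])
  have "card ?K \<le> card (\<Union>z\<in>?P. ?G z)" by (rule card_mono[OF finU sub])
  also have "\<dots> \<le> (\<Sum>z\<in>?P. card (?G z))" by (intro card_UN_le) auto
  also have "\<dots> \<le> (\<Sum>z\<in>?P. card A ^ (h - 1))"
  proof (intro sum_mono)
    fix z assume "z \<in> ?P"
    then obtain i j where z: "z = (i,j)" "j < h" by auto
    have "card (?G z) \<le> card (({..<h} - {j}) \<rightarrow>\<^sub>E A)"
      unfolding z(1) prod.case using assms by (intro card_image_le finite_PiE) auto
    also have "\<dots> = card A ^ (h - 1)" using z(2) by (simp add: card_funcsetE)
    finally show "card (?G z) \<le> card A ^ (h - 1)" .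
  qed
  also have "\<dots> = h\<^sup>2 * card A ^ (h - 1)" by (simp add: card_cartesian_product power2_eq_square)
  finally show "card ?K \<le> h\<^sup>2 * card A ^ (h - 1)" .
qed

definition low_missing :: "nat \<Rightarrow> nat \<Rightarrow> int set \<Rightarrow> nat" where
  "low_missing N M A = card {m\<in>{..M}. value_at N m \<notin> sumdiff_set s d A}"

lemma rep_pairs_imp_sumdiff: "\<not> avoids N k A \<Longrightarrow> k \<in> sumdiff_set s d A"
proof -
  assume "\<not> avoids N k A"
  then obtain f where f: "f \<in> inj_reps N k" "f ` {..<h} \<subseteq> A" by (auto simp: avoids_def rep_pairs_def supp_blocks)
  then have "f \<in> {..<h} \<rightarrow>\<^sub>E A" by (auto simp: inj_reps_def inj_tuples_def PiE_iff)
  then show ?thesis using f(1) unfolding sumdiff_set_iff by (auto simp: inj_reps_def)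
qed

text \<open>A value that is avoided but not missing has a representation with a repeated element,
  and by the box bound all its entries lie within \<open>M\<close> of an end of the interval. So
  only the few elements of \<open>A\<close> there count.\<close>

lemma low_missing_diff:
  assumes A: "A \<subseteq> {0..int N}"
  shows "\<bar>real (low_missing N M A) - (\<Sum>m\<le>M. of_bool (avoids N (value_at N m) A))\<bar>
     \<le> (real h)\<^sup>2 * real (card (A \<inter> ({0..int M} \<union> {int N - int M..int N}))) ^ (h - 1)"
proof -
  let ?A = "A \<inter> ({0..int M} \<union> {int N - int M..int N})"
  let ?K = "{k. \<exists>f\<in>{..<h} \<rightarrow>\<^sub>E ?A. \<not> inj_on f {..<h} \<and> signed_sum f = k}"
  let ?X = "{m\<in>{..M}. value_at N m \<notin> sumdiff_set s d A}" and ?Y = "{m\<in>{..M}. avoids N (value_at N m) A}"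
  have XY: "?X \<subseteq> ?Y" using rep_pairs_imp_sumdiff by auto
  have inj: "inj_on (value_at N) S" for S by (auto simp: inj_on_def value_at_def)
  have "value_at N ` (?Y - ?X) \<subseteq> ?K"
  proof (rule image_subsetI)
    fix m assume "m \<in> ?Y - ?X"
    then have m: "m \<le> M" "avoids N (value_at N m) A" "value_at N m \<in> sumdiff_set s d A" by auto
    then obtain f where f: "f \<in> {..<h} \<rightarrow>\<^sub>E A" "signed_sum f = value_at N m" by (auto simp: sumdiff_set_iff)
    have fr: "f \<in> reps N (value_at N m)" using f A unfolding reps_def by (auto simp: PiE_iff)
    have "\<not> inj_on f {..<h}"
    proof
      assume "inj_on f {..<h}"
      then have "f \<in> inj_reps N (value_at N m)" using fr by (auto simp: inj_reps_def inj_tuples_def reps_def)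
      then have "blocks f \<in> rep_pairs N (value_at N m)" by (simp add: rep_pairs_def)
      moreover have "supp (blocks f) \<subseteq> A" unfolding supp_blocks using f(1) by auto
      ultimately show False using m(2) by (auto simp: avoids_def)
    qed
    moreover have "f \<in> {..<h} \<rightarrow>\<^sub>E ?A"
    proof -
      have fb: "f \<in> PiE {..<h} (box N M)" using value_at_box[OF m(1)] fr by blast
      have "f i \<in> ?A" if "i < h" for i
        using PiE_mem[OF f(1), of i] PiE_mem[OF fb, of i] that by (auto simp: box_def split: if_splits)
      then show ?thesis using f(1) by (auto simp: PiE_iff)
    qed
    ultimately show "value_at N m \<in> ?K" using f(2) by blast
  qed
  moreover have finA: "finite ?A" by auto
  ultimately have "card (value_at N ` (?Y - ?X)) \<le> card ?K"
    using card_noninj_values(1)[OF finA] by (intro card_mono) auto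
  also have "\<dots> \<le> h\<^sup>2 * card ?A ^ (h - 1)" by (rule card_noninj_values(2)[OF finA])
  finally have "card (?Y - ?X) \<le> h\<^sup>2 * card ?A ^ (h - 1)" by (simp add: card_image[OF inj])
  then have "real (card (?Y - ?X)) \<le> real (h\<^sup>2 * card ?A ^ (h - 1))" by (rule of_nat_mono)
  then have "real (card (?Y - ?X)) \<le> (real h)\<^sup>2 * real (card ?A) ^ (h - 1)" by simp
  moreover have "real (card (?Y - ?X)) = real (card ?Y) - real (card ?X)"
    using XY by (simp add: card_Diff_subset card_mono)
  moreover have "card ?X \<le> card ?Y" using XY by (intro card_mono) auto
  moreover have "(\<Sum>m\<le>M. of_bool (avoids N (value_at N m) A)) = real (card ?Y)"
    by (simp add: sum_of_bool_eq Int_def)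
  ultimately show ?thesis unfolding low_missing_def by linarith
qed

end

section \<open>Missing values in a window\<close>

locale sumdiff_seq = sumdiff_params s d h + prob_seq p for s d h :: nat and p :: "nat \<Rightarrow> real"
begin

lemma expectation_card_Int:
  assumes "finite V"
  shows "subset_expect (p N) {0..int N} (\<lambda>A. real (card (A \<inter> V))) \<le> real (card V) * p N"
proof -
  have "subset_expect (p N) {0..int N} (\<lambda>A. real (card (A \<inter> V))) = subset_expect (p N) {0..int N} (\<lambda>A. \<Sum>v\<in>V. of_bool ({v} \<subseteq> A))"
    using assms by (intro subset_expect_cong) (simp add: sum_of_bool_eq Int_def conj_commute)
  also have "\<dots> = (\<Sum>v\<in>V. subset_expect (p N) {0..int N} (\<lambda>A. of_bool ({v} \<subseteq> A)))" by (rule subset_expect_sum)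
  also have "\<dots> \<le> (\<Sum>v\<in>V. p N)"
  proof (intro sum_mono)
    fix v
    show "subset_expect (p N) {0..int N} (\<lambda>A. of_bool ({v} \<subseteq> A)) \<le> p N"
    proof (cases "v \<in> {0..int N}")
      case True
      then show ?thesis using subset_expect_subset_prob[of "{0..int N}" "{v}" "p N"] by simp
    next
      case False
      then have "subset_expect (p N) {0..int N} (\<lambda>A. of_bool ({v} \<subseteq> A)) = subset_expect (p N) {0..int N} (\<lambda>A. 0)"
        by (intro subset_expect_cong) auto
      then show ?thesis using p01'[of N] by (simp add: subset_expect_const)
    qed
  qed
  finally show ?thesis by simp
qed

text \<open>Markov's inequality is applied to the count itself and then raised to the power
  \<open>n\<close>, which avoids higher moments.\<close>

lemma conv_prob_count:
  fixes T w :: "nat \<Rightarrow> real" and V :: "nat \<Rightarrow> int set"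
  assumes fin: "\<And>N. finite (V N)" and V: "\<forall>\<^sub>F N in sequentially. real (card (V N)) \<le> w N" and C: "0 \<le> C"
    and T: "\<forall>\<^sub>F N in sequentially. T N > 0" and w: "\<forall>\<^sub>F N in sequentially. w N > 0"
    and lim: "(\<lambda>N. (w N * p N) ^ n / T N) \<longlonglongrightarrow> 0"
  shows "conv_prob p T (\<lambda>N A. C * real (card (A \<inter> V N)) ^ n) 0"
proof (rule conv_probI)
  fix e \<delta> :: real assume e: "e > 0" and d: "\<delta> > 0"
  have "(\<lambda>N. C / (\<delta> ^ n) * ((w N * p N) ^ n / T N)) \<longlonglongrightarrow> C / (\<delta> ^ n) * 0"
    by (intro tendsto_intros lim)
  then have "\<forall>\<^sub>F N in sequentially. dist (C / (\<delta> ^ n) * ((w N * p N) ^ n / T N)) 0 < e"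
    using e by (intro tendstoD) auto
  with V T w show "\<forall>\<^sub>F N in sequentially. subset_expect (p N) {0..int N} (\<lambda>A. of_bool (\<bar>C * real (card (A \<inter> V N)) ^ n - 0 * T N\<bar> > e * T N)) \<le> \<delta>"
  proof eventually_elim
    case (elim N)
    let ?f = "\<lambda>A. real (card (A \<inter> V N))"
    let ?E = "subset_expect (p N) {0..int N}"
    \<comment> \<open>At this threshold Markov's inequality gives exactly
      \<open>\<delta>\<close>.\<close>
    define a where "a = w N * p N / \<delta>"
    have wp: "w N * p N > 0" using elim(3) p01 by simp
    have a: "a > 0" using wp d by (simp add: a_def)
    have lt: "C * a ^ n < e * T N"
    proof -
      have "C * a ^ n / T N = C / (\<delta> ^ n) * ((w N * p N) ^ n / T N)" by (simp add: a_def power_divide)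
      also have "\<dots> < e" using elim(4) unfolding dist_real_def by linarith
      finally show ?thesis using elim(2) by (simp add: pos_divide_less_eq)
    qed
    have "?E (\<lambda>A. of_bool (\<bar>C * ?f A ^ n - 0 * T N\<bar> > e * T N)) \<le> ?E (\<lambda>A. of_bool (?f A \<ge> a))"
    proof (intro subset_expect_mono p01')
      fix A
      have "\<not> \<bar>C * ?f A ^ n - 0 * T N\<bar> > e * T N" if "\<not> ?f A \<ge> a"
      proof -
        have "C * ?f A ^ n \<le> C * a ^ n" using that C by (intro mult_left_mono power_mono) auto
        moreover have "0 \<le> C * ?f A ^ n" using C by simp
        ultimately show ?thesis using lt by simp
      qed
      then show "of_bool (\<bar>C * ?f A ^ n - 0 * T N\<bar> > e * T N) \<le> (of_bool (?f A \<ge> a) :: real)"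
        by (cases "?f A \<ge> a") simp_all
    qed
    also have "\<dots> \<le> ?E ?f / a"
      by (rule subset_expect_markov[OF p01' a]) simp
    also have "\<dots> \<le> (w N * p N) / a"
    proof (rule divide_right_mono)
      have "?E ?f \<le> real (card (V N)) * p N" by (rule expectation_card_Int[OF fin])
      also have "\<dots> \<le> w N * p N" using elim(1) p01' by (intro mult_right_mono) auto
      finally show "?E ?f \<le> w N * p N" .
    qed (use a in simp)
    also have "\<dots> = \<delta>" using elim(3) p01[of N] d by (simp add: a_def)
    finally show ?case .
  qed
qed

lemma abs_exp_diff_le:
  fixes a b :: real
  assumes "0 \<le> a" "\<bar>a - b\<bar> \<le> e"
  shows "\<bar>exp (- a) - exp (- b)\<bar> \<le> exp e - 1"
proof -
  have ea: "exp (- a) \<le> 1" "0 < exp (- a)" using assms by auto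
  have e0: "0 \<le> e" using assms by linarith
  have 1: "exp (- b) \<le> exp (- a) * exp e"
    unfolding exp_add[symmetric] using assms by simp
  have 2: "exp (- a) \<le> exp (- b) * exp e"
    unfolding exp_add[symmetric] using assms by simp
  have "exp (- b) - exp (- a) \<le> exp (- a) * (exp e - 1)" using 1 by (simp add: algebra_simps)
  also have "\<dots> \<le> 1 * (exp e - 1)" using ea e0 by (intro mult_right_mono) auto
  finally have A: "exp (- b) - exp (- a) \<le> exp e - 1" by simp
  have "exp (- a) - exp (- b) \<le> exp (- a) - exp (- a) * exp (- e)"
    using 2 mult_right_mono[OF 2, of "exp (- e)"] by (simp add: mult.assoc flip: exp_add)
  also have "\<dots> = exp (- a) * (1 - exp (- e))" by (simp add: algebra_simps)
  also have "\<dots> \<le> 1 * (1 - exp (- e))" using ea e0 by (intro mult_right_mono) auto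
  also have "\<dots> \<le> exp e - 1"
  proof -
    have "1 - e \<le> exp (- e)" using exp_ge_add_one_self[of "- e"] by simp
    moreover have "1 + e \<le> exp e" by (rule exp_ge_add_one_self)
    ultimately show ?thesis by (simp only: mult_1_left)
  qed
  finally show ?thesis using A by linarith
qed

section \<open>Concentration of the missing count in a window of width \<open>L * T\<close> with
  bounded means\<close>

context
  fixes T :: "nat \<Rightarrow> real" and L D :: real and G :: "real \<Rightarrow> real"
  assumes p0: "p \<longlonglongrightarrow> 0"
    and T: "filterlim T at_top sequentially"
    and Tp: "filterlim (\<lambda>N. T N * p N) at_top sequentially"
    and L: "L > 0"
    and D: "\<forall>\<^sub>F N in sequentially. T N ^ (h - 1) * p N ^ h \<le> D"
begin

private definition M where "M N = nat \<lfloor>L * T N\<rfloor>"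
private definition b where "b N = real (Suc (M N))"
private definition D' where "D' = (2 * L) ^ (h - 1) * D"

private lemma Tbig: "\<forall>\<^sub>F N in sequentially. T N > z"
  using T unfolding filterlim_at_top_dense by blast

private lemma b_bounds: "\<forall>\<^sub>F N in sequentially. 0 < L * T N \<and> L * T N \<le> b N \<and> b N \<le> 2 * L * T N"
  using Tbig[of 0] Tbig[of "1 / L"]
proof eventually_elim
  case (elim N)
  have LT: "L * T N > 0" "L * T N > 1" using elim L by (auto simp: field_simps)
  have f0: "0 \<le> \<lfloor>L * T N\<rfloor>" using LT by simp
  have "b N = real_of_int \<lfloor>L * T N\<rfloor> + 1" using f0 by (simp add: b_def M_def)
  then show ?case using LT by linarith
qed

private lemma y_top: "filterlim (\<lambda>N. b N * p N) at_top sequentially"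
proof (rule filterlim_at_top_mono)
  show "filterlim (\<lambda>N. L * (T N * p N)) at_top sequentially"
    by (rule filterlim_tendsto_pos_mult_at_top[OF tendsto_const L Tp])
  show "\<forall>\<^sub>F N in sequentially. L * (T N * p N) \<le> b N * p N"
    using b_bounds
  proof eventually_elim
    case (elim N)
    then have "L * T N * p N \<le> b N * p N" using p01' by (intro mult_right_mono) auto
    then show ?case by simp
  qed
qed

private lemma y_ge: "\<forall>\<^sub>F N in sequentially. b N * p N > z"
  using y_top unfolding filterlim_at_top_dense by blast

private lemma D'_bound: "\<forall>\<^sub>F N in sequentially. b N ^ (h - 1) * p N ^ h \<le> D'"
  using b_bounds D
proof eventually_elim
  case (elim N)
  have "b N ^ (h - 1) * p N ^ h \<le> (2 * L * T N) ^ (h - 1) * p N ^ h"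
    using elim p01' by (intro mult_right_mono power_mono) auto
  also have "\<dots> = (2 * L) ^ (h - 1) * (T N ^ (h - 1) * p N ^ h)" by (simp add: power_mult_distrib)
  also have "\<dots> \<le> D'" unfolding D'_def using elim L by (intro mult_left_mono) auto
  finally show ?case .
qed

private lemma y_power: "(b N * p N) ^ h = b N * (b N ^ (h - 1) * p N ^ h)"
proof -
  have "b N ^ h = b N * b N ^ (h - 1)" using h2 by (simp flip: power_Suc)
  then show ?thesis by (simp add: power_mult_distrib)
qed

private lemma b_pos: "b N > 0" by (simp add: b_def)

private lemma inv_y: "(\<lambda>N. C / (b N * p N)) \<longlonglongrightarrow> 0"
  by (rule real_tendsto_divide_at_top[OF tendsto_const y_top])

private lemma b_top: "filterlim b at_top sequentially"
proof (rule filterlim_at_top_mono[OF y_top])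
  have "b N * p N \<le> b N" for N using b_pos[of N] p01'[of N] by (simp add: mult_left_le)
  then show "\<forall>\<^sub>F N in sequentially. b N * p N \<le> b N" by simp
qed

text \<open>One factor \<open>b\<close> is missing from the bounded quantity
  \<open>b ^ (h - 1) * p ^ h\<close>, so the term is \<open>O(1 / b)\<close>.\<close>

private lemma eta_tendsto: "(\<lambda>N. (real h)\<^sup>2 * b N ^ (h - 2) * p N ^ h) \<longlonglongrightarrow> 0"
proof (rule Lim_null_comparison)
  show "\<forall>\<^sub>F N in sequentially. norm ((real h)\<^sup>2 * b N ^ (h - 2) * p N ^ h) \<le> (real h)\<^sup>2 * D' / b N"
    using D'_bound
  proof eventually_elim
    case (elim N)
    have "h - 1 = Suc (h - 2)" using h2 by simp
    then have "(real h)\<^sup>2 * b N ^ (h - 2) * p N ^ h = (real h)\<^sup>2 * (b N ^ (h - 1) * p N ^ h) / b N"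
      using b_pos[of N] by simp
    also have "\<dots> \<le> (real h)\<^sup>2 * D' / b N"
      using elim b_pos[of N] by (intro divide_right_mono mult_left_mono) auto
    finally show ?case using b_pos[of N] p01'[of N] by simp
  qed
  show "(\<lambda>N. (real h)\<^sup>2 * D' / b N) \<longlonglongrightarrow> 0"
    by (rule real_tendsto_divide_at_top[OF tendsto_const b_top])
qed

text \<open>With \<open>y = b * p\<close>, \<open>y ^ (2 * h)\<close> is \<open>b\<^sup>2\<close>
  times the square of a bounded quantity, so the overlap is \<open>O(1 / y)\<close>.\<close>

private lemma Delta_tendsto: "(\<lambda>N. overlap_const * (b N * p N) ^ (2 * h - 1) / (b N)\<^sup>2) \<longlonglongrightarrow> 0"
proof (rule Lim_null_comparison)
  show "\<forall>\<^sub>F N in sequentially. norm (overlap_const * (b N * p N) ^ (2 * h - 1) / (b N)\<^sup>2) \<le> overlap_const * D'\<^sup>2 / (b N * p N)"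
    using D'_bound y_ge[of 0]
  proof eventually_elim
    case (elim N)
    let ?y = "b N * p N"
    have "?y * ?y ^ (2 * h - 1) = ?y ^ (h + h)" using h2 by (simp flip: power_Suc add: mult_2)
    also have "\<dots> = (b N)\<^sup>2 * (b N ^ (h - 1) * p N ^ h)\<^sup>2"
      unfolding power_add y_power by (simp add: power2_eq_square)
    finally have eq: "?y * ?y ^ (2 * h - 1) = (b N)\<^sup>2 * (b N ^ (h - 1) * p N ^ h)\<^sup>2" .
    have "?y ^ (2 * h - 1) / (b N)\<^sup>2 = (b N ^ (h - 1) * p N ^ h)\<^sup>2 / ?y"
    proof -
      have gen: "v / x = z / t" if "t * v = x * z" "t \<noteq> 0" "x \<noteq> 0" for t v x z :: real
        using that by (simp add: field_simps)
      from eq show ?thesis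
        by (rule gen) (use b_pos[of N] elim(2) in auto)
    qed
    then have "overlap_const * ?y ^ (2 * h - 1) / (b N)\<^sup>2 = overlap_const * (b N ^ (h - 1) * p N ^ h)\<^sup>2 / ?y"
      by (metis times_divide_eq_right)
    also have "\<dots> \<le> overlap_const * D'\<^sup>2 / ?y"
      using elim overlap_const_pos b_pos[of N] p01'[of N] by (intro divide_right_mono mult_left_mono power_mono) auto
    finally show ?case using elim overlap_const_pos by simp
  qed
  show "(\<lambda>N. overlap_const * D'\<^sup>2 / (b N * p N)) \<longlonglongrightarrow> 0" by (rule inv_y)
qed

text \<open>About \<open>y = b * p\<close> elements lie near the edges, so at most of order
  \<open>y ^ (h - 1)\<close> values come from repeated elements; as \<open>y ^ h = O(T)\<close>,
  this is \<open>O(T / y)\<close>.\<close>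

private lemma degenerate_negligible:
  "conv_prob p T (\<lambda>N A. real (low_missing N (M N) A) - (\<Sum>m\<le>M N. of_bool (avoids N (value_at N m) A))) 0"
proof (rule conv_prob_mono0)
  let ?V = "\<lambda>N. {0..int (M N)} \<union> {int N - int (M N)..int N}"
  show "conv_prob p T (\<lambda>N A. (real h)\<^sup>2 * real (card (A \<inter> ?V N)) ^ (h - 1)) 0"
  proof (rule conv_prob_count)
    show "\<forall>\<^sub>F N in sequentially. real (card (?V N)) \<le> 2 * b N"
    proof (rule always_eventually, rule allI)
      fix N
      have "card (?V N) \<le> Suc (M N) + Suc (M N)" by (rule order.trans[OF card_Un_le]) simp
      then have "real (card (?V N)) \<le> real (Suc (M N) + Suc (M N))" by (rule of_nat_mono)
      then show "real (card (?V N)) \<le> 2 * b N" by (simp add: b_def)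
    qed
    show "\<forall>\<^sub>F N in sequentially. 2 * b N > 0" using b_pos by simp
    show "\<forall>\<^sub>F N in sequentially. T N > 0" by (rule Tbig)
    show "(\<lambda>N. (2 * b N * p N) ^ (h - 1) / T N) \<longlonglongrightarrow> 0"
    proof (rule Lim_null_comparison)
      show "\<forall>\<^sub>F N in sequentially. norm ((2 * b N * p N) ^ (h - 1) / T N) \<le> 2 ^ (h - 1) * (2 * L * D') / (b N * p N)"
        using b_bounds D'_bound y_ge[of 0] Tbig[of 0]
      proof eventually_elim
        case (elim N)
        let ?y = "b N * p N"
        have "?y * ?y ^ (h - 1) = ?y ^ h" using h2 by (simp flip: power_Suc)
        also have "\<dots> \<le> (2 * L * T N) * D'"
          unfolding y_power using elim b_pos[of N] L p01'[of N] by (intro mult_mono) auto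
        finally have "?y ^ (h - 1) / T N \<le> 2 * L * D' / ?y"
          using elim(3,4) by (simp add: field_simps)
        then have "2 ^ (h - 1) * (?y ^ (h - 1) / T N) \<le> 2 ^ (h - 1) * (2 * L * D' / ?y)"
          by (intro mult_left_mono) auto
        moreover have "(2 * b N * p N) ^ (h - 1) = 2 ^ (h - 1) * ?y ^ (h - 1)"
          by (simp only: power_mult_distrib mult.assoc)
        moreover have "0 \<le> (2 * b N * p N) ^ (h - 1) / T N"
          using elim(4) b_pos[of N] p01'(1)[of N] by (intro divide_nonneg_pos zero_le_power) auto
        ultimately show ?case by (simp only: real_norm_def abs_of_nonneg times_divide_eq_right)
      qed
      show "(\<lambda>N. 2 ^ (h - 1) * (2 * L * D') / (b N * p N)) \<longlonglongrightarrow> 0" by (rule inv_y)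
    qed
  qed auto
  show "\<forall>\<^sub>F N in sequentially. \<forall>A\<subseteq>{0..int N}. \<bar>real (low_missing N (M N) A) - (\<Sum>m\<le>M N. of_bool (avoids N (value_at N m) A))\<bar>
      \<le> \<bar>(real h)\<^sup>2 * real (card (A \<inter> ?V N)) ^ (h - 1)\<bar>"
    using low_missing_diff by (intro always_eventually allI impI order.trans[OF _ abs_ge_self]) auto
qed

text \<open>\<open>G\<close> is the limit profile of the ordered count times \<open>p ^ h\<close>.
  The sum of \<open>exp (- rep_mean)\<close> becomes a Riemann sum of mesh \<open>1 / T\<close>,
  both moments of the number of avoided values follow it, and repeated elements are
  negligible.\<close>

theorem window_conv_prob:
  assumes G: "continuous_on {0..L} G"
    and unif: "\<And>e. e > 0 \<Longrightarrow> \<forall>\<^sub>F N in sequentially. \<forall>m\<le>nat \<lfloor>L * T N\<rfloor>. \<bar>real (box_count h N (int m)) * p N ^ h - G (real m / T N)\<bar> \<le> e"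
  shows "conv_prob p T (\<lambda>N A. real (low_missing N (nat \<lfloor>L * T N\<rfloor>) A))
     (integral {0..L} (\<lambda>x. exp (- G x / (fact s * fact d))))"
proof -
  let ?F = "fact s * fact d :: real"
  define c where "c = integral {0..L} (\<lambda>x. exp (- G x / ?F))"
  define S where "S N = (\<Sum>m\<le>M N. exp (- rep_mean N (p N) m))" for N
  define R where "R N = (\<Sum>m\<le>M N. exp (- G (real m / T N) / ?F))" for N
  have F1: "1 \<le> ?F" using mult_mono[of 1 "fact s :: real" 1 "fact d"] by (simp add: fact_ge_1)
  have RT: "(\<lambda>N. R N / T N) \<longlonglongrightarrow> c"
    unfolding R_def c_def M_def
    by (rule riemann_sum_tendsto[OF _ L T]) (use F1 in \<open>intro continuous_intros G, auto\<close>)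
  have c0: "0 \<le> c" unfolding c_def by (rule integral_nonneg) (use F1 in \<open>auto intro!: integrable_continuous_real continuous_intros G\<close>)
  have "(\<lambda>N. S N / T N - R N / T N) \<longlonglongrightarrow> 0"
  proof (rule tendstoI)
    fix r :: real assume r: "r > 0"
    \<comment> \<open>Chosen to make \<open>exp e - 1\<close> equal to \<open>r / (4 * L)\<close>;
      the window has at most \<open>2 * L * T\<close> indices, so the total error is at most
      \<open>r / 2 * T\<close>.\<close>
    define e where "e = ln (1 + r / (4 * L))"
    have e: "e > 0" "exp e - 1 = r / (4 * L)" using r L by (auto simp: e_def add_pos_pos)
    show "\<forall>\<^sub>F N in sequentially. dist (S N / T N - R N / T N) 0 < r"
      using unif[OF e(1)] b_bounds Tbig[of 0]
    proof eventually_elim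
      case (elim N)
      have one: "\<bar>exp (- rep_mean N (p N) m) - exp (- G (real m / T N) / ?F)\<bar> \<le> exp e - 1" if m: "m \<le> M N" for m
      proof -
        have "\<bar>real (box_count h N (int m)) * p N ^ h - G (real m / T N)\<bar> \<le> e" using elim(1) m by (simp add: M_def)
        moreover have "rep_mean N (p N) m - G (real m / T N) / ?F = (real (box_count h N (int m)) * p N ^ h - G (real m / T N)) / ?F"
          by (simp add: rep_mean_def diff_divide_distrib)
        moreover have "\<bar>z / ?F\<bar> \<le> \<bar>z\<bar>" for z :: real
          using F1 by (simp add: abs_divide divide_le_eq mult_left_le mult.commute[of _ ?F] mult_le_cancel_right1)
        ultimately have "\<bar>rep_mean N (p N) m - G (real m / T N) / ?F\<bar> \<le> e" by (metis order.trans)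
        then show ?thesis using abs_exp_diff_le[of "rep_mean N (p N) m" "G (real m / T N) / ?F" e] rep_mean_nonneg p01'(1) by simp
      qed
      have "\<bar>S N - R N\<bar> \<le> (\<Sum>m\<le>M N. exp e - 1)"
        unfolding S_def R_def sum_subtractf[symmetric] by (rule order.trans[OF sum_abs sum_mono]) (use one in auto)
      also have "\<dots> = b N * (r / (4 * L))" using e by (simp add: b_def)
      also have "\<dots> \<le> (2 * L * T N) * (r / (4 * L))" using elim r L by (intro mult_right_mono) auto
      also have "\<dots> = r / 2 * T N" using L by (simp add: field_simps)
      finally have "\<bar>S N - R N\<bar> / T N \<le> r / 2" using elim by (simp add: pos_divide_le_eq)
      moreover have "\<bar>S N / T N - R N / T N\<bar> = \<bar>S N - R N\<bar> / T N"
        using elim by (simp add: abs_divide flip: diff_divide_distrib)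
      ultimately show ?case using r unfolding dist_real_def by linarith
    qed
  qed
  from tendsto_add[OF this RT] have ST: "(\<lambda>N. S N / T N) \<longlonglongrightarrow> c" by simp
  let ?X' = "\<lambda>N A. (\<Sum>m\<le>M N. of_bool (avoids N (value_at N m) A)) :: real"
  \<comment> \<open>The moment bounds divided by the scale; the exponential factors tend to 1, and
    the exceptional pairs contribute \<open>O(1 / T)\<close>.\<close>
  define u where "u N = exp (2 * ((real h)\<^sup>2 * b N ^ (h - 2) * p N ^ h) + 4 * (overlap_const * (b N * p N) ^ (2 * h - 1) / (b N)\<^sup>2)) * (S N / T N)\<^sup>2 + 4 * b N / (T N)\<^sup>2" for N
  define l where "l N = exp (- 2 * D' * p N) * (S N / T N)" for N
  have "conv_prob p T ?X' c"
  proof (rule conv_prob_moments[OF T])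
    show "\<forall>\<^sub>F N in sequentially. subset_expect (p N) {0..int N} (\<lambda>A. (?X' N A)\<^sup>2) \<le> u N * (T N)\<^sup>2"
      using y_ge[of 1] Tbig[of 0]
    proof eventually_elim
      case (elim N)
      have "subset_expect (p N) {0..int N} (\<lambda>A. (?X' N A)\<^sup>2) \<le>
        exp (2 * ((real h)\<^sup>2 * b N ^ (h - 2) * p N ^ h) + 4 * (overlap_const * (b N * p N) ^ (2 * h - 1) / (b N)\<^sup>2)) * (S N)\<^sup>2 + 4 * b N"
        unfolding S_def b_def by (rule avoids_expectation_upper[OF p01']) (use elim(1) in \<open>simp add: b_def\<close>)
      also have "\<dots> = u N * (T N)\<^sup>2" using elim(2) by (simp add: u_def field_simps power_divide)
      finally show ?case .
    qed
    show "\<forall>\<^sub>F N in sequentially. l N * T N \<le> subset_expect (p N) {0..int N} (?X' N)"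
    proof -
      have "\<forall>\<^sub>F N in sequentially. dist (p N) 0 < 1/2" using p0 by (rule tendstoD) simp
      then show ?thesis using D'_bound Tbig[of 0]
      proof eventually_elim
        case (elim N)
        have "exp (- 2 * D' * p N) * (\<Sum>m\<le>M N. exp (- rep_mean N (p N) m)) \<le> subset_expect (p N) {0..int N} (?X' N)"
        proof (rule avoids_expectation_lower)
          show "p N \<le> 1/2" using elim(1) by (simp add: dist_real_def)
          fix m assume m: "m \<le> M N"
          have "rep_mean N (p N) m \<le> real (box_count h N (int m)) * p N ^ h / 1"
            unfolding rep_mean_def using F1 p01'[of N] by (intro divide_left_mono) auto
          also have "\<dots> \<le> b N ^ (h - 1) * p N ^ h"
          proof -
            have "real (box_count h N (int m)) \<le> real (Suc (M N) ^ (h - 1))" by (rule of_nat_mono[OF box_count_le[OF m]])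
            then show ?thesis using p01'[of N] by (simp add: b_def mult_right_mono)
          qed
          also have "\<dots> \<le> D'" by (rule elim(2))
          finally show "rep_mean N (p N) m \<le> D'" .
        qed (rule p01')
        then show ?case using elim(3) by (simp add: l_def S_def)
      qed
    qed
    have bT: "(\<lambda>N. 4 * b N / (T N)\<^sup>2) \<longlonglongrightarrow> 0"
    proof (rule Lim_null_comparison)
      show "\<forall>\<^sub>F N in sequentially. norm (4 * b N / (T N)\<^sup>2) \<le> 8 * L / T N"
        using b_bounds Tbig[of 0]
      proof eventually_elim
        case (elim N)
        have "4 * b N / (T N)\<^sup>2 \<le> 4 * (2 * L * T N) / (T N)\<^sup>2" using elim by (intro divide_right_mono) auto
        also have "\<dots> = 8 * L / T N" using elim by (simp add: power2_eq_square)
        finally show ?case using b_pos[of N] by simp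
      qed
      show "(\<lambda>N. 8 * L / T N) \<longlonglongrightarrow> 0" by (rule real_tendsto_divide_at_top[OF tendsto_const T])
    qed
    have "u \<longlonglongrightarrow> exp (2 * 0 + 4 * 0) * c\<^sup>2 + 0"
      unfolding u_def by (intro tendsto_intros eta_tendsto Delta_tendsto ST bT)
    then show "u \<longlonglongrightarrow> c\<^sup>2" by simp
    have "l \<longlonglongrightarrow> exp (- 2 * D' * 0) * c" unfolding l_def by (intro tendsto_intros p0 ST)
    then show "l \<longlonglongrightarrow> c" by simp
  qed (rule c0)
  from conv_prob_add[OF this degenerate_negligible]
  show ?thesis by (simp add: c_def M_def)
qed

end

end

section \<open>Values far from the edges\<close>

text \<open>\<open>g\<close> coordinates range freely over \<open>{a..a + w}\<close>; the hypotheses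
  say that the last coordinate, which is then forced, lies in \<open>{0..N}\<close>.\<close>

lemma box_count_block:
  assumes "g * (a + w) \<le> m" "m \<le> g * a + N" "a + w \<le> N"
  shows "(w + 1) ^ g \<le> box_count (Suc g) N (int m)"
  using assms(1,2)
proof (induction g arbitrary: m)
  case 0
  have "(\<Sum>j\<in>{m}. if int m - int j = 0 then 1 else 0) \<le> (\<Sum>j\<in>{0..N}. if int m - int j = 0 then 1 else (0::nat))"
    using 0 by (intro sum_mono2) auto
  then show ?case by simp
next
  case (Suc g)
  have "(w + 1) ^ Suc g = (\<Sum>j\<in>{a..a+w}. (w + 1) ^ g)" by simp
  also have "\<dots> \<le> (\<Sum>j\<in>{a..a+w}. box_count (Suc g) N (int m - int j))"
  proof (intro sum_mono)
    fix j assume j: "j \<in> {a..a+w}"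
    have m: "a + w + g * (a + w) \<le> m" "m \<le> a + g * a + N" using Suc.prems by simp_all
    have "(w + 1) ^ g \<le> box_count (Suc g) N (int (m - j))"
      by (rule Suc.IH) (use m j in auto)
    moreover have "int (m - j) = int m - int j" using m j by auto
    ultimately show "(w + 1) ^ g \<le> box_count (Suc g) N (int m - int j)" by simp
  qed
  also have "\<dots> \<le> (\<Sum>j\<in>{0..N}. box_count (Suc g) N (int m - int j))"
    using assms(3) by (intro sum_mono2) auto
  finally show ?case by (simp only: box_count.simps(2)[of "Suc g"])
qed

text \<open>A block of tuples with entries near the average \<open>m / h\<close> already has the
  right order \<open>m ^ (h - 1)\<close>, uniformly over the whole lower half. An asymptotic count
  with additive error would not do for the tail estimate.\<close>

lemma box_count_lower:
  assumes h: "2 \<le> h" and m: "2 * m \<le> h * N" and N: "4 * h \<le> N"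
  shows "(real m / (2 * (real h)\<^sup>2)) ^ (h - 1) \<le> real (box_count h N (int m))"
proof -
  obtain g where g: "h = Suc g" using h by (cases h) auto
  \<comment> \<open>The width is a fraction \<open>1 / (2 * h)\<close> of the average, so that the
    block stays inside \<open>{0..N}\<close> whatever its entries are.\<close>
  define w where "w = m div (2 * h * h)"
  define Dv where "Dv = m div h"
  have hpos: "0 < h" using h by simp
  have wle: "2 * h * w \<le> Dv"
  proof -
    have "h * (2 * h * w) \<le> m" unfolding w_def by (metis mult.assoc mult.commute times_div_less_eq_dividend)
    then show ?thesis unfolding Dv_def using hpos by (simp add: less_eq_div_iff_mult_less_eq mult.commute)
  qed
  have w1: "w \<le> Dv" using wle hpos by (metis le_trans mult_le_mono1 mult_1 Suc_leI mult_2 nat_0_less_mult_iff pos2 One_nat_def)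
  have Dm: "h * Dv \<le> m" "m < h * Dv + h" unfolding Dv_def using hpos
    using dividend_less_times_div[OF hpos, of m] by (simp_all add: add.commute)
  have D2: "2 * Dv \<le> N"
  proof -
    have "h * (2 * Dv) = 2 * (h * Dv)" by simp
    then have "h * (2 * Dv) \<le> h * N" using Dm(1) m by linarith
    then show ?thesis using hpos by simp
  qed
  have hw: "4 * (h * w) \<le> N" using wle D2 by simp
  define a where "a = Dv - w"
  have aw: "a + w = Dv" using w1 by (simp add: a_def)
  have "(w + 1) ^ g \<le> box_count (Suc g) N (int m)"
  proof (rule box_count_block)
    show "g * (a + w) \<le> m" unfolding aw using Dm(1) g by simp
    have "g * Dv = g * a + g * w" unfolding aw[symmetric] by (simp add: algebra_simps)
    moreover have "h * Dv = g * Dv + Dv" "h * w = g * w + w" using g by simp_all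
    \<comment> \<open>Beyond \<open>g * a\<close> the target exceeds the block by less than
      \<open>g * w + Dv + h\<close>, and these are at most \<open>N / 4\<close>,
      \<open>N / 2\<close> and \<open>N / 4\<close>; the last one, due to rounding, needs
      \<open>4 * h \<le> N\<close>.\<close>
    ultimately show "m \<le> g * a + N" using Dm(2) D2 hw N by linarith
    show "a + w \<le> N" unfolding aw using D2 by simp
  qed
  then have "real ((w + 1) ^ g) \<le> real (box_count h N (int m))" unfolding g by (rule of_nat_mono)
  moreover have "real m / (2 * (real h)\<^sup>2) \<le> real (w + 1)"
  proof -
    have "m < 2 * h * h * w + 2 * h * h" unfolding w_def using dividend_less_times_div[of "2 * h * h" m] hpos by simp
    then have "real m \<le> real (2 * h * h * w + 2 * h * h)" by (intro of_nat_mono) simp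
    then show ?thesis using hpos by (simp add: field_simps power2_eq_square)
  qed
  then have "(real m / (2 * (real h)\<^sup>2)) ^ g \<le> real (w + 1) ^ g" by (intro power_mono) auto
  ultimately show ?thesis using g by (simp del: of_nat_add)
qed

lemma exp_minus_le:
  assumes "z > (0::real)"
  shows "exp (- z) \<le> fact k / z ^ k"
proof -
  have "(\<Sum>n\<in>{k}. z ^ n /\<^sub>R fact n) \<le> (\<Sum>n. z ^ n /\<^sub>R fact n)"
    using assms by (intro sum_le_suminf summable_exp_generic) auto
  then have "z ^ k / fact k \<le> exp z" by (simp add: exp_def divide_inverse_commute)
  then have "inverse (exp z) \<le> inverse (z ^ k / fact k)" using assms by (intro le_imp_inverse_le) auto
  then show ?thesis by (simp add: exp_minus)
qed

lemma sum_inverse_squares_le: "(\<Sum>m\<in>{M<..Q}. 1 / (real (Suc m))\<^sup>2) \<le> 2"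
proof -
  have "(\<Sum>m\<le>Q. 1 / (real (Suc m))\<^sup>2) \<le> 2 - 1 / real (Suc Q)"
  proof (induction Q)
    case (Suc Q)
    have "1 / (real (Suc (Suc Q)))\<^sup>2 \<le> 1 / (real (Suc Q) * real (Suc (Suc Q)))"
      unfolding power2_eq_square by (intro divide_left_mono mult_right_mono mult_pos_pos) auto
    also have "\<dots> = 1 / real (Suc Q) - 1 / real (Suc (Suc Q))" by (simp add: field_simps)
    finally show ?case using Suc by simp
  qed simp
  moreover have "(\<Sum>m\<in>{M<..Q}. 1 / (real (Suc m))\<^sup>2) \<le> (\<Sum>m\<le>Q. 1 / (real (Suc m))\<^sup>2)"
    by (intro sum_mono2) auto
  moreover have "0 \<le> 1 / real (Suc Q)" by simp
  ultimately show ?thesis by linarith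
qed

text \<open>A geometric tail of ratio \<open>x = exp (- \<kappa> / T)\<close>, with
  \<open>1 / (1 - x)\<close> bounded by \<open>1 + T / \<kappa>\<close>.\<close>

lemma sum_exp_tail_le:
  assumes \<kappa>: "\<kappa> > 0" and T: "T > (0::real)" and M: "L * T \<le> real (Suc M)"
  shows "(\<Sum>m\<in>{M<..Q}. exp (- \<kappa> * (real (Suc m) / T))) \<le> exp (- \<kappa> * L) * (1 + T / \<kappa>)"
proof -
  define x where "x = exp (- \<kappa> / T)"
  have x: "0 < x" "x < 1" using \<kappa> T by (auto simp: x_def)
  have xp: "exp (- \<kappa> * (real n / T)) = x ^ n" for n
    by (simp add: x_def flip: exp_of_nat_mult)
  have tele: "(1 - x) * (\<Sum>m\<in>{M<..Q}. x ^ Suc m) \<le> x ^ Suc M"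
  proof (cases "M \<le> Q")
    case True
    have "(1 - x) * (\<Sum>m\<in>{M<..Q}. x ^ Suc m) \<le> x ^ Suc M - x ^ Suc Q"
      using True
    proof (induction Q rule: dec_induct)
      case (step n)
      have "{M<..Suc n} = insert (Suc n) {M<..n}" using step by auto
      then have "(1 - x) * (\<Sum>m\<in>{M<..Suc n}. x ^ Suc m) = (1 - x) * x ^ Suc (Suc n) + (1 - x) * (\<Sum>m\<in>{M<..n}. x ^ Suc m)"
        by (simp add: algebra_simps)
      also have "\<dots> \<le> (1 - x) * x ^ Suc (Suc n) + (x ^ Suc M - x ^ Suc n)" using step by simp
      also have "\<dots> \<le> (1 - x) * x ^ Suc n + (x ^ Suc M - x ^ Suc n)"
        using x by (intro add_mono mult_left_mono power_decreasing) auto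
      also have "\<dots> = x ^ Suc M - x ^ Suc (Suc n)" by (simp add: algebra_simps)
      finally show ?case .
    qed simp
    moreover have "0 \<le> x ^ Suc Q" using x by simp
    ultimately show ?thesis by linarith
  qed (use x in simp)
  \<comment> \<open>This inequality gives the lower bound for \<open>1 - x\<close>.\<close>
  have "1 + \<kappa> / T \<le> exp (\<kappa> / T)" by (rule exp_ge_add_one_self)
  then have "x * (1 + \<kappa> / T) \<le> 1"
    unfolding x_def using mult_left_mono[of "1 + \<kappa> / T" "exp (\<kappa> / T)" "exp (- \<kappa> / T)"] by (simp flip: exp_add)
  then have inv: "1 \<le> (1 - x) * (1 + T / \<kappa>)" using \<kappa> T x by (simp add: field_simps)
  have "(\<Sum>m\<in>{M<..Q}. exp (- \<kappa> * (real (Suc m) / T))) = (\<Sum>m\<in>{M<..Q}. x ^ Suc m)" by (simp only: xp)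
  also have "\<dots> \<le> x ^ Suc M * (1 + T / \<kappa>)"
  proof -
    let ?S = "\<Sum>m\<in>{M<..Q}. x ^ Suc m"
    have S0: "0 \<le> ?S" using x by (intro sum_nonneg) auto
    have "?S * 1 \<le> ?S * ((1 - x) * (1 + T / \<kappa>))" using inv S0 by (rule mult_left_mono)
    also have "\<dots> = ((1 - x) * ?S) * (1 + T / \<kappa>)" by simp
    also have "\<dots> \<le> x ^ Suc M * (1 + T / \<kappa>)" using tele \<kappa> T by (intro mult_right_mono) auto
    finally show ?thesis by simp
  qed
  also have "x ^ Suc M \<le> exp (- \<kappa> * L)"
  proof -
    have "L \<le> real (Suc M) / T" using M T by (simp add: field_simps)
    then have "\<kappa> * L \<le> \<kappa> * (real (Suc M) / T)" using \<kappa> by (intro mult_left_mono) auto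
    then show ?thesis unfolding xp[symmetric] by (simp del: of_nat_Suc)
  qed
  finally show ?thesis using \<kappa> T by (simp add: mult_right_mono)
qed

context sumdiff_params
begin

text \<open>The block count, with \<open>m / (2 * h\<^sup>2)\<close> lowered to
  \<open>(m + 1) / (4 * h\<^sup>2)\<close> and divided by \<open>s! d!\<close>; the extra factor 2
  leaves room for tuples with repeated entries.\<close>

definition density_const :: real where "density_const = 1 / (2 * (fact s * fact d) * (4 * (real h)\<^sup>2) ^ (h - 1))"

lemma density_const_pos: "density_const > 0" using h2 by (simp add: density_const_def)

lemma card_rep_pairs_lower:
  assumes m: "1 \<le> m" "2 * m \<le> h * N" and N: "4 * h \<le> N" and k: "value_at N m \<noteq> 0"
    and b: "(real h)\<^sup>2 / density_const \<le> real (Suc m)"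
  shows "density_const * real (Suc m) ^ (h - 1) \<le> real (card (rep_pairs N (value_at N m)))"
proof -
  let ?b = "real (Suc m)"
  let ?F = "fact s * fact d :: real"
  have "(?b / (4 * (real h)\<^sup>2)) ^ (h - 1) \<le> (real m / (2 * (real h)\<^sup>2)) ^ (h - 1)"
  proof (rule power_mono)
    show "?b / (4 * (real h)\<^sup>2) \<le> real m / (2 * (real h)\<^sup>2)" using m(1) h2 by (simp add: field_simps)
  qed simp
  also have "\<dots> \<le> real (box_count h N (int m))" by (rule box_count_lower[OF h2 m(2) N])
  finally have "(?b / (4 * (real h)\<^sup>2)) ^ (h - 1) / ?F \<le> real (box_count h N (int m)) / ?F" by (intro divide_right_mono) auto
  moreover have "(?b / (4 * (real h)\<^sup>2)) ^ (h - 1) / ?F = 2 * (density_const * ?b ^ (h - 1))"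
    by (simp add: density_const_def power_divide del: of_nat_Suc)
  ultimately have 1: "2 * (density_const * ?b ^ (h - 1)) \<le> rep_mean N 1 m" by (simp add: rep_mean_def)
  have "(real h)\<^sup>2 * ?b ^ (h - 2) \<le> (density_const * ?b) * ?b ^ (h - 2)"
    using b density_const_pos by (intro mult_right_mono) (auto simp: field_simps)
  also have "\<dots> = density_const * ?b ^ (h - 1)"
  proof -
    have "h - 1 = Suc (h - 2)" using h2 by simp
    then show ?thesis by simp
  qed
  finally have 2: "(real h)\<^sup>2 * ?b ^ (h - 2) \<le> density_const * ?b ^ (h - 1)" .
  \<comment> \<open>At density 1 the comparison of means is a plain comparison of counts.\<close>
  have "rep_mean N 1 m - (real h)\<^sup>2 * ?b ^ (h - 2) * 1 ^ h \<le> real (card (rep_pairs N (value_at N m))) * 1 ^ h"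
    by (rule card_rep_pairs_q_ge) (use k in auto)
  then show ?thesis using 1 2 by simp
qed

text \<open>Makes \<open>overlap_const * thinning_const\<close> equal to half of
  \<open>density_const\<close>: under \<open>y ^ (h - 1) \<le> thinning_const * b\<close> the
  overlap is at most half of the lower bound for the mean.\<close>

definition thinning_const :: real where "thinning_const = density_const / (2 * overlap_const)"

lemma thinning_const_pos: "thinning_const > 0" using density_const_pos overlap_const_pos by (simp add: thinning_const_def)

text \<open>Janson's bound is useless when the overlap sum exceeds the mean. As avoidance is a decreasing event,
  the density may first be lowered until \<open>y\<^sup>h\<^sup>-\<^sup>1 \<le> thinning_const b\<close>, where \<open>y = b q\<close>.\<close>

lemma avoids_middle:
  assumes m: "1 \<le> m" "2 * m \<le> h * N" and N: "4 * h \<le> N" and k: "value_at N m \<noteq> 0"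
    and b: "(real h)\<^sup>2 / density_const \<le> real (Suc m)" and q: "0 < q" "q \<le> 1"
    and bq: "1 \<le> real (Suc m) * q" and db: "1 \<le> thinning_const * real (Suc m)"
  shows "subset_expect q {0..int N} (\<lambda>A. of_bool (avoids N (value_at N m) A))
     \<le> exp (- (density_const / 2) * (real (Suc m) ^ (h - 1) * q ^ h)) + exp (- (density_const / 2 * thinning_const * root (h - 1) (thinning_const * real (Suc m))))"
proof -
  define bb where "bb = real (Suc m)"
  \<comment> \<open>The largest \<open>y\<close> for which the overlap is under control;
    \<open>q'\<close> is the density with \<open>b * q' = y\<close>, so nothing is thinned when
    \<open>b * q \<le> r\<close>.\<close>
  define r where "r = root (h - 1) (thinning_const * bb)"
  define y where "y = min (bb * q) r"
  define q' where "q' = y / bb"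
  have b0: "bb > 0" by (simp add: bb_def)
  have h1: "0 < h - 1" using h2 by simp
  have db0: "0 \<le> thinning_const * bb" using thinning_const_pos b0 by simp
  have rp: "r ^ (h - 1) = thinning_const * bb" unfolding r_def using h1 db0 by (simp add: real_root_pow_pos2)
  have r1: "1 \<le> r" unfolding r_def using db h1 by (simp add: bb_def del: of_nat_Suc)
  have y1: "1 \<le> y" using r1 bq by (simp add: y_def bb_def)
  have yh: "y ^ (h - 1) \<le> thinning_const * bb" unfolding rp[symmetric] using y1 by (intro power_mono) (auto simp: y_def)
  have q': "0 \<le> q'" "q' \<le> q" using y1 b0 by (auto simp: q'_def y_def field_simps)
  have bq': "bb * q' = y" using b0 by (simp add: q'_def)
  have hs: "h = Suc (h - 1)" using h1 by simp
  have bq'h: "bb ^ (h - 1) * q' ^ h = y ^ h / bb"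
  proof -
    have "bb * (bb ^ (h - 1) * q' ^ h) = bb ^ h * q' ^ h" using power_Suc[of bb "h - 1"] hs by simp
    also have "\<dots> = y ^ h" by (simp add: bq' flip: power_mult_distrib)
    finally show ?thesis using b0 by (simp add: field_simps)
  qed
  have "subset_expect q {0..int N} (\<lambda>A. of_bool (avoids N (value_at N m) A)) \<le> subset_expect q' {0..int N} (\<lambda>A. of_bool (avoids N (value_at N m) A))"
  proof (rule subset_expect_antimono_prob)
    fix A B :: "int set" assume "A \<subseteq> B"
    then have "avoids N (value_at N m) B \<Longrightarrow> avoids N (value_at N m) A" unfolding avoids_def by blast
    then show "(of_bool (avoids N (value_at N m) B) :: real) \<le> of_bool (avoids N (value_at N m) A)" by simp
  qed (use q q' in auto)
  also have "\<dots> \<le> exp (- real (card (rep_pairs N (value_at N m))) * q' ^ h + overlap N q' (value_at N m) (value_at N m))"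
    by (rule avoids_upper) (use q q' in auto)
  also have "\<dots> \<le> exp (- (density_const / 2 * (y ^ h / bb)))"
  proof -
    have "density_const * bb ^ (h - 1) * q' ^ h \<le> real (card (rep_pairs N (value_at N m))) * q' ^ h"
      using card_rep_pairs_lower[OF m N k b] q' by (intro mult_right_mono) (auto simp: bb_def)
    then have 1: "density_const * (y ^ h / bb) \<le> real (card (rep_pairs N (value_at N m))) * q' ^ h"
      unfolding bq'h[symmetric] by (simp add: mult.assoc)
    have "overlap N q' (value_at N m) (value_at N m) \<le> overlap_const * (real (Suc m) * q') ^ (2 * h - 1) / (real (Suc m))\<^sup>2"
      by (rule overlap_le) (use q' bq' y1 k value_at_box_inj_reps in \<open>auto simp: bb_def simp del: of_nat_Suc\<close>)
    also have "\<dots> = overlap_const * y ^ (2 * h - 1) / bb\<^sup>2" by (simp only: bq' bb_def[symmetric])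
    also have "\<dots> = overlap_const * (y ^ (h - 1) / bb) * (y ^ h / bb)"
    proof -
      have "2 * h - 1 = (h - 1) + h" using h1 by simp
      then show ?thesis by (simp add: power_add power2_eq_square)
    qed
    also have "\<dots> \<le> overlap_const * thinning_const * (y ^ h / bb)"
      using yh overlap_const_pos b0 y1 by (intro mult_right_mono mult_left_mono) (auto simp: pos_divide_le_eq)
    also have "overlap_const * thinning_const = density_const / 2" using overlap_const_pos by (simp add: thinning_const_def)
    finally have "overlap N q' (value_at N m) (value_at N m) \<le> density_const / 2 * (y ^ h / bb)" .
    then show ?thesis using 1 by simp
  qed
  also have "\<dots> \<le> exp (- (density_const / 2) * (real (Suc m) ^ (h - 1) * q ^ h)) + exp (- (density_const / 2 * thinning_const * root (h - 1) (thinning_const * real (Suc m))))"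
  \<comment> \<open>Without thinning the exponent is the mean at density \<open>q\<close>, the first
    summand. With thinning, \<open>y = r\<close> gives an exponent of order \<open>r\<close>, the
    second.\<close>
  proof (cases "bb * q \<le> r")
    case True
    then have "y = bb * q" by (simp add: y_def)
    then have "q' = q" using b0 by (simp add: q'_def)
    then have "y ^ h / bb = bb ^ (h - 1) * q ^ h" using bq'h by simp
    then show ?thesis by (simp add: bb_def del: of_nat_Suc)
  next
    case False
    then have yr: "y = r" by (simp add: y_def)
    have "y ^ h / bb = r * (r ^ (h - 1) / bb)" using power_Suc[of r "h - 1"] hs by (simp add: yr)
    also have "\<dots> = thinning_const * r" using rp b0 by simp
    finally have "density_const / 2 * (y ^ h / bb) = density_const / 2 * thinning_const * root (h - 1) (thinning_const * real (Suc m))"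
      by (simp only: r_def bb_def mult.assoc)
    then show ?thesis by (simp only:) (rule order.trans[OF _ add_increasing], auto)
  qed
  finally show ?thesis .
qed

definition mid_missing :: "nat \<Rightarrow> nat \<Rightarrow> int set \<Rightarrow> nat" where
  "mid_missing N M A = card {m\<in>{M<..h * N div 2}. value_at N m \<notin> sumdiff_set s d A}"

definition reflect :: "nat \<Rightarrow> int set \<Rightarrow> int set" where "reflect N A = (\<lambda>x. int N - x) ` A"

lemma subset_expect_reflect: "subset_expect q {0..int N} (\<lambda>A. f (reflect N A)) = subset_expect q {0..int N} f"
  unfolding reflect_def
  by (rule subset_expect_image) (auto intro!: bij_betwI[where g = "\<lambda>x. int N - x"])

lemma reflect_reflect: "reflect N (reflect N A) = A" by (auto simp: reflect_def image_image)

text \<open>Reflecting all entries sends the value \<open>k\<close> to \<open>(s - d) N - k\<close>,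
  which exchanges the two edges.\<close>

lemma sumdiff_reflect_imp: "k \<in> sumdiff_set s d A \<Longrightarrow> (int s - int d) * int N - k \<in> sumdiff_set s d (reflect N A)"
proof -
  assume "k \<in> sumdiff_set s d A"
  then obtain a b where ab: "k = (\<Sum>i<s. a i) - (\<Sum>j<d. b j)" "\<forall>i<s. a i \<in> A" "\<forall>j<d. b j \<in> A"
    by (auto simp: sumdiff_set_def)
  let ?a = "\<lambda>i. int N - a i" and ?b = "\<lambda>i. int N - b i"
  have "(int s - int d) * int N - k = (\<Sum>i<s. ?a i) - (\<Sum>j<d. ?b j)"
    by (simp add: sum_subtractf ab(1) algebra_simps)
  moreover have "\<forall>i<s. ?a i \<in> reflect N A" "\<forall>j<d. ?b j \<in> reflect N A" using ab by (auto simp: reflect_def)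
  ultimately show ?thesis unfolding sumdiff_set_def by (intro CollectI exI[of _ ?a] exI[of _ ?b]) auto
qed

lemma sumdiff_reflect: "k \<in> sumdiff_set s d (reflect N A) \<longleftrightarrow> (int s - int d) * int N - k \<in> sumdiff_set s d A"
  using sumdiff_reflect_imp[of k "reflect N A" N] sumdiff_reflect_imp[of "(int s - int d) * int N - k" A N]
  by (auto simp: reflect_reflect)

end

section \<open>Splitting the complement\<close>

text \<open>The substitution \<open>t = a * x ^ n\<close> turns the integrand into that of
  \<open>Gamma (1 / n)\<close>; the Jacobian contributes \<open>1 / (n * root n a)\<close>.\<close>

lemma stretched_exponential_integral:
  fixes n :: nat and a :: real
  assumes n: "1 \<le> n" and a: "0 < a"
  shows "((\<lambda>L. integral {0..L} (\<lambda>x. exp (- (a * x ^ n)))) \<longlongrightarrow> Gamma (1 / n) / (n * root n a)) at_top"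
proof (rule tendstoI)
  fix e :: real assume e: "e > 0"
  define C where "C = 1 / (real n * root n a)"
  have ra: "root n a > 0" using n a by simp
  have C: "C > 0" unfolding C_def using n ra by simp
  let ?f = "\<lambda>t::real. t powr (1 / n - 1) / exp t"
  have hI: "(?f has_integral Gamma (1 / n)) {0..}" using n by (intro Gamma_integral_real) auto
  \<comment> \<open>For a set that is not a box the integral is by definition a limit over large
    boxes; this gives a bound \<open>B\<close> beyond which the truncated Gamma integrals are
    close.\<close>
  have ncb: "\<not> (\<exists>u v. {0::real..} = cbox u v)"
  proof clarify
    fix u v :: real assume eq: "{0..} = cbox u v"
    have "max 0 (v + 1) \<in> {0..}" by simp
    then have "max 0 (v + 1) \<in> cbox u v" unfolding eq .
    then show False by simp
  qed
  have eC: "e / C > 0" using e C by simp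
  obtain B where B: "B > 0" "\<forall>u v. ball 0 B \<subseteq> cbox u v \<longrightarrow>
      (\<exists>z. ((\<lambda>x. if x \<in> {0..} then ?f x else 0) has_integral z) (cbox u v) \<and> norm (z - Gamma (1 / n)) < e / C)"
    by (rule has_integral_altD[OF hI ncb eC])
  have key: "dist (integral {0..L} (\<lambda>x. exp (- (a * x ^ n)))) (Gamma (1 / n) / (n * root n a)) < e"
    if L: "L > 0" "a * L ^ n \<ge> B" for L
  proof -
    define b where "b = a * L ^ n"
    have b: "b \<ge> B" "b > 0" using L B by (auto simp: b_def)
    have "ball 0 B \<subseteq> cbox (- b) b" using b by (auto simp: dist_real_def)
    then obtain z where z: "((\<lambda>x. if x \<in> {0..} then ?f x else 0) has_integral z) (cbox (- b) b)" "norm (z - Gamma (1 / n)) < e / C"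
      using B(2) by blast
    have "((\<lambda>x. if x \<in> {0..b} then ?f x else 0) has_integral z) (cbox (- b) b)"
      by (rule has_integral_eq[OF _ z(1)]) auto
    then have zf: "(?f has_integral z) {0..b}"
      using has_integral_restrict[of "{0..b}" "cbox (- b) b" ?f z] b by auto
    let ?g = "\<lambda>t. root n (t / a)"
    let ?g' = "\<lambda>t. C * t powr (1 / n - 1)"
    have gb: "?g b = L" using n a L by (simp add: b_def real_root_power_cancel)
    have g_ab: "?g t = t powr (1 / n) / root n a" if "0 \<le> t" for t
      using that n a by (simp add: real_root_divide root_powr_inverse)
    have "((\<lambda>t. ?g' t *\<^sub>R exp (- (a * ?g t ^ n))) has_integral (integral {?g 0..?g b} (\<lambda>x. exp (- (a * x ^ n))))) {0..b}"
    \<comment> \<open>The exceptional set is \<open>{0}\<close>, where the root may fail to be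
      differentiable; continuity is enough there.\<close>
    proof (rule has_integral_substitution_strong[where s = "{0}" and c = 0 and d = L])
      show "?g ` {0..b} \<subseteq> {0..L}"
      proof
        fix y assume "y \<in> ?g ` {0..b}"
        then obtain t where t: "0 \<le> t" "t \<le> b" "y = ?g t" by auto
        then have "y \<le> ?g b" using n a by (simp add: divide_right_mono)
        moreover have "0 \<le> y" using t n a by simp
        ultimately show "y \<in> {0..L}" using gb by simp
      qed
      show "continuous_on {0..b} ?g" using n by (intro continuous_intros) (use a in auto)
      fix t assume "t \<in> {0..b} - {0}"
      then have t: "0 < t" by auto
      have "((\<lambda>t. t powr (1 / n) / root n a) has_field_derivative ?g' t) (at t within {0..b})"
        unfolding C_def using t n ra
        by (auto intro!: derivative_eq_intros simp: field_simps)
      then show "(?g has_field_derivative ?g' t) (at t within {0..b})"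
        by (rule has_field_derivative_transform_within[where d = 1])
           (use \<open>t \<in> {0..b} - {0}\<close> g_ab in auto)
    qed (use b gb n L in \<open>auto intro!: continuous_intros\<close>)
    then have 1: "((\<lambda>t. ?g' t *\<^sub>R exp (- (a * ?g t ^ n))) has_integral (integral {0..L} (\<lambda>x. exp (- (a * x ^ n))))) {0..b}"
      using gb n by simp
    have "((\<lambda>t. C * ?f t) has_integral (integral {0..L} (\<lambda>x. exp (- (a * x ^ n))))) {0..b}"
    proof (rule has_integral_eq[OF _ 1])
      fix t assume t: "t \<in> {0..b}"
      then have "?g t ^ n = t / a" using n a by (simp add: real_root_pow_pos2)
      then show "?g' t *\<^sub>R exp (- (a * ?g t ^ n)) = C * ?f t" using a by (simp add: exp_minus field_simps)
    qed
    moreover have "((\<lambda>t. C * ?f t) has_integral (C * z)) {0..b}" using zf by (rule has_integral_mult_right)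
    ultimately have "integral {0..L} (\<lambda>x. exp (- (a * x ^ n))) = C * z" by (rule has_integral_unique)
    moreover have "Gamma (1 / n) / (n * root n a) = C * Gamma (1 / n)" by (simp add: C_def)
    moreover have "\<bar>C * z - C * Gamma (1 / n)\<bar> < e"
    proof -
      have "\<bar>C * z - C * Gamma (1 / n)\<bar> = C * \<bar>z - Gamma (1 / n)\<bar>" using C by (simp add: abs_mult flip: right_diff_distrib)
      also have "\<dots> < e" using z(2) C by (simp add: field_simps)
      finally show ?thesis .
    qed
    ultimately show ?thesis by (simp add: dist_real_def)
  qed
  have "eventually (\<lambda>L. L \<ge> max 1 (B / a)) at_top" by (rule eventually_ge_at_top)
  then show "eventually (\<lambda>L. dist (integral {0..L} (\<lambda>x. exp (- (a * x ^ n)))) (Gamma (1 / n) / (n * root n a)) < e) at_top"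
  proof (rule eventually_mono)
    fix L :: real assume L: "max 1 (B / a) \<le> L"
    then have "L \<le> L ^ n" using n by (intro self_le_power) auto
    then have "a * L \<le> a * L ^ n" using a by simp
    moreover have "B \<le> a * L" using L a by (simp add: field_simps)
    ultimately show "dist (integral {0..L} (\<lambda>x. exp (- (a * x ^ n)))) (Gamma (1 / n) / (n * root n a)) < e"
      using L by (intro key) auto
  qed
qed

context sumdiff_params
begin

definition missing_indices :: "nat \<Rightarrow> int set \<Rightarrow> nat set" where
  "missing_indices N A = {m\<in>{..h * N}. value_at N m \<notin> sumdiff_set s d A}"

lemma card_sumdiff_compl: "card (sumdiff_compl s d N A) = card (missing_indices N A)"
proof -
  have hN: "int d * int N + int s * int N = int (h * N)" unfolding h_eq[symmetric] of_nat_mult of_nat_add by (simp add: algebra_simps)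
  have "sumdiff_compl s d N A = value_at N ` missing_indices N A"
  proof (intro set_eqI iffI)
    fix k assume k: "k \<in> sumdiff_compl s d N A"
    define m where "m = nat (k + int d * int N)"
    have km: "- (int d * int N) \<le> k" "k \<le> int s * int N" using k by (auto simp: sumdiff_compl_def)
    have "int m = k + int d * int N" unfolding m_def using km by (intro int_nat_eq[THEN trans]) auto
    then have kkm: "value_at N m = k" and "int m \<le> int (h * N)" using km hN unfolding value_at_def by linarith+
    then have "m \<le> h * N" by linarith
    then show "k \<in> value_at N ` missing_indices N A" using kkm k by (intro image_eqI[of _ _ m]) (auto simp: missing_indices_def sumdiff_compl_def)
  next
    fix k assume "k \<in> value_at N ` missing_indices N A"
    then obtain m where m: "m \<le> h * N" "k = value_at N m" "k \<notin> sumdiff_set s d A" by (auto simp: missing_indices_def)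
    then have "int m \<le> int (h * N)" by linarith
    then have "- (int d * int N) \<le> k" "k \<le> int s * int N" using m(2) hN unfolding value_at_def by linarith+
    then show "k \<in> sumdiff_compl s d N A" using m by (auto simp: sumdiff_compl_def)
  qed
  moreover have "inj_on (value_at N) (missing_indices N A)" by (auto simp: inj_on_def value_at_def)
  ultimately show ?thesis by (simp add: card_image)
qed

lemma value_at_reflect: "m \<le> h * N \<Longrightarrow> value_at N m \<in> sumdiff_set s d (reflect N A) \<longleftrightarrow> value_at N (h * N - m) \<in> sumdiff_set s d A"
proof -
  assume m: "m \<le> h * N"
  have "(int s - int d) * int N - value_at N m = value_at N (h * N - m)"
    using m by (simp add: value_at_def of_nat_diff algebra_simps flip: h_eq)
  then show ?thesis by (simp add: sumdiff_reflect)
qed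

text \<open>The index \<open>m\<close> becomes \<open>h * N - m\<close> under reflection, so the top
  window is the bottom window of the reflected set.\<close>

lemma card_compl_split:
  assumes M: "M \<le> h * N"
  shows "card (missing_indices N A \<inter> {h * N - M..}) = low_missing N M (reflect N A)"
proof -
  have "bij_betw (\<lambda>m. h * N - m) (missing_indices N A \<inter> {h * N - M..}) {m\<in>{..M}. value_at N m \<notin> sumdiff_set s d (reflect N A)}"
  proof (rule bij_betw_byWitness[where f' = "\<lambda>m. h * N - m"])
    show "(\<lambda>m. h * N - m) ` (missing_indices N A \<inter> {h * N - M..}) \<subseteq> {m\<in>{..M}. value_at N m \<notin> sumdiff_set s d (reflect N A)}"
      using M by (auto simp: missing_indices_def value_at_reflect)
    show "(\<lambda>m. h * N - m) ` {m\<in>{..M}. value_at N m \<notin> sumdiff_set s d (reflect N A)} \<subseteq> missing_indices N A \<inter> {h * N - M..}"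
      using M by (auto simp: missing_indices_def value_at_reflect)
  qed (use M in \<open>auto simp: missing_indices_def\<close>)
  then show ?thesis by (simp add: low_missing_def bij_betw_same_card)
qed

lemma card_compl_mid:
  "card (missing_indices N A \<inter> {h * N div 2<..<h * N - M}) \<le> mid_missing N M (reflect N A)"
proof -
  have inj: "inj_on (\<lambda>m. h * N - m) (missing_indices N A \<inter> {h * N div 2<..<h * N - M})"
    by (auto simp: inj_on_def missing_indices_def)
  have "card (missing_indices N A \<inter> {h * N div 2<..<h * N - M}) = card ((\<lambda>m. h * N - m) ` (missing_indices N A \<inter> {h * N div 2<..<h * N - M}))"
    using inj by (simp add: card_image)
  also have "\<dots> \<le> mid_missing N M (reflect N A)"
    unfolding mid_missing_def by (intro card_mono) (auto simp: missing_indices_def value_at_reflect)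
  finally show ?thesis .
qed

lemma low_missing_compl: "M \<le> h * N \<Longrightarrow> low_missing N M A = card (missing_indices N A \<inter> {..M})"
  unfolding low_missing_def missing_indices_def by (intro arg_cong[where f = card]) auto

lemma finite_missing_indices [simp]: "finite (missing_indices N A)" by (simp add: missing_indices_def)

text \<open>The halves cover all indices and share only the middle one, when \<open>h * N\<close> is
  even; hence the error 1.\<close>

lemma compl_halves:
  assumes "M = h * N div 2"
  shows "\<bar>real (card (sumdiff_compl s d N A)) - (real (low_missing N M A) + real (low_missing N M (reflect N A)))\<bar> \<le> 1"
proof -
  let ?C = "missing_indices N A"
  have M: "M \<le> h * N" using assms by simp
  have "?C = (?C \<inter> {..M}) \<union> (?C \<inter> {h * N - M..})" using assms by auto
  then have "card ?C = card ((?C \<inter> {..M}) \<union> (?C \<inter> {h * N - M..}))" by simp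
  moreover have "card (?C \<inter> {..M}) + card (?C \<inter> {h * N - M..}) = card ((?C \<inter> {..M}) \<union> (?C \<inter> {h * N - M..})) + card ((?C \<inter> {..M}) \<inter> (?C \<inter> {h * N - M..}))"
    by (rule card_Un_Int) auto
  moreover have "card ((?C \<inter> {..M}) \<inter> (?C \<inter> {h * N - M..})) \<le> card {M}"
    using assms by (intro card_mono) auto
  ultimately show ?thesis using M by (simp add: card_sumdiff_compl low_missing_compl card_compl_split)
qed

lemma compl_window_mid:
  assumes "2 * M < h * N"
  shows "real (low_missing N M A) + real (low_missing N M (reflect N A)) \<le> real (card (sumdiff_compl s d N A))"
    "real (card (sumdiff_compl s d N A)) \<le> real (low_missing N M A) + real (low_missing N M (reflect N A))
      + (real (mid_missing N M A) + real (mid_missing N M (reflect N A)))"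
proof -
  let ?C = "missing_indices N A"
  have M: "M \<le> h * N" using assms by simp
  let ?U = "(?C \<inter> {..M}) \<union> (?C \<inter> {h * N - M..})"
  let ?L = "?C \<inter> {M<..h * N div 2}" and ?H = "?C \<inter> {h * N div 2<..<h * N - M}"
  have dj: "card ?U = card (?C \<inter> {..M}) + card (?C \<inter> {h * N - M..})"
    using assms by (intro card_Un_disjoint) auto
  have "card ?U \<le> card ?C" by (intro card_mono) auto
  then show "real (low_missing N M A) + real (low_missing N M (reflect N A)) \<le> real (card (sumdiff_compl s d N A))"
    using M dj by (simp add: card_sumdiff_compl low_missing_compl card_compl_split)
  have "?C \<subseteq> ?U \<union> (?L \<union> ?H)" by auto
  then have "card ?C \<le> card (?U \<union> (?L \<union> ?H))" by (intro card_mono) auto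
  also have "\<dots> \<le> card ?U + (card ?L + card ?H)"
    by (rule order.trans[OF card_Un_le]) (intro add_left_mono card_Un_le)
  also have "card ?L \<le> mid_missing N M A" unfolding mid_missing_def by (intro card_mono) (auto simp: missing_indices_def)
  also have "card ?H \<le> mid_missing N M (reflect N A)" by (rule card_compl_mid)
  finally have "card ?C \<le> card ?U + (mid_missing N M A + mid_missing N M (reflect N A))" by simp
  then show "real (card (sumdiff_compl s d N A)) \<le> real (low_missing N M A) + real (low_missing N M (reflect N A))
      + (real (mid_missing N M A) + real (mid_missing N M (reflect N A)))"
    using M dj by (simp add: card_sumdiff_compl low_missing_compl card_compl_split)
qed

end

context sumdiff_seq
begin

lemma conv_prob_reflect:
  assumes "conv_prob p T X c"
  shows "conv_prob p T (\<lambda>N A. X N (reflect N A)) c"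
  using assms unfolding conv_prob_def
  using subset_expect_reflect[of "p N" N "\<lambda>A. of_bool (\<bar>X N A - c * T N\<bar> > e * T N)" for N e] by simp

text \<open>Sums the bound of \<open>avoids_middle\<close> over the indices outside the window. Its
  first term gives a geometric tail, small against \<open>T\<close> for large \<open>L\<close>; the
  second is summable, so it gives a constant independent of \<open>L\<close>; the value 0 costs
  1.\<close>

lemma mid_missing_expectation:
  fixes T :: "nat \<Rightarrow> real"
  assumes p0: "p \<longlonglongrightarrow> 0" and T: "filterlim T at_top sequentially"
    and Tp: "filterlim (\<lambda>N. T N * p N) at_top sequentially"
    and Tn: "\<forall>\<^sub>F N in sequentially. T N ^ (h - 1) * p N ^ h = 1"
  obtains \<kappa> C where "\<kappa> > 0" "C \<ge> 0" "\<And>L. L \<ge> 1 \<Longrightarrow> \<forall>\<^sub>F N in sequentially.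
      subset_expect (p N) {0..int N} (\<lambda>A. real (mid_missing N (nat \<lfloor>L * T N\<rfloor>) A)) \<le> C + exp (- \<kappa> * L) * (1 + T N / \<kappa>)"
proof -
  define \<kappa> where "\<kappa> = density_const / 2"
  have \<kappa>: "\<kappa> > 0" using density_const_pos by (simp add: \<kappa>_def)
  define z where "z = \<kappa> * thinning_const"
  have z: "z > 0" using \<kappa> thinning_const_pos by (simp add: z_def)
  \<comment> \<open>From \<open>exp (- z) \<le> fact k / z ^ k\<close> with
    \<open>k = 2 * (h - 1)\<close>, the power that turns the root of order \<open>h - 1\<close> into
    a square.\<close>
  define K where "K = fact (2 * (h - 1)) / (z ^ (2 * (h - 1)) * thinning_const\<^sup>2)"
  have K: "K \<ge> 0" using z by (simp add: K_def)
  have h1: "0 < h - 1" using h2 by simp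
  have root_tail: "exp (- (z * root (h - 1) (thinning_const * b))) \<le> K * (1 / b\<^sup>2)" if b: "b > 0" for b
  proof -
    let ?r = "root (h - 1) (thinning_const * b)"
    have r: "?r > 0" using b thinning_const_pos h1 by simp
    have "exp (- (z * ?r)) \<le> fact (2 * (h - 1)) / (z * ?r) ^ (2 * (h - 1))"
      using z r by (intro exp_minus_le) simp
    also have "(z * ?r) ^ (2 * (h - 1)) = z ^ (2 * (h - 1)) * (thinning_const * b)\<^sup>2"
    proof -
      have "?r ^ (2 * (h - 1)) = (?r ^ (h - 1))\<^sup>2" by (simp add: power_mult[symmetric] mult.commute)
      also have "?r ^ (h - 1) = thinning_const * b" using b thinning_const_pos h1 by (intro real_root_pow_pos2) auto
      finally show ?thesis by (simp only: power_mult_distrib)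
    qed
    finally show ?thesis by (simp add: K_def power_mult_distrib)
  qed
  show ?thesis
  proof (rule that[of \<kappa> "1 + 2 * K"])
    fix L :: real assume L: "L \<ge> 1"
    have Tbig: "\<forall>\<^sub>F N in sequentially. T N > u" for u using T unfolding filterlim_at_top_dense by blast
    have Tpbig: "\<forall>\<^sub>F N in sequentially. T N * p N > u" for u using Tp unfolding filterlim_at_top_dense by blast
    show "\<forall>\<^sub>F N in sequentially. subset_expect (p N) {0..int N} (\<lambda>A. real (mid_missing N (nat \<lfloor>L * T N\<rfloor>) A))
        \<le> 1 + 2 * K + exp (- \<kappa> * L) * (1 + T N / \<kappa>)"
      using Tbig[of 1] Tbig[of "1 / thinning_const"] Tbig[of "(real h)\<^sup>2 / density_const"] Tpbig[of 1] Tn eventually_ge_at_top[of "4 * h"]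
    proof eventually_elim
      case (elim N)
      define M where "M = nat \<lfloor>L * T N\<rfloor>"
      define Q where "Q = h * N div 2"
      have T0: "T N > 0" using elim by simp
      have LT: "L * T N \<ge> T N" using L T0 by (simp add: mult_le_cancel_right1)
      have M: "L * T N \<le> real (Suc M)" unfolding M_def using L T0 by linarith
      have p0': "0 < p N" "p N \<le> 1" using p01[of N] by auto
      let ?P = "\<lambda>m. subset_expect (p N) {0..int N} (\<lambda>A. of_bool (avoids N (value_at N m) A))"
      have one: "?P m \<le> exp (- \<kappa> * (real (Suc m) / T N)) + K * (1 / (real (Suc m))\<^sup>2)"
        if m: "m \<in> {M<..Q}" and k: "value_at N m \<noteq> 0" for m
      proof -
        let ?b = "real (Suc m)"
        have bM: "real (Suc M) \<le> ?b" using m by simp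
        have bT: "T N \<le> ?b" using bM M LT by linarith
        have b0: "?b > 0" by simp
        have "?P m \<le> exp (- (density_const / 2) * (?b ^ (h - 1) * p N ^ h)) + exp (- (density_const / 2 * thinning_const * root (h - 1) (thinning_const * ?b)))"
        proof (rule avoids_middle)
          show "1 \<le> m" using m by simp
          have "m \<le> h * N div 2" using m by (simp add: Q_def)
          then show "2 * m \<le> h * N" by linarith
          show "(real h)\<^sup>2 / density_const \<le> ?b" using elim bT by linarith
          have "T N * p N \<le> ?b * p N" using bT p0' by (intro mult_right_mono) auto
          then show "1 \<le> ?b * p N" using elim by linarith
          have "thinning_const * T N \<le> thinning_const * ?b" using bT thinning_const_pos by (intro mult_left_mono) auto
          moreover have "1 \<le> thinning_const * T N" using elim(2) thinning_const_pos by (simp add: field_simps)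
          ultimately show "1 \<le> thinning_const * ?b" by linarith
        qed (use elim k p0' in auto)
        moreover have "exp (- (density_const / 2) * (?b ^ (h - 1) * p N ^ h)) \<le> exp (- \<kappa> * (?b / T N))"
        proof -
          \<comment> \<open>Beyond the window \<open>?b \<ge> T N\<close>, so the mean
            \<open>(?b / T N) ^ (h - 1)\<close> may be replaced by the linear
            \<open>?b / T N\<close>, which makes the sum geometric.\<close>
          have "?b / T N \<le> (?b / T N) ^ (h - 1)" using bT T0 h1 by (intro self_le_power) (auto simp: field_simps)
          also have "\<dots> = ?b ^ (h - 1) * p N ^ h"
            using elim(5) T0 by (simp add: power_divide field_simps del: of_nat_Suc)
          finally have "\<kappa> * (?b / T N) \<le> \<kappa> * (?b ^ (h - 1) * p N ^ h)" using \<kappa> by (intro mult_left_mono) auto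
          then show ?thesis by (simp add: \<kappa>_def)
        qed
        moreover have "exp (- (density_const / 2 * thinning_const * root (h - 1) (thinning_const * ?b))) \<le> K * (1 / ?b\<^sup>2)"
          using root_tail[OF b0] unfolding z_def \<kappa>_def .
        ultimately show ?thesis by linarith
      qed
      have "subset_expect (p N) {0..int N} (\<lambda>A. real (mid_missing N M A))
         \<le> subset_expect (p N) {0..int N} (\<lambda>A. \<Sum>m\<in>{M<..Q}. of_bool (avoids N (value_at N m) A))"
      proof (intro subset_expect_mono p01')
        fix A
        have "mid_missing N M A \<le> card {m\<in>{M<..Q}. avoids N (value_at N m) A}"
          unfolding mid_missing_def Q_def using rep_pairs_imp_sumdiff by (intro card_mono) auto
        then have "real (mid_missing N M A) \<le> real (card {m\<in>{M<..Q}. avoids N (value_at N m) A})" by (rule of_nat_mono)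
        then show "real (mid_missing N M A) \<le> (\<Sum>m\<in>{M<..Q}. of_bool (avoids N (value_at N m) A))"
          by (simp add: sum_of_bool_eq Int_def)
      qed
      also have "\<dots> = (\<Sum>m\<in>{M<..Q}. ?P m)" by (rule subset_expect_sum)
      also have "\<dots> \<le> (\<Sum>m\<in>{M<..Q}. exp (- \<kappa> * (real (Suc m) / T N)) + K * (1 / (real (Suc m))\<^sup>2) + of_bool (value_at N m = 0))"
      proof (intro sum_mono)
        fix m assume m: "m \<in> {M<..Q}"
        show "?P m \<le> exp (- \<kappa> * (real (Suc m) / T N)) + K * (1 / (real (Suc m))\<^sup>2) + of_bool (value_at N m = 0)"
        proof (cases "value_at N m = 0")
          case True
          have "?P m \<le> subset_expect (p N) {0..int N} (\<lambda>A. 1)" by (intro subset_expect_mono p01') auto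
          then have "?P m \<le> 1" by (simp add: subset_expect_const)
          moreover have "0 \<le> exp (- \<kappa> * (real (Suc m) / T N)) + K * (1 / (real (Suc m))\<^sup>2)" using K by (intro add_nonneg_nonneg mult_nonneg_nonneg) auto
          ultimately show ?thesis using True by simp
        next
          case False
          then show ?thesis using one[OF m] by simp
        qed
      qed
      also have "\<dots> = (\<Sum>m\<in>{M<..Q}. exp (- \<kappa> * (real (Suc m) / T N))) + K * (\<Sum>m\<in>{M<..Q}. 1 / (real (Suc m))\<^sup>2)
          + (\<Sum>m\<in>{M<..Q}. of_bool (value_at N m = 0))"
        by (simp only: sum.distrib sum_distrib_left)
      also have "\<dots> \<le> exp (- \<kappa> * L) * (1 + T N / \<kappa>) + K * 2 + 1"
      proof (intro add_mono mult_left_mono)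
        show "(\<Sum>m\<in>{M<..Q}. exp (- \<kappa> * (real (Suc m) / T N))) \<le> exp (- \<kappa> * L) * (1 + T N / \<kappa>)"
          by (rule sum_exp_tail_le[OF \<kappa> T0 M])
        show "(\<Sum>m\<in>{M<..Q}. 1 / (real (Suc m))\<^sup>2) \<le> 2" by (rule sum_inverse_squares_le)
        have "card {m\<in>{M<..Q}. value_at N m = 0} \<le> card {d * N}" by (intro card_mono) (auto simp: value_at_def simp flip: of_nat_mult)
        then have "real (card {m\<in>{M<..Q}. value_at N m = 0}) \<le> 1" by simp
        then show "(\<Sum>m\<in>{M<..Q}. of_bool (value_at N m = 0)) \<le> (1::real)" by (simp add: sum_of_bool_eq Int_def)
      qed (rule K)
      finally show ?case by (simp add: M_def)
    qed
  qed (use \<kappa> K in auto)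
qed

end

section \<open>The number of values of a sparse set\<close>

text \<open>Fix a representative of each fibre. Representatives inject into the image, and every
  other element forms a collision with its representative.\<close>

lemma card_le_image_plus_collisions:
  assumes "finite S"
  shows "card S \<le> card (f ` S) + card {(x, y) \<in> S \<times> S. x \<noteq> y \<and> f x = f y}"
proof -
  define r where "r v = (SOME x. x \<in> S \<and> f x = v)" for v
  have r: "r (f x) \<in> S" "f (r (f x)) = f x" if "x \<in> S" for x
    using someI[of "\<lambda>z. z \<in> S \<and> f z = f x" x] that by (auto simp: r_def)
  let ?S1 = "{x\<in>S. r (f x) = x}" and ?S2 = "{x\<in>S. r (f x) \<noteq> x}"
  let ?P = "{(x, y) \<in> S \<times> S. x \<noteq> y \<and> f x = f y}"
  have finP: "finite ?P" by (rule finite_subset[of _ "S \<times> S"]) (use assms in auto)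
  have "card S = card ?S1 + card ?S2"
    using assms by (subst card_Un_disjoint[symmetric]) (auto intro: arg_cong[where f = card])
  moreover have "card ?S1 \<le> card (f ` S)"
  proof (rule card_inj_on_le)
    show "inj_on f ?S1"
    proof (rule inj_onI)
      fix x y assume x: "x \<in> ?S1" and y: "y \<in> ?S1" and eq: "f x = f y"
      have "x = r (f x)" using x by simp
      also have "\<dots> = r (f y)" by (simp only: eq)
      also have "\<dots> = y" using y by simp
      finally show "x = y" .
    qed
  qed (use assms in auto)
  moreover have "card ?S2 \<le> card ?P"
  proof (rule card_inj_on_le)
    show "inj_on (\<lambda>x. (x, r (f x))) ?S2" by (rule inj_onI) simp
    show "(\<lambda>x. (x, r (f x))) ` ?S2 \<subseteq> ?P"
    proof (rule image_subsetI)
      fix x assume "x \<in> ?S2"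
      then have "x \<in> S" "r (f x) \<noteq> x" by auto
      then show "(x, r (f x)) \<in> ?P" using r[of x] by simp
    qed
  qed (rule finP)
  ultimately show ?thesis by linarith
qed

context prob_seq
begin

lemma conv_prob_det:
  assumes "(\<lambda>N. u N / T N) \<longlonglongrightarrow> c" "filterlim T at_top sequentially"
  shows "conv_prob p T (\<lambda>N A. u N) c"
proof (rule conv_probI)
  fix e \<delta> :: real assume e: "e > 0" and d: "\<delta> > 0"
  have "\<forall>\<^sub>F N in sequentially. dist (u N / T N) c < e" using assms(1) e by (rule tendstoD)
  moreover have "\<forall>\<^sub>F N in sequentially. T N > 0" using assms(2) unfolding filterlim_at_top_dense by blast
  ultimately show "\<forall>\<^sub>F N in sequentially. subset_expect (p N) {0..int N} (\<lambda>A. of_bool (\<bar>u N - c * T N\<bar> > e * T N)) \<le> \<delta>"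
  proof eventually_elim
    case (elim N)
    have "u N - c * T N = (u N / T N - c) * T N" using elim(2) by (simp add: left_diff_distrib)
    then have "\<bar>u N - c * T N\<bar> = \<bar>u N / T N - c\<bar> * T N" using elim(2) by (simp only: abs_mult abs_of_pos)
    also have "\<dots> \<le> e * T N" using elim by (intro mult_right_mono) (auto simp: dist_real_def)
    finally have "\<not> \<bar>u N - c * T N\<bar> > e * T N" by simp
    then show ?case using d by (simp add: subset_expect_const)
  qed
qed

lemma conv_prob_uminus: "conv_prob p T X c \<Longrightarrow> conv_prob p T (\<lambda>N A. - X N A) (- c)"
proof -
  have "\<bar>- x - - c * t\<bar> = \<bar>x - c * t\<bar>" for x t :: real by simp
  then show "conv_prob p T X c \<Longrightarrow> conv_prob p T (\<lambda>N A. - X N A) (- c)" by (simp only: conv_prob_def)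
qed

end

context sumdiff_params
begin

lemma sumdiff_set_subset:
  assumes "A \<subseteq> {0..int N}"
  shows "sumdiff_set s d A \<subseteq> {- (int d * int N)..int s * int N}"
proof
  fix k assume "k \<in> sumdiff_set s d A"
  then obtain a b where ab: "k = (\<Sum>i<s. a i) - (\<Sum>j<d. b j)" "\<forall>i<s. a i \<in> A" "\<forall>j<d. b j \<in> A"
    by (auto simp: sumdiff_set_def)
  have A: "0 \<le> x \<and> x \<le> int N" if "x \<in> A" for x using that assms by auto
  have "(\<Sum>i<s. a i) \<le> (\<Sum>i<s. int N)" by (rule sum_mono) (use A ab in auto)
  moreover have "0 \<le> (\<Sum>i<s. a i)" by (rule sum_nonneg) (use A ab in auto)
  moreover have "(\<Sum>j<d. b j) \<le> (\<Sum>j<d. int N)" by (rule sum_mono) (use A ab in auto)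
  moreover have "0 \<le> (\<Sum>j<d. b j)" by (rule sum_nonneg) (use A ab in auto)
  ultimately  show "k \<in> {- (int d * int N)..int s * int N}" using ab(1) by simp
qed

lemma card_sumdiff_set:
  assumes "A \<subseteq> {0..int N}"
  shows "real (card (sumdiff_set s d A)) = real h * real N + 1 - real (card (sumdiff_compl s d N A))"
proof -
  let ?I = "{- (int d * int N)..int s * int N}"
  have sub: "sumdiff_set s d A \<subseteq> ?I" using sumdiff_set_subset[OF assms] .
  have "int s * int N + int d * int N = int (h * N)" unfolding h_eq[symmetric] of_nat_mult of_nat_add by (simp add: algebra_simps)
  then have "card ?I = h * N + 1" by (simp add: nat_eq_iff)
  moreover have "card (sumdiff_compl s d N A) = card ?I - card (sumdiff_set s d A)"
    unfolding sumdiff_compl_def using sub by (intro card_Diff_subset finite_subset[OF sub]) auto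
  moreover have "card (sumdiff_set s d A) \<le> card ?I" using sub by (intro card_mono) auto
  ultimately have "card (sumdiff_set s d A) + card (sumdiff_compl s d N A) = h * N + 1" by linarith
  then have "real (card (sumdiff_set s d A) + card (sumdiff_compl s d N A)) = real (h * N + 1)" by simp
  then show ?thesis by simp
qed

definition pairs_in :: "nat \<Rightarrow> int set \<Rightarrow> (int set \<times> int set) set" where
  "pairs_in N A = {\<rho>\<in>all_pairs N. supp \<rho> \<subseteq> A}"

definition collisions :: "nat \<Rightarrow> int set \<Rightarrow> real" where
  "collisions N A = (\<Sum>\<rho>\<in>all_pairs N. \<Sum>\<rho>'\<in>{\<rho>'\<in>rep_pairs N (pair_value \<rho>). \<rho>' \<noteq> \<rho>}. of_bool (supp \<rho> \<union> supp \<rho>' \<subseteq> A))"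

lemma collisions_nonneg: "0 \<le> collisions N A" unfolding collisions_def by (intro sum_nonneg) auto

lemma all_pairs_supp: "\<rho> \<in> all_pairs N \<Longrightarrow> supp \<rho> \<subseteq> {0..int N}"
proof -
  assume "\<rho> \<in> all_pairs N"
  then obtain f where f: "f \<in> inj_tuples N" "\<rho> = blocks f" by (auto simp: all_pairs_def)
  show ?thesis using inj_tuplesD(2)[OF f(1)] by (simp only: f(2) supp_blocks)
qed

lemma subset_expect_collisions: "subset_expect q {0..int N} (collisions N) = collision_mean N q"
proof -
  have "subset_expect q {0..int N} (\<lambda>A. of_bool (supp \<rho> \<union> supp \<rho>' \<subseteq> A)) = q ^ card (supp \<rho> \<union> supp \<rho>')"
    if "\<rho> \<in> all_pairs N" "\<rho>' \<in> rep_pairs N k" for \<rho> \<rho>' k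
    using that all_pairs_supp by (intro subset_expect_subset_prob) (auto simp: rep_pairs_all_pairs)
  then show ?thesis
    unfolding collision_mean_def collisions_def[abs_def] subset_expect_sum by (intro sum.cong refl) auto
qed

lemma card_pairs_in:
  assumes A: "A \<subseteq> {0..int N}"
  shows "fact s * fact d * card (pairs_in N A) = card {f \<in> {..<h} \<rightarrow>\<^sub>E A. inj_on f {..<h}}"
proof -
  have F: "{f \<in> {..<h} \<rightarrow>\<^sub>E A. inj_on f {..<h}} = {f\<in>inj_tuples N. f ` {..<h} \<subseteq> A}"
    using A by (auto simp: inj_tuples_def PiE_iff)
  have P: "pairs_in N A = blocks ` {f\<in>inj_tuples N. f ` {..<h} \<subseteq> A}" unfolding pairs_in_def all_pairs_def by (auto simp: supp_blocks)
  have "card {f\<in>inj_tuples N. f ` {..<h} \<subseteq> A} = fact s * fact d * card (blocks ` {f\<in>inj_tuples N. f ` {..<h} \<subseteq> A})"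
  proof (rule card_blocks_image[where N = N])
    fix f g assume f: "f \<in> {f\<in>inj_tuples N. f ` {..<h} \<subseteq> A}" and g: "g \<in> inj_tuples N" "blocks g = blocks f"
    have "g ` {..<h} = f ` {..<h}" unfolding supp_blocks[symmetric] g(2) ..
    then show "g \<in> {f\<in>inj_tuples N. f ` {..<h} \<subseteq> A}" using f g by simp
  qed auto
  then show ?thesis by (simp only: F P)
qed

lemma card_inj_functions:
  assumes "finite A"
  shows "card {f \<in> {..<h} \<rightarrow>\<^sub>E A. inj_on f {..<h}} \<le> card A ^ h"
    "card A ^ h \<le> card {f \<in> {..<h} \<rightarrow>\<^sub>E A. inj_on f {..<h}} + h\<^sup>2 * card A ^ (h - 1)"
proof -
  let ?U = "{..<h} \<rightarrow>\<^sub>E A"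
  let ?X = "\<lambda>(i,j). {f\<in>?U. i < h \<and> j < h \<and> i \<noteq> j \<and> f i = f j}"
  let ?P = "{..<h} \<times> {..<h}"
  have finU: "finite ?U" using assms by (intro finite_PiE) auto
  have cU: "card ?U = card A ^ h" by (simp add: card_funcsetE)
  show "card {f \<in> ?U. inj_on f {..<h}} \<le> card A ^ h"
    unfolding cU[symmetric] using finU by (intro card_mono) auto
  have finX: "finite (?X z)" for z using finU by (cases z) (auto intro: finite_subset)
  have "?U \<subseteq> {f \<in> ?U. inj_on f {..<h}} \<union> (\<Union>z\<in>?P. ?X z)"
  proof
    fix f assume f: "f \<in> ?U"
    show "f \<in> {f \<in> ?U. inj_on f {..<h}} \<union> (\<Union>z\<in>?P. ?X z)"
    proof (cases "inj_on f {..<h}")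
      case False
      then obtain i j where "i < h" "j < h" "i \<noteq> j" "f i = f j" by (auto simp: inj_on_def)
      then show ?thesis using f by (intro UnI2 UN_I[of "(i,j)"]) (simp_all only: mem_Sigma_iff lessThan_iff prod.case mem_Collect_eq simp_thms)
    qed (use f in simp)
  qed
  moreover have finUn: "finite (\<Union>z\<in>?P. ?X z)" by (rule finite_UN_I) (use finX in simp_all)
  ultimately have "card ?U \<le> card ({f \<in> ?U. inj_on f {..<h}} \<union> (\<Union>z\<in>?P. ?X z))"
    using finU by (intro card_mono) auto
  also have "\<dots> \<le> card {f \<in> ?U. inj_on f {..<h}} + card (\<Union>z\<in>?P. ?X z)" by (rule card_Un_le)
  also have "card (\<Union>z\<in>?P. ?X z) \<le> (\<Sum>z\<in>?P. card (?X z))" by (intro card_UN_le) auto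
  also have "\<dots> \<le> (\<Sum>z\<in>?P. card A ^ (h - 1))"
  proof (intro sum_mono)
    fix z assume "z \<in> ?P"
    then obtain i j where z: "z = (i,j)" "i < h" "j < h" by auto
    show "card (?X z) \<le> card A ^ (h - 1)"
    proof (cases "i = j")
      case False
      have "card (?X z) \<le> (\<Prod>k\<in>{..<h} - {j}. card A)"
      proof (rule card_PiE_determined)
        fix f g k assume fg: "f \<in> ?X z" "g \<in> ?X z" and eq: "\<And>k. k \<in> {..<h} - {j} \<Longrightarrow> f k = g k" and k: "k \<in> {j}"
        have "f i = g i" by (rule eq) (use z False in auto)
        moreover have "f i = f j" "g i = g j" using fg by (simp_all add: z)
        ultimately show "f k = g k" using k by simp
      qed (use assms z in auto)
      then show ?thesis using z by simp
    qed (simp add: z)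
  qed
  also have "\<dots> = h\<^sup>2 * card A ^ (h - 1)" by (simp add: card_cartesian_product power2_eq_square)
  finally show "card A ^ h \<le> card {f \<in> {..<h} \<rightarrow>\<^sub>E A. inj_on f {..<h}} + h\<^sup>2 * card A ^ (h - 1)"
    unfolding cU by simp
qed

text \<open>A deterministic estimate: up to tuples with repeated entries there are
  \<open>card A ^ h / (s! d!)\<close> pairs of blocks inside \<open>A\<close>; they lose at most
  \<open>collisions\<close> in passing to values, and repeated entries add few values.\<close>

lemma sumdiff_card_approx:
  assumes A: "A \<subseteq> {0..int N}"
  shows "\<bar>real (card (sumdiff_set s d A)) - real (card A) ^ h / (fact s * fact d)\<bar>
    \<le> (real h)\<^sup>2 * real (card A) ^ (h - 1) + collisions N A"
proof -
  let ?F = "fact s * fact d :: real"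
  let ?n = "real (card A)"
  let ?E = "(real h)\<^sup>2 * ?n ^ (h - 1)"
  let ?K = "{k. \<exists>f\<in>{..<h} \<rightarrow>\<^sub>E A. \<not> inj_on f {..<h} \<and> signed_sum f = k}"
  let ?V = "pair_value ` pairs_in N A"
  have finA: "finite A" using A finite_subset by blast
  have F1: "1 \<le> ?F" using mult_mono[of 1 "fact s :: real" 1 "fact d"] by (simp add: fact_ge_1)
  have finP: "finite (pairs_in N A)" by (simp add: pairs_in_def)
  have V: "?V \<subseteq> sumdiff_set s d A"
  proof (rule image_subsetI)
    fix \<rho> assume "\<rho> \<in> pairs_in N A"
    then obtain f where f: "f \<in> inj_tuples N" "\<rho> = blocks f" "f ` {..<h} \<subseteq> A" by (auto simp: pairs_in_def all_pairs_def supp_blocks)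
    then have "f \<in> {..<h} \<rightarrow>\<^sub>E A" by (auto simp: inj_tuples_def PiE_iff)
    then show "pair_value \<rho> \<in> sumdiff_set s d A" using f by (auto simp: sumdiff_set_iff pair_value_blocks)
  qed
  have VK: "sumdiff_set s d A \<subseteq> ?V \<union> ?K"
  proof
    fix k assume "k \<in> sumdiff_set s d A"
    then obtain f where f: "f \<in> {..<h} \<rightarrow>\<^sub>E A" "signed_sum f = k" by (auto simp: sumdiff_set_iff)
    show "k \<in> ?V \<union> ?K"
    proof (cases "inj_on f {..<h}")
      case True
      then have fN: "f \<in> inj_tuples N" using f(1) A by (auto simp: inj_tuples_def PiE_iff)
      moreover have "supp (blocks f) \<subseteq> A" unfolding supp_blocks using f(1) by auto
      ultimately have "blocks f \<in> pairs_in N A" by (auto simp: pairs_in_def all_pairs_def)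
      moreover have "k = pair_value (blocks f)" using fN f(2) by (simp add: pair_value_blocks)
      ultimately show ?thesis by blast
    qed (use f in blast)
  qed
  have finK: "finite ?K" by (rule card_noninj_values(1)[OF finA])
  have "card (sumdiff_set s d A) \<le> card (?V \<union> ?K)" using VK finP finK by (intro card_mono) auto
  also have "\<dots> \<le> card ?V + card ?K" by (rule card_Un_le)
  also have "card ?V \<le> card (pairs_in N A)" using finP by (rule card_image_le)
  also have "card ?K \<le> h\<^sup>2 * card A ^ (h - 1)" by (rule card_noninj_values(2)[OF finA])
  finally have "real (card (sumdiff_set s d A)) \<le> real (card (pairs_in N A) + h\<^sup>2 * card A ^ (h - 1))"
    by (simp only: of_nat_le_iff)
  then have up: "real (card (sumdiff_set s d A)) \<le> real (card (pairs_in N A)) + ?E"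
    by (simp only: of_nat_add of_nat_mult of_nat_power)
  have P1: "?F * real (card (pairs_in N A)) \<le> ?n ^ h"
  proof -
    have "fact s * fact d * card (pairs_in N A) \<le> card A ^ h" unfolding card_pairs_in[OF A] by (rule card_inj_functions(1)[OF finA])
    then have "real (fact s * fact d * card (pairs_in N A)) \<le> real (card A ^ h)" by (rule of_nat_mono)
    then show ?thesis by simp
  qed
  have P2: "?n ^ h \<le> ?F * real (card (pairs_in N A)) + ?E"
  proof -
    have "card A ^ h \<le> fact s * fact d * card (pairs_in N A) + h\<^sup>2 * card A ^ (h - 1)" unfolding card_pairs_in[OF A] by (rule card_inj_functions(2)[OF finA])
    then have "real (card A ^ h) \<le> real (fact s * fact d * card (pairs_in N A) + h\<^sup>2 * card A ^ (h - 1))" by (rule of_nat_mono)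
    then show ?thesis by simp
  qed
  have Q1: "real (card (pairs_in N A)) \<le> ?n ^ h / ?F" using P1 F1 by (simp add: pos_le_divide_eq mult.commute)
  have Q2: "?n ^ h / ?F \<le> real (card (pairs_in N A)) + ?E"
  proof -
    have "?E \<le> ?F * ?E" using mult_right_mono[OF F1, of ?E] by simp
    then have "?n ^ h \<le> ?F * (real (card (pairs_in N A)) + ?E)" using P2 by (simp add: distrib_left)
    then show ?thesis using F1 by (simp add: pos_divide_le_eq mult.commute)
  qed
  have "card (pairs_in N A) \<le> card ?V + card {(x, y) \<in> pairs_in N A \<times> pairs_in N A. x \<noteq> y \<and> pair_value x = pair_value y}"
    by (rule card_le_image_plus_collisions[OF finP])
  moreover have "card ?V \<le> card (sumdiff_set s d A)"
    using V VK finP finK by (intro card_mono) (auto intro: finite_subset)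
  ultimately have lo: "real (card (pairs_in N A)) \<le> real (card (sumdiff_set s d A)) + real (card {(x, y) \<in> pairs_in N A \<times> pairs_in N A. x \<noteq> y \<and> pair_value x = pair_value y})"
    by linarith
  have "real (card {(x, y) \<in> pairs_in N A \<times> pairs_in N A. x \<noteq> y \<and> pair_value x = pair_value y}) \<le> collisions N A"
  proof -
    let ?S = "\<lambda>\<rho>. {\<rho>'\<in>{\<rho>'\<in>rep_pairs N (pair_value \<rho>). \<rho>' \<noteq> \<rho>}. supp \<rho> \<union> supp \<rho>' \<subseteq> A}"
    have "card {(x, y) \<in> pairs_in N A \<times> pairs_in N A. x \<noteq> y \<and> pair_value x = pair_value y} \<le> card (Sigma (all_pairs N) ?S)"
      by (intro card_mono finite_SigmaI) (auto simp: pairs_in_def rep_pairs_all_pairs)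
    also have "\<dots> = (\<Sum>\<rho>\<in>all_pairs N. card (?S \<rho>))" by (rule card_SigmaI) auto
    finally have "real (card {(x, y) \<in> pairs_in N A \<times> pairs_in N A. x \<noteq> y \<and> pair_value x = pair_value y}) \<le> real (\<Sum>\<rho>\<in>all_pairs N. card (?S \<rho>))"
      by (rule of_nat_mono)
    also have "\<dots> = collisions N A"
    proof -
      have "real (card (?S \<rho>)) = (\<Sum>\<rho>'\<in>{\<rho>'\<in>rep_pairs N (pair_value \<rho>). \<rho>' \<noteq> \<rho>}. of_bool (supp \<rho> \<union> supp \<rho>' \<subseteq> A))" for \<rho>
        by (subst sum_of_bool_eq) (auto intro!: arg_cong[where f = card])
      then show ?thesis unfolding collisions_def by (simp only: of_nat_sum)
    qed
    finally show ?thesis .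
  qed
  with lo up Q1 Q2 collisions_nonneg[of N A] show ?thesis by linarith
qed

end

section \<open>The sparse and critical regimes\<close>

context prob_seq
begin

lemma conv_prob_cmult:
  assumes X: "conv_prob p T X c" and a: "a > 0"
  shows "conv_prob p T (\<lambda>N A. a * X N A) (a * c)"
proof -
  have eq: "(\<bar>a * x - a * c * t\<bar> > e * t) = (\<bar>x - c * t\<bar> > (e / a) * t)" for x t e :: real
  proof -
    have "\<bar>a * x - a * c * t\<bar> = a * \<bar>x - c * t\<bar>"
      using a abs_mult[of a "x - c * t"] by (simp add: right_diff_distrib)
    then show ?thesis using a by (simp add: field_simps)
  qed
  show ?thesis
    unfolding conv_prob_def eq
  proof (intro allI impI)
    fix e :: real assume "e > 0"
    then have "e / a > 0" using a by simp
    then show "(\<lambda>N. subset_expect (p N) {0..int N} (\<lambda>A. of_bool (\<bar>X N A - c * T N\<bar> > e / a * T N))) \<longlonglongrightarrow> 0"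
      using X unfolding conv_prob_def by blast
  qed
qed

text \<open>Continuity of the power function at 1, applied to the ratio
  \<open>X / T\<close>.\<close>

lemma conv_prob_power:
  assumes X: "conv_prob p T X 1" and T: "\<forall>\<^sub>F N in sequentially. T N > 0"
  shows "conv_prob p (\<lambda>N. T N ^ n) (\<lambda>N A. X N A ^ n) 1"
proof (rule conv_probI)
  fix e \<delta> :: real assume e: "e > 0" and d: "\<delta> > 0"
  have "((\<lambda>x::real. x ^ n) \<longlongrightarrow> 1 ^ n) (at 1)" by (intro tendsto_intros)
  from LIM_D[OF this e] obtain r where r: "r > 0"
    "\<And>x::real. x \<noteq> 1 \<Longrightarrow> norm (x - 1) < r \<Longrightarrow> norm (x ^ n - 1 ^ n) < e" by auto
  have r': "\<bar>x ^ n - 1\<bar> \<le> e" if "\<bar>x - 1\<bar> \<le> r / 2" for x :: real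
    using r(2)[of x] that r(1) e by (cases "x = 1") (auto simp: dist_real_def)
  have "r / 2 > 0" using r by simp
  from conv_probD[OF X this d] T
  show "\<forall>\<^sub>F N in sequentially. subset_expect (p N) {0..int N} (\<lambda>A. of_bool (\<bar>X N A ^ n - 1 * T N ^ n\<bar> > e * T N ^ n)) \<le> \<delta>"
  proof eventually_elim
    case (elim N)
    have "subset_expect (p N) {0..int N} (\<lambda>A. of_bool (\<bar>X N A ^ n - 1 * T N ^ n\<bar> > e * T N ^ n))
       \<le> dev_prob p X 1 T (r / 2) N"
    proof (intro subset_expect_mono p01')
      fix A
      have "\<bar>X N A ^ n - 1 * T N ^ n\<bar> \<le> e * T N ^ n" if "\<bar>X N A - 1 * T N\<bar> \<le> r / 2 * T N"
      proof -
        have t: "T N > 0" by (rule elim(2))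
        have "X N A - 1 * T N = (X N A / T N - 1) * T N" using t by (simp add: left_diff_distrib)
        then have "\<bar>X N A / T N - 1\<bar> * T N \<le> r / 2 * T N" using that t by (simp only: abs_mult abs_of_pos)
        then have "\<bar>X N A / T N - 1\<bar> \<le> r / 2" using t by simp
        then have 1: "\<bar>(X N A / T N) ^ n - 1\<bar> \<le> e" by (rule r')
        have tn: "T N ^ n > 0" using t by simp
        have "X N A ^ n - 1 * T N ^ n = ((X N A / T N) ^ n - 1) * T N ^ n" using t by (simp add: left_diff_distrib power_divide)
        then have "\<bar>X N A ^ n - 1 * T N ^ n\<bar> = \<bar>(X N A / T N) ^ n - 1\<bar> * T N ^ n" using tn by (simp only: abs_mult abs_of_pos)
        then show ?thesis using 1 tn by (simp only: mult_right_mono less_imp_le)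
      qed
      then show "of_bool (\<bar>X N A ^ n - 1 * T N ^ n\<bar> > e * T N ^ n) \<le> (of_bool (\<bar>X N A - 1 * T N\<bar> > r / 2 * T N) :: real)"
        by (cases "\<bar>X N A - 1 * T N\<bar> \<le> r / 2 * T N") (simp_all only: of_bool_def not_less not_le if_True if_False, auto)
    qed
    then show ?case using elim(1) by linarith
  qed
qed

lemma conv_prob_L1:
  assumes X: "\<And>N A. 0 \<le> X N A" and E: "\<forall>\<^sub>F N in sequentially. subset_expect (p N) {0..int N} (X N) \<le> w N * T N"
    and w: "w \<longlonglongrightarrow> 0" and T: "\<forall>\<^sub>F N in sequentially. T N > 0"
  shows "conv_prob p T X 0"
proof (rule conv_probI)
  fix e \<delta> :: real assume e: "e > 0" and d: "\<delta> > 0"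
  have "e * \<delta> > 0" using e d by simp
  then have "\<forall>\<^sub>F N in sequentially. dist (w N) 0 < e * \<delta>" using w by (intro tendstoD)
  with E T show "\<forall>\<^sub>F N in sequentially. dev_prob p X 0 T e N \<le> \<delta>"
  proof eventually_elim
    case (elim N)
    have et: "e * T N > 0" using e elim by simp
    have "dev_prob p X 0 T e N
        \<le> subset_expect (p N) {0..int N} (\<lambda>A. of_bool (X N A \<ge> e * T N))"
      using X by (intro subset_expect_mono p01') auto
    also have "\<dots> \<le> subset_expect (p N) {0..int N} (X N) / (e * T N)"
      by (rule subset_expect_markov[OF p01' et X])
    also have "\<dots> \<le> (w N * T N) / (e * T N)" using elim(1) et by (intro divide_right_mono) auto
    also have "\<dots> = w N / e" using elim(2) by simp
    also have "\<dots> \<le> \<delta>" using elim(3) e by (simp add: dist_real_def field_simps)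
    finally show ?case .
  qed
qed

end

locale sumdiff_asymp = sumdiff_seq s d h p for s d h :: nat and p :: "nat \<Rightarrow> real" +
  assumes p0: "p \<longlonglongrightarrow> 0" and Np: "filterlim (\<lambda>N. real N * p N) at_top sequentially"
begin

lemma Np_big: "\<forall>\<^sub>F N in sequentially. real N * p N > z"
  using Np unfolding filterlim_at_top_dense by blast

lemma N_at_top: "filterlim (\<lambda>N. real N) at_top sequentially" by (rule filterlim_real_sequentially)

lemma Suc_ratio: "(\<lambda>N. (real N + 1) / real N) \<longlonglongrightarrow> 1" by real_asymp

text \<open>The first two moments of a binomial variable with \<open>N + 1\<close> trials; the
  factors \<open>(N + 1) / N\<close> account for the extra trial.\<close>

lemma conv_prob_card: "conv_prob p (\<lambda>N. real N * p N) (\<lambda>N A. real (card A)) 1"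
proof -
  let ?V = "\<lambda>N. {0..int N}"
  let ?S = "\<lambda>N A. \<Sum>v\<in>?V N. of_bool ({v} \<subseteq> A) :: real"
  have cardA: "real (card A) = ?S N A" if "A \<subseteq> ?V N" for N A
  proof -
    have "?V N \<inter> {v. v \<in> A} = A" using that by auto
    then show ?thesis by (simp add: sum_of_bool_eq)
  qed
  define u where "u N = ((real N + 1) / real N) * (1 / (real N * p N)) + ((real N + 1) / real N)\<^sup>2" for N
  define l where "l N = (real N + 1) / real N" for N
  have "conv_prob p (\<lambda>N. real N * p N) ?S 1"
  proof (rule conv_prob_moments[OF Np])
    have cV: "real (card (?V N)) = real N + 1" for N by simp
    show "\<forall>\<^sub>F N in sequentially. subset_expect (p N) (?V N) (\<lambda>A. (?S N A)\<^sup>2) \<le> u N * (real N * p N)\<^sup>2"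
      using Np_big[of 0]
    proof eventually_elim
      case (elim N)
      have N0: "real N > 0" "p N > 0" using elim p01[of N] by (auto simp: zero_less_mult_iff)
      have "subset_expect (p N) (?V N) (\<lambda>A. (?S N A)\<^sup>2) = subset_expect (p N) (?V N) (\<lambda>A. \<Sum>v\<in>?V N. \<Sum>w\<in>?V N. of_bool ({v, w} \<subseteq> A))"
        unfolding power2_eq_square sum_product by (intro subset_expect_cong sum.cong refl) auto
      also have "\<dots> = (\<Sum>v\<in>?V N. \<Sum>w\<in>?V N. subset_expect (p N) (?V N) (\<lambda>A. of_bool ({v, w} \<subseteq> A)))" by (simp only: subset_expect_sum)
      also have "\<dots> = (\<Sum>v\<in>?V N. \<Sum>w\<in>?V N. p N ^ card {v, w})"
        by (intro sum.cong refl subset_expect_subset_prob) auto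
      also have "\<dots> \<le> (\<Sum>v\<in>?V N. \<Sum>w\<in>?V N. of_bool (w = v) * p N + (p N)\<^sup>2)"
      proof (intro sum_mono)
        fix v w :: int
        show "p N ^ card {v, w} \<le> of_bool (w = v) * p N + (p N)\<^sup>2"
          using N0 by (cases "w = v") (auto simp: power2_eq_square)
      qed
      also have "\<dots> = (\<Sum>v\<in>?V N. p N + (real N + 1) * (p N)\<^sup>2)"
        by (intro sum.cong refl) (simp add: sum.distrib cV sum_of_bool_eq flip: sum_distrib_right)
      also have "\<dots> = (real N + 1) * (p N + (real N + 1) * (p N)\<^sup>2)" by (simp add: cV)
      also have "\<dots> = u N * (real N * p N)\<^sup>2"
        using N0 by (simp add: u_def power2_eq_square field_simps)
      finally show ?case .
    qed
    show "\<forall>\<^sub>F N in sequentially. l N * (real N * p N) \<le> subset_expect (p N) (?V N) (?S N)"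
      using Np_big[of 0]
    proof eventually_elim
      case (elim N)
      have N0: "real N > 0" using elim by (cases N) auto
      have "subset_expect (p N) (?V N) (?S N) = (\<Sum>v\<in>?V N. subset_expect (p N) (?V N) (\<lambda>A. of_bool ({v} \<subseteq> A)))" by (rule subset_expect_sum)
      also have "\<dots> = (\<Sum>v\<in>?V N. p N ^ card {v})" by (intro sum.cong refl subset_expect_subset_prob) auto
      also have "\<dots> = l N * (real N * p N)" using N0 by (simp add: l_def)
      finally show ?case by simp
    qed
    have "(\<lambda>N. 1 / (real N * p N)) \<longlonglongrightarrow> 0" by (rule real_tendsto_divide_at_top[OF tendsto_const Np])
    then have "u \<longlonglongrightarrow> 1 * 0 + 1\<^sup>2" unfolding u_def by (intro tendsto_intros Suc_ratio)
    then show "u \<longlonglongrightarrow> 1\<^sup>2" by simp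
    show "l \<longlonglongrightarrow> 1" unfolding l_def by (rule Suc_ratio)
  qed simp
  then show ?thesis by (rule conv_prob_cong) (use cardA in auto)
qed

theorem sparse_regime:
  assumes o: "p \<in> o(\<lambda>N. real N powr (- ((real h - 1) / real h)))"
  shows "rv_asymp (\<lambda>N. random_subset N (p N)) (\<lambda>N A. real (card (sumdiff_set s d A)))
          (\<lambda>N. (real N * p N) ^ h / (fact s * fact d))"
proof -
  let ?F = "fact s * fact d :: real"
  define T where "T N = (real N * p N) ^ h" for N
  have F0: "1 / ?F > 0" by simp
  have Tpos: "\<forall>\<^sub>F N in sequentially. T N > 0" using Np_big[of 0] by eventually_elim (simp add: T_def)
  have main: "conv_prob p T (\<lambda>N A. 1 / ?F * real (card A) ^ h) (1 / ?F * 1)"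
    unfolding T_def by (intro conv_prob_cmult[OF conv_prob_power[OF conv_prob_card Np_big] F0])
  \<comment> \<open>\<open>(N p) ^ h / N\<close> is the \<open>h\<close>-th power of
    \<open>p\<close> over its threshold, so this is where sparseness enters; the ratio bounds the
    expected collisions relative to \<open>T\<close>.\<close>
  have ratio: "(\<lambda>N. overlap_const * 4 ^ h * ((real N * p N) ^ h / real N)) \<longlonglongrightarrow> 0"
  proof -
    have "(\<lambda>N. (p N / real N powr (- ((real h - 1) / real h))) ^ h) \<longlonglongrightarrow> 0 ^ h"
      by (intro tendsto_power smalloD_tendsto[OF o])
    moreover have "\<forall>\<^sub>F N in sequentially. (p N / real N powr (- ((real h - 1) / real h))) ^ h = (real N * p N) ^ h / real N"
      using eventually_gt_at_top[of 0]
    proof eventually_elim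
      case (elim N)
      have "(real N powr (- ((real h - 1) / real h))) ^ h = real N powr (- (real h - 1))"
        using elim h2 by (simp add: powr_powr flip: powr_realpow)
      also have "\<dots> = real N / real N ^ h"
        using elim by (simp add: powr_diff powr_realpow)
      finally show ?case using elim by (simp add: power_divide power_mult_distrib)
    qed
    ultimately have "(\<lambda>N. (real N * p N) ^ h / real N) \<longlonglongrightarrow> 0 ^ h" by (rule Lim_transform_eventually)
    then have "(\<lambda>N. overlap_const * 4 ^ h * ((real N * p N) ^ h / real N)) \<longlonglongrightarrow> overlap_const * 4 ^ h * 0 ^ h" by (intro tendsto_mult tendsto_const)
    moreover have "(0::real) ^ h = 0" using h2 by (simp add: power_0_left)
    ultimately show ?thesis by (simp only: mult_zero_right)
  qed
  have coll: "conv_prob p T collisions 0"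
  proof (rule conv_prob_L1[OF collisions_nonneg _ ratio Tpos])
    show "\<forall>\<^sub>F N in sequentially. subset_expect (p N) {0..int N} (collisions N) \<le> overlap_const * 4 ^ h * ((real N * p N) ^ h / real N) * T N"
      using Np_big[of 1]
    proof eventually_elim
      case (elim N)
      have N0: "real N \<ge> 1" using elim by (cases N) auto
      have pN: "0 < p N" "p N \<le> 1" using p01[of N] by auto
      have le: "real N * p N \<le> real (Suc N) * p N" using pN by (intro mult_right_mono) auto
      have "subset_expect (p N) {0..int N} (collisions N) \<le> overlap_const * (real (Suc N) * p N) ^ (2 * h) / real (Suc N)"
        unfolding subset_expect_collisions
      proof (rule collision_mean_le)
        show "1 \<le> real (Suc N) * p N" using le elim by linarith
      qed (use pN in simp)
      also have "\<dots> \<le> overlap_const * (2 * (real N * p N)) ^ (2 * h) / real N"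
      proof (intro frac_le mult_left_mono power_mono)
        show "real (Suc N) * p N \<le> 2 * (real N * p N)"
          using mult_right_mono[of "real (Suc N)" "2 * real N" "p N"] N0 pN by simp
      qed (use N0 pN overlap_const_pos in auto)
      also have "\<dots> = overlap_const * 4 ^ h * ((real N * p N) ^ h / real N) * T N"
      proof -
        have "(2 * (real N * p N)) ^ (2 * h) = 4 ^ h * ((real N * p N) ^ h * (real N * p N) ^ h)"
          unfolding power_mult_distrib[of 2] power_mult[of 2] by (simp add: mult_2 power_add)
        then show ?thesis by (simp add: T_def)
      qed
      finally show ?case .
    qed
  qed
  have deg: "conv_prob p T (\<lambda>N A. (real h)\<^sup>2 * real (card (A \<inter> {0..int N})) ^ (h - 1)) 0"
  proof (rule conv_prob_count[where w = "\<lambda>N. 2 * real N"])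
    show "\<forall>\<^sub>F N in sequentially. real (card {0..int N}) \<le> 2 * real N"
      using eventually_ge_at_top[of 1] by eventually_elim simp
    show "\<forall>\<^sub>F N in sequentially. 2 * real N > 0" using eventually_gt_at_top[of 0] by eventually_elim simp
    have "(\<lambda>N. 2 ^ (h - 1) / (real N * p N)) \<longlonglongrightarrow> 0" by (rule real_tendsto_divide_at_top[OF tendsto_const Np])
    moreover have "\<forall>\<^sub>F N in sequentially. 2 ^ (h - 1) / (real N * p N) = (2 * real N * p N) ^ (h - 1) / T N"
      using Np_big[of 0]
    proof eventually_elim
      case (elim N)
      have "T N = (real N * p N) * (real N * p N) ^ (h - 1)" unfolding T_def using h2 by (simp flip: power_Suc)
      moreover have "(2 * real N * p N) ^ (h - 1) = 2 ^ (h - 1) * (real N * p N) ^ (h - 1)"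
        by (simp only: power_mult_distrib mult.assoc)
      moreover have "real N * p N \<noteq> 0" using elim by linarith
      then have "(real N * p N) ^ (h - 1) \<noteq> 0" by (rule power_not_zero)
      ultimately show ?case by simp
    qed
    ultimately show "(\<lambda>N. (2 * real N * p N) ^ (h - 1) / T N) \<longlonglongrightarrow> 0" by (rule Lim_transform_eventually)
  qed (use Tpos in auto)
  have err: "conv_prob p T (\<lambda>N A. (real h)\<^sup>2 * real (card (A \<inter> {0..int N})) ^ (h - 1) + collisions N A) 0"
    using conv_prob_add[OF deg coll] by (simp only: add_0)
  have "conv_prob p T (\<lambda>N A. real (card (sumdiff_set s d A)) - 1 / ?F * real (card A) ^ h) 0"
  proof (rule conv_prob_mono0[OF err])
    show "\<forall>\<^sub>F N in sequentially. \<forall>A\<subseteq>{0..int N}. \<bar>real (card (sumdiff_set s d A)) - 1 / ?F * real (card A) ^ h\<bar>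
      \<le> \<bar>(real h)\<^sup>2 * real (card (A \<inter> {0..int N})) ^ (h - 1) + collisions N A\<bar>"
    proof (intro always_eventually allI impI)
      fix N and A :: "int set" assume A: "A \<subseteq> {0..int N}"
      then have "A \<inter> {0..int N} = A" by auto
      then show "\<bar>real (card (sumdiff_set s d A)) - 1 / ?F * real (card A) ^ h\<bar>
        \<le> \<bar>(real h)\<^sup>2 * real (card (A \<inter> {0..int N})) ^ (h - 1) + collisions N A\<bar>"
        using sumdiff_card_approx[OF A] by simp
    qed
  qed
  from conv_prob_add[OF main this]
  have "conv_prob p T (\<lambda>N A. real (card (sumdiff_set s d A))) (1 / ?F)" by simp
  then show ?thesis by (rule rv_asymp_conv_prob[OF _ F0 Tpos]) (simp add: T_def)
qed

text \<open>The counting error of order \<open>T ^ (h - 2)\<close>, multiplied by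
  \<open>p ^ h\<close>, is smaller by a factor \<open>T\<close> than the bounded quantity
  \<open>T ^ (h - 1) * p ^ h\<close>.\<close>

lemma box_count_uniform:
  fixes T :: "nat \<Rightarrow> real"
  assumes T: "filterlim T at_top sequentially" and D: "\<forall>\<^sub>F N in sequentially. T N ^ (h - 1) * p N ^ h \<le> D"
    and L: "L > 0" and e: "e > 0"
  shows "\<forall>\<^sub>F N in sequentially. \<forall>m\<le>nat \<lfloor>L * T N\<rfloor>.
     \<bar>real (box_count h N (int m)) * p N ^ h - real N ^ (h - 1) * ihpoly h (real m / real N) * p N ^ h\<bar> \<le> e"
proof -
  define C where "C = 2 ^ h * (2 * (real h)\<^sup>2) * (L + real h) ^ (h - 2)"
  have Cnn: "0 \<le> C" using L by (simp add: C_def)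
  have Tbig: "\<forall>\<^sub>F N in sequentially. T N > u" for u using T unfolding filterlim_at_top_dense by blast
  show ?thesis
    using D Tbig[of 1] Tbig[of "C * D / e"] eventually_gt_at_top[of 0]
  proof eventually_elim
    case (elim N)
    show ?case
    proof (intro allI impI)
      fix m assume m: "m \<le> nat \<lfloor>L * T N\<rfloor>"
      have T0: "T N > 0" using elim by simp
      have "0 \<le> L * T N" using L T0 by simp
      then have "real m \<le> L * T N" using m by linarith
      moreover have "real h \<le> real h * T N" using elim(2) by (simp add: mult_le_cancel_left1)
      ultimately have mh: "real m + real h \<le> (L + real h) * T N" by (simp add: algebra_simps)
      have ph: "0 \<le> p N ^ h" using p01' by simp
      have "\<bar>real (box_count h N (int m)) * p N ^ h - real N ^ (h - 1) * ihpoly h (real m / real N) * p N ^ h\<bar>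
        = \<bar>real (box_count h N (int m)) - real N ^ (h - 1) * ihpoly h (real m / real N)\<bar> * p N ^ h"
        using ph by (simp add: abs_mult flip: left_diff_distrib)
      also have "\<dots> \<le> (2 ^ h * (2 * (real h)\<^sup>2) * (real m + real h) ^ (h - 2)) * p N ^ h"
        using box_count_approx[of "int m" h N] h2 elim(4) ph by (intro mult_right_mono) auto
      also have "\<dots> \<le> (2 ^ h * (2 * (real h)\<^sup>2) * ((L + real h) * T N) ^ (h - 2)) * p N ^ h"
        using mh ph by (intro mult_right_mono mult_left_mono power_mono) auto
      also have "\<dots> = C * (T N ^ (h - 1) * p N ^ h) / T N"
      proof -
        have "h - 1 = Suc (h - 2)" using h2 by simp
        then show ?thesis using T0 by (simp add: C_def power_mult_distrib)
      qed
      also have "\<dots> \<le> C * D / T N" using elim(1) Cnn T0 by (intro divide_right_mono mult_left_mono) auto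
      also have "\<dots> \<le> e" using elim(3) e T0 by (simp add: field_simps)
      finally show "\<bar>real (box_count h N (int m)) * p N ^ h - real N ^ (h - 1) * ihpoly h (real m / real N) * p N ^ h\<bar> \<le> e" .
    qed
  qed
qed

text \<open>The alternating sum does not show its sign, but it is a limit of the nonnegative counts
  \<open>box_count\<close> divided by \<open>N ^ (h - 1)\<close>.\<close>

lemma ihpoly_nonneg:
  assumes x: "x \<ge> 0"
  shows "0 \<le> ihpoly h x"
proof (rule ccontr)
  assume "\<not> 0 \<le> ihpoly h x"
  then have neg: "ihpoly h x < 0" by simp
  have lim: "(\<lambda>N. real (nat \<lfloor>x * real N\<rfloor>) / real N) \<longlonglongrightarrow> x"
  proof (rule tendsto_sandwich[of "\<lambda>N. x - 1 / real N" _ _ "\<lambda>N. x"])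
    show "\<forall>\<^sub>F N in sequentially. x - 1 / real N \<le> real (nat \<lfloor>x * real N\<rfloor>) / real N"
      using eventually_gt_at_top[of 0]
    proof eventually_elim
      case (elim N)
      have "x * real N - 1 \<le> real (nat \<lfloor>x * real N\<rfloor>)" by linarith
      then have "(x * real N - 1) / real N \<le> real (nat \<lfloor>x * real N\<rfloor>) / real N" by (rule divide_right_mono) simp
      then show ?case using elim by (simp add: diff_divide_distrib)
    qed
    show "\<forall>\<^sub>F N in sequentially. real (nat \<lfloor>x * real N\<rfloor>) / real N \<le> x"
      using eventually_gt_at_top[of 0]
    proof eventually_elim
      case (elim N)
      have "0 \<le> x * real N" using x by simp
      then have "real (nat \<lfloor>x * real N\<rfloor>) \<le> x * real N" by linarith
      then show ?case using elim by (simp add: field_simps)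
    qed
    show "(\<lambda>N. x - 1 / real N) \<longlonglongrightarrow> x" by real_asymp
  qed simp
  have "isCont (ihpoly h) x" using continuous_on_ihpoly[of UNIV h] by (simp add: continuous_on_eq_continuous_at)
  then have "(\<lambda>N. ihpoly h (real (nat \<lfloor>x * real N\<rfloor>) / real N)) \<longlonglongrightarrow> ihpoly h x"
    using lim by (rule isCont_tendsto_compose)
  moreover have "ihpoly h x < ihpoly h x / 2" using neg by simp
  ultimately have ev1: "\<forall>\<^sub>F N in sequentially. ihpoly h (real (nat \<lfloor>x * real N\<rfloor>) / real N) < ihpoly h x / 2"
    by (rule order_tendstoD(2))
  define K where "K = 2 ^ h * (2 * (real h)\<^sup>2) * (x + real h) ^ (h - 2)"
  have "\<forall>\<^sub>F N in sequentially. real N > 2 * K / (- ihpoly h x)"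
    using N_at_top unfolding filterlim_at_top_dense by blast
  with ev1 eventually_gt_at_top[of 0] have "\<forall>\<^sub>F N in sequentially. False"
  proof eventually_elim
    case (elim N)
    define m where "m = nat \<lfloor>x * real N\<rfloor>"
    have xN: "0 \<le> x * real N" using x by simp
    then have "real m \<le> x * real N" unfolding m_def by linarith
    moreover have "real h \<le> real h * real N" using elim(2) by (simp add: mult_le_cancel_left1)
    ultimately have mh: "real m + real h \<le> (x + real h) * real N" by (simp add: algebra_simps)
    have h21: "h - 1 = Suc (h - 2)" using h2 by simp
    have "real (box_count h N (int m)) - real N ^ (h - 1) * ihpoly h (real m / real N) \<le> 2 ^ h * (2 * (real h)\<^sup>2) * (real m + real h) ^ (h - 2)"
      using box_count_approx[of "int m" h N] h2 elim(2) by auto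
    also have "\<dots> \<le> 2 ^ h * (2 * (real h)\<^sup>2) * ((x + real h) * real N) ^ (h - 2)"
      using mh by (intro mult_left_mono power_mono) auto
    also have "\<dots> = K * real N ^ (h - 2)" by (simp add: K_def power_mult_distrib)
    finally have "- (real N ^ (h - 1) * ihpoly h (real m / real N)) \<le> K * real N ^ (h - 2)" by simp
    then have "real N ^ (h - 2) * (- (real N * ihpoly h (real m / real N))) \<le> real N ^ (h - 2) * K"
      unfolding h21 by (simp add: algebra_simps)
    then have 1: "- (real N * ihpoly h (real m / real N)) \<le> K" by (rule mult_left_le_imp_le) (use elim(2) in simp)
    have "real N * (- ihpoly h x / 2) \<le> real N * (- ihpoly h (real m / real N))"
      using elim(1) by (intro mult_left_mono) (auto simp: m_def)
    then have "real N * (- ihpoly h x / 2) \<le> K" using 1 by simp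
    moreover have "K < real N * (- ihpoly h x / 2)" using elim(3) neg by (simp add: field_simps)
    ultimately show False by linarith
  qed
  then show False by simp
qed

text \<open>Positivity of both limit constants of the critical regime, without which a relative
  asymptotic could not be concluded.\<close>

lemma exp_irwin_hall_integral:
  assumes a: "a > 0"
  defines "I \<equiv> integral {0..real h / 2} (\<lambda>x. exp (- a * irwin_hall h x))"
  shows "I = integral {0..real h / 2} (\<lambda>x. exp (- a * ihpoly h x))" "0 < I" "2 * I < real h"
proof -
  let ?f = "\<lambda>x. exp (- a * ihpoly h x)"
  show I: "I = integral {0..real h / 2} ?f"
    unfolding I_def by (intro integral_cong) (simp add: irwin_hall_eq_ihpoly)
  have cf: "continuous_on {0..real h / 2} ?f" by (intro continuous_intros continuous_on_ihpoly)
  have h0: "0 < real h / 2" using h2 by simp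
  have "I \<ge> 0" unfolding I by (intro integral_nonneg integrable_continuous_real cf) simp
  moreover have "I \<noteq> 0" unfolding I using integral_eq_0_iff[OF cf h0] h0 by (auto intro: bexI[of _ 0])
  ultimately show "0 < I" by simp
  let ?g = "\<lambda>x. 1 - ?f x"
  have cg: "continuous_on {0..real h / 2} ?g" by (intro continuous_intros cf)
  have g0: "0 \<le> ?g x" if "x \<in> {0..real h / 2}" for x
    using that ihpoly_nonneg[of x] a by simp
  have "integral {0..real h / 2} ?g = integral {0..real h / 2} (\<lambda>x. 1) - I"
    unfolding I by (intro integral_diff integrable_continuous_real cf) auto
  also have "integral {0..real h / 2} (\<lambda>x. 1::real) = real h / 2" using h0 by simp
  finally have eq: "integral {0..real h / 2} ?g = real h / 2 - I" .
  have "integral {0..real h / 2} ?g \<ge> 0" by (intro integral_nonneg integrable_continuous_real cg g0)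
  moreover have "integral {0..real h / 2} ?g \<noteq> 0"
  proof
    assume "integral {0..real h / 2} ?g = 0"
    \<comment> \<open>The point 1 lies in the interval because \<open>h \<ge> 2\<close>, and the
      density there is \<open>1 / (h - 1)!\<close>, not 0.\<close>
    then have "?g 1 = 0" using integral_eq_0_iff[OF cg h0 g0] h2 by auto
    then have "ihpoly h 1 = 0" using a by simp
    then show False using ihpoly_small[of 1 h] h2 by simp
  qed
  ultimately show "2 * I < real h" using eq by linarith
qed

theorem critical_regime:
  assumes c: "c > 0" and pc: "\<forall>\<^sub>F N in sequentially. p N = c * real N powr (- ((real h - 1) / real h))"
  defines "I \<equiv> integral {0..real h / 2} (\<lambda>x. exp (- (c ^ h / (fact s * fact d)) * irwin_hall h x))"
  shows "rv_asymp (\<lambda>N. random_subset N (p N)) (\<lambda>N A. real (card (sumdiff_set s d A))) (\<lambda>N. (real h - 2 * I) * real N)"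
    "rv_asymp (\<lambda>N. random_subset N (p N)) (\<lambda>N A. real (card (sumdiff_compl s d N A))) (\<lambda>N. (2 * I) * real N)"
proof -
  let ?F = "fact s * fact d :: real"
  let ?T = "\<lambda>N. real N"
  have a: "c ^ h / ?F > 0" using c by simp
  note I = exp_irwin_hall_integral[OF a, folded I_def]
  have Tp: "filterlim (\<lambda>N. ?T N * p N) at_top sequentially" by (rule Np)
  \<comment> \<open>The exponent of the threshold is the one that makes this quantity constant;
    \<open>c ^ h\<close> then scales the Irwin--Hall profile.\<close>
  have Dc: "\<forall>\<^sub>F N in sequentially. ?T N ^ (h - 1) * p N ^ h = c ^ h"
    using pc eventually_gt_at_top[of 0]
  proof eventually_elim
    case (elim N)
    have "(real N powr (- ((real h - 1) / real h))) ^ h = real N powr (- (real h - 1))"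
      using elim h2 by (simp add: powr_powr flip: powr_realpow)
    also have "\<dots> = real N powr (- real (h - 1))" using h2 by (simp add: of_nat_diff)
    also have "\<dots> = inverse (real N ^ (h - 1))"
      using elim(2) by (simp only: powr_minus) (simp add: powr_realpow)
    finally show ?case using elim by (simp add: power_mult_distrib)
  qed
  then have D: "\<forall>\<^sub>F N in sequentially. ?T N ^ (h - 1) * p N ^ h \<le> c ^ h" by eventually_elim simp
  have L: "real h / 2 > 0" using h2 by simp
  have "conv_prob p ?T (\<lambda>N A. real (low_missing N (nat \<lfloor>real h / 2 * ?T N\<rfloor>) A))
     (integral {0..real h / 2} (\<lambda>x. exp (- (c ^ h * ihpoly h x) / ?F)))"
  proof (rule window_conv_prob[OF p0 N_at_top Tp L D])
    show "continuous_on {0..real h / 2} (\<lambda>x. c ^ h * ihpoly h x)" by (intro continuous_intros continuous_on_ihpoly)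
    fix e :: real assume "e > 0"
    from box_count_uniform[OF N_at_top D L this] Dc
    show "\<forall>\<^sub>F N in sequentially. \<forall>m\<le>nat \<lfloor>real h / 2 * ?T N\<rfloor>.
       \<bar>real (box_count h N (int m)) * p N ^ h - c ^ h * ihpoly h (real m / ?T N)\<bar> \<le> e"
    proof eventually_elim
      case (elim N)
      have eq: "real N ^ (h - 1) * ihpoly h (real m / real N) * p N ^ h = c ^ h * ihpoly h (real m / real N)" for m
        unfolding elim(2)[symmetric] by (simp only: mult_ac)
      show ?case using elim(1) unfolding eq .
    qed
  qed
  also have "integral {0..real h / 2} (\<lambda>x. exp (- (c ^ h * ihpoly h x) / ?F)) = I"
    unfolding I(1) by simp
  also have "(\<lambda>N A. real (low_missing N (nat \<lfloor>real h / 2 * ?T N\<rfloor>) A)) = (\<lambda>N A. real (low_missing N (h * N div 2) A))"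
  proof -
    have "nat \<lfloor>real h / 2 * ?T N\<rfloor> = h * N div 2" for N
    proof -
      have "real h / 2 * real N = real (h * N) / real 2" by simp
      then have "\<lfloor>real h / 2 * real N\<rfloor> = int (h * N div 2)" by (simp only: floor_divide_of_nat_eq)
      then show ?thesis by simp
    qed
    then show ?thesis by simp
  qed
  finally have low: "conv_prob p ?T (\<lambda>N A. real (low_missing N (h * N div 2) A)) I" .
  have both: "conv_prob p ?T (\<lambda>N A. real (low_missing N (h * N div 2) A) + real (low_missing N (h * N div 2) (reflect N A))) (I + I)"
    by (rule conv_prob_add[OF low conv_prob_reflect[OF low]])
  \<comment> \<open>Pays for the middle index that the two halves may share.\<close>
  have one: "conv_prob p ?T (\<lambda>N A. 1) 0"
    by (rule conv_prob_det[OF real_tendsto_divide_at_top[OF tendsto_const N_at_top] N_at_top])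
  have "conv_prob p ?T (\<lambda>N A. real (card (sumdiff_compl s d N A)) - (real (low_missing N (h * N div 2) A) + real (low_missing N (h * N div 2) (reflect N A)))) 0"
    by (rule conv_prob_mono0[OF one]) (use compl_halves[OF refl] in auto)
  from conv_prob_add[OF both this]
  have compl: "conv_prob p ?T (\<lambda>N A. real (card (sumdiff_compl s d N A))) (2 * I)" by simp
  have Tpos: "\<forall>\<^sub>F N in sequentially. ?T N > 0" using eventually_gt_at_top[of 0] by eventually_elim simp
  show "rv_asymp (\<lambda>N. random_subset N (p N)) (\<lambda>N A. real (card (sumdiff_compl s d N A))) (\<lambda>N. (2 * I) * real N)"
    by (rule rv_asymp_conv_prob[OF compl _ Tpos]) (use I in auto)
  \<comment> \<open>There are \<open>h * N + 1\<close> possible values, so the size of the set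
    follows from that of the complement.\<close>
  have "(\<lambda>N. (real h * real N + 1) / real N) \<longlonglongrightarrow> real h" by real_asymp
  from conv_prob_add[OF conv_prob_det[OF this N_at_top] conv_prob_uminus[OF compl]]
  have "conv_prob p ?T (\<lambda>N A. (real h * real N + 1) + - real (card (sumdiff_compl s d N A))) (real h - 2 * I)" by simp
  then have "conv_prob p ?T (\<lambda>N A. real (card (sumdiff_set s d A))) (real h - 2 * I)"
    by (rule conv_prob_cong) (use card_sumdiff_set in auto)
  then show "rv_asymp (\<lambda>N. random_subset N (p N)) (\<lambda>N A. real (card (sumdiff_set s d A))) (\<lambda>N. (real h - 2 * I) * real N)"
    by (rule rv_asymp_conv_prob[OF _ _ Tpos]) (use I in auto)
qed

end

section \<open>The dense regime\<close>

context sumdiff_asymp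
begin

theorem dense_regime:
  assumes o: "(\<lambda>N. real N powr (- ((real h - 1) / real h))) \<in> o(p)"
  shows "rv_asymp (\<lambda>N. random_subset N (p N)) (\<lambda>N A. real (card (sumdiff_compl s d N A)))
          (\<lambda>N. 2 * Gamma (1 / (real h - 1)) * root (h - 1) (fact (h - 1) * fact s * fact d)
                 / ((real h - 1) * p N powr (real h / (real h - 1))))"
proof -
  define n where "n = h - 1"
  have n: "n \<ge> 1" "real n = real h - 1" "h = Suc n" using h2 by (auto simp: n_def)
  let ?F = "fact s * fact d :: real"
  define \<alpha> where "\<alpha> = real h / real n"
  have \<alpha>: "\<alpha> \<ge> 1" "\<alpha> > 0" using n by (auto simp: \<alpha>_def)
  \<comment> \<open>The solution of \<open>T ^ (h - 1) * p ^ h = 1\<close>: at this distance from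
    the edge the mean number of representations is of order 1.\<close>
  define T where "T N = p N powr (- \<alpha>)" for N
  define a where "a = 1 / (fact n * fact s * fact d :: real)"
  have a: "a > 0" by (simp add: a_def)
  define J where "J = Gamma (1 / n) / (n * root n a)"
  have J: "J > 0" unfolding J_def using n a by (intro divide_pos_pos mult_pos_pos Gamma_real_pos) auto
  have pp: "0 < p N" "p N < 1" "0 \<le> p N" for N using p01[of N] by auto
  have Tpos: "T N > 0" for N using pp[of N] by (simp add: T_def)
  have inv: "filterlim (\<lambda>N. inverse (p N)) at_top sequentially"
    by (rule filterlim_inverse_at_top[OF p0]) (use pp in simp)
  have T: "filterlim T at_top sequentially"
  proof (rule filterlim_at_top_mono[OF inv])
    have "inverse (p N) \<le> T N" for N
    proof -
      have "inverse (p N) = p N powr (- 1)" using pp[of N] by (simp add: powr_minus)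
      also have "\<dots> \<le> T N" unfolding T_def using pp[of N] \<alpha> by (intro powr_mono') auto
      finally show ?thesis .
    qed
    then show "\<forall>\<^sub>F N in sequentially. inverse (p N) \<le> T N" by simp
  qed
  have Tbig: "\<forall>\<^sub>F N in sequentially. T N > u" for u using T unfolding filterlim_at_top_dense by blast
  have Tp: "filterlim (\<lambda>N. T N * p N) at_top sequentially"
  proof -
    have "filterlim (\<lambda>x::real. x powr (1 / real n)) at_top at_top" using n by real_asymp
    from filterlim_compose[OF this inv]
    have "filterlim (\<lambda>N. inverse (p N) powr (1 / real n)) at_top sequentially" .
    moreover have "inverse (p N) powr (1 / real n) = T N * p N" for N
    proof -
      have "1 - \<alpha> = - (1 / real n)" using n by (simp add: \<alpha>_def field_simps)
      then have "inverse (p N) powr (1 / real n) = p N powr (1 + - \<alpha>)"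
        using pp[of N] by (simp add: powr_minus inverse_powr)
      also have "\<dots> = T N * p N" using pp[of N] by (subst powr_add) (simp add: T_def)
      finally show ?thesis .
    qed
    ultimately show ?thesis by simp
  qed
  have Tn: "T N ^ (h - 1) * p N ^ h = 1" for N
  proof -
    have "T N ^ n = p N powr (- \<alpha> * real n)" using pp[of N] by (simp add: T_def powr_powr flip: powr_realpow)
    also have "- \<alpha> * real n = - real h" using n by (simp add: \<alpha>_def)
    finally show ?thesis using pp[of N] by (simp add: n_def powr_minus powr_realpow)
  qed
  \<comment> \<open>Denseness keeps the window below \<open>N\<close>: the density there is the pure
    monomial, and the windows at the two edges do not meet.\<close>
  have LTN: "\<forall>\<^sub>F N in sequentially. L * T N < real N" if L: "L > 0" for L
  proof -
    \<comment> \<open>Chosen so that raising to the power \<open>- \<alpha>\<close> gives exactly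
      \<open>2 * L\<close>.\<close>
    define \<epsilon> where "\<epsilon> = (1 / (2 * L)) powr (1 / \<alpha>)"
    have \<epsilon>: "\<epsilon> > 0" using L by (simp add: \<epsilon>_def)
    have "\<forall>\<^sub>F N in sequentially. norm (real N powr (- ((real h - 1) / real h))) \<le> \<epsilon> * norm (p N)"
      using landau_o.smallD[OF o \<epsilon>] by simp
    then show ?thesis using eventually_gt_at_top[of 0]
    proof eventually_elim
      case (elim N)
      have ia: "(real h - 1) / real h = 1 / \<alpha>" using n by (simp add: \<alpha>_def)
      have "real N powr (- (1 / \<alpha>)) \<le> \<epsilon> * p N" using elim(1) pp[of N] unfolding ia by simp
      then have "(\<epsilon> * p N) powr (- \<alpha>) \<le> (real N powr (- (1 / \<alpha>))) powr (- \<alpha>)"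
        using elim(2) \<alpha> by (intro powr_mono2') auto
      also have "\<dots> = real N" using elim(2) \<alpha> by (simp add: powr_powr)
      also have "(\<epsilon> * p N) powr (- \<alpha>) = \<epsilon> powr (- \<alpha>) * T N" using \<epsilon> pp[of N] by (simp add: T_def powr_mult)
      also have "\<epsilon> powr (- \<alpha>) = 2 * L" using L \<alpha> by (simp add: \<epsilon>_def powr_powr powr_minus)
      finally show ?case using mult_pos_pos[OF L Tpos[of N]] by linarith
    qed
  qed
  let ?low = "\<lambda>L N A. real (low_missing N (nat \<lfloor>L * T N\<rfloor>) A)"
  define I where "I L = integral {0..L} (\<lambda>x. exp (- (a * x ^ n)))" for L
  have window: "conv_prob p T (?low L) (I L)" if L: "L > 0" for L
  proof -
    have Tn': "\<forall>\<^sub>F N in sequentially. T N ^ (h - 1) * p N ^ h \<le> 1" using Tn by simp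
    have "conv_prob p T (?low L) (integral {0..L} (\<lambda>x. exp (- (x ^ n / fact n) / ?F)))"
    proof (rule window_conv_prob[OF p0 T Tp L Tn'])
      show "continuous_on {0..L} (\<lambda>x::real. x ^ n / fact n)" by (intro continuous_intros) auto
      fix e :: real assume "e > 0"
      from box_count_uniform[OF T Tn' L this] LTN[OF L] eventually_gt_at_top[of 0]
      show "\<forall>\<^sub>F N in sequentially. \<forall>m\<le>nat \<lfloor>L * T N\<rfloor>. \<bar>real (box_count h N (int m)) * p N ^ h - (real m / T N) ^ n / fact n\<bar> \<le> e"
      proof eventually_elim
        case (elim N)
        show ?case
        proof (intro allI impI)
          fix m assume m: "m \<le> nat \<lfloor>L * T N\<rfloor>"
          have "0 \<le> L * T N" using L Tpos[of N] by simp
          then have "real m \<le> real N" using m elim(2) by linarith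
          then have "ihpoly h (real m / real N) = (real m / real N) ^ n / fact n"
            using elim(3) h2 by (subst ihpoly_small) (auto simp: n_def)
          then have "real N ^ (h - 1) * ihpoly h (real m / real N) * p N ^ h = real m ^ n * p N ^ h / fact n"
            using elim(3) by (simp add: n_def power_divide)
          also have "real m ^ n * p N ^ h = (real m / T N) ^ n"
            using Tn[of N] Tpos[of N] by (simp add: n_def power_divide field_simps)
          finally show "\<bar>real (box_count h N (int m)) * p N ^ h - (real m / T N) ^ n / fact n\<bar> \<le> e"
            using elim(1) m by metis
        qed
      qed
    qed
    also have "(\<lambda>x::real. exp (- (x ^ n / fact n) / ?F)) = (\<lambda>x. exp (- (a * x ^ n)))"
      by (simp add: a_def fun_eq_iff field_simps)
    finally show ?thesis by (simp add: I_def)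
  qed
  obtain \<kappa> C where \<kappa>: "\<kappa> > 0" and C: "C \<ge> 0" and mid: "\<And>L. L \<ge> 1 \<Longrightarrow> \<forall>\<^sub>F N in sequentially.
      subset_expect (p N) {0..int N} (\<lambda>A. real (mid_missing N (nat \<lfloor>L * T N\<rfloor>) A)) \<le> C + exp (- \<kappa> * L) * (1 + T N / \<kappa>)"
    by (rule mid_missing_expectation[OF p0 T Tp]) (use Tn in auto)
  have "conv_prob p T (\<lambda>N A. real (card (sumdiff_compl s d N A))) (2 * J)"
  proof (rule conv_probI)
    fix e \<delta> :: real assume e: "e > 0" and \<delta>: "\<delta> > 0"
    have "(I \<longlongrightarrow> J) at_top" unfolding I_def J_def by (rule stretched_exponential_integral[OF n(1) a])
    then have "\<forall>\<^sub>F L in at_top. dist (I L) J < e / 8" using e by (intro tendstoD) auto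
    \<comment> \<open>\<open>L\<close> is fixed before \<open>N\<close>: the truncated integral must
      be near \<open>J\<close>, and the second bound makes the geometric tail at most
      \<open>\<delta> * e / 32\<close> relative to \<open>T\<close>.\<close>
    then have "\<forall>\<^sub>F L in at_top. dist (I L) J < e / 8 \<and> L \<ge> 1 \<and> L \<ge> 64 / (\<kappa>\<^sup>2 * \<delta> * e)"
      by (intro eventually_conj eventually_ge_at_top)
    then obtain L where L: "dist (I L) J < e / 8" "L \<ge> 1" "L \<ge> 64 / (\<kappa>\<^sup>2 * \<delta> * e)"
      by (auto simp: eventually_at_top_linorder)
    have L0: "L > 0" using L by simp
    have tail: "exp (- \<kappa> * L) * (2 / \<kappa>) \<le> \<delta> * e / 32"
    proof -
      have "exp (- (\<kappa> * L)) \<le> 1 / (\<kappa> * L)" using exp_minus_le[of "\<kappa> * L" 1] \<kappa> L0 by simp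
      then have "exp (- \<kappa> * L) * (2 / \<kappa>) \<le> 1 / (\<kappa> * L) * (2 / \<kappa>)" using \<kappa> by (intro mult_right_mono) auto
      also have "\<dots> = 2 / (\<kappa>\<^sup>2 * L)" by (simp add: power2_eq_square)
      also have "\<dots> \<le> \<delta> * e / 32"
      proof -
        have "64 \<le> L * (\<kappa>\<^sup>2 * \<delta> * e)" using L(3) \<kappa> \<delta> e by (simp add: pos_divide_le_eq)
        then show ?thesis using \<kappa> L0 by (simp add: field_simps)
      qed
      finally show ?thesis .
    qed
    let ?M = "\<lambda>N. nat \<lfloor>L * T N\<rfloor>"
    let ?X = "\<lambda>N A. ?low L N A + ?low L N (reflect N A)"
    let ?mid = "\<lambda>N A. real (mid_missing N (?M N) A) + real (mid_missing N (?M N) (reflect N A))"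
    let ?C = "\<lambda>N A. real (card (sumdiff_compl s d N A))"
    have X: "conv_prob p T ?X (I L + I L)" by (rule conv_prob_add[OF window[OF L0] conv_prob_reflect[OF window[OF L0]]])
    have "e / 4 > 0" "\<delta> / 2 > 0" "2 * L > 0" using e \<delta> L0 by auto
    \<comment> \<open>The bound on the window is used with \<open>2 * L\<close>, which gives
      \<open>2 * M < N\<close> and so separates the two windows.\<close>
    from conv_probD[OF X this(1,2)] mid[OF L(2)] Tbig[of \<kappa>] Tbig[of "32 * C / (\<delta> * e)"] LTN[OF \<open>2 * L > 0\<close>]
    show "\<forall>\<^sub>F N in sequentially. subset_expect (p N) {0..int N} (\<lambda>A. of_bool (\<bar>?C N A - 2 * J * T N\<bar> > e * T N)) \<le> \<delta>"
    proof eventually_elim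
      case (elim N)
      let ?E = "subset_expect (p N) {0..int N}"
      \<comment> \<open>The two ways to fail: the windows deviate by more than \<open>e / 4\<close>,
        or the middle holds at least \<open>e / 2\<close> missing values, in units of
        \<open>T\<close>. The remaining \<open>e / 4\<close> covers the distance from
        \<open>I L\<close> to \<open>J\<close> at both edges.\<close>
      let ?U = "\<lambda>A. of_bool (\<bar>?X N A - (I L + I L) * T N\<bar> > e / 4 * T N) :: real"
      let ?V = "\<lambda>A. of_bool (?mid N A \<ge> e / 2 * T N) :: real"
      have t: "T N > 0" by (rule Tpos)
      have M: "2 * ?M N < h * N"
      proof -
        have "0 \<le> L * T N" using L0 t by simp
        then have "2 * real (?M N) < real N" using elim(5) by linarith
        then have "2 * ?M N < N" by linarith
        also have "N \<le> h * N" using h2 by simp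
        finally show ?thesis .
      qed
      have "?E (\<lambda>A. of_bool (\<bar>?C N A - 2 * J * T N\<bar> > e * T N)) \<le> ?E (\<lambda>A. ?U A + ?V A)"
      proof (intro subset_expect_mono p01')
        fix A
        have "\<bar>?C N A - 2 * J * T N\<bar> \<le> e * T N"
          if u: "\<bar>?X N A - (I L + I L) * T N\<bar> \<le> e / 4 * T N" and v: "?mid N A < e / 2 * T N"
        proof -
          have 1: "\<bar>?C N A - ?X N A\<bar> \<le> e / 2 * T N" using compl_window_mid[OF M, of A] v by linarith
          have "\<bar>(I L + I L) - 2 * J\<bar> \<le> e / 4" using L(1) unfolding dist_real_def by linarith
          then have "\<bar>(I L + I L) - 2 * J\<bar> * T N \<le> e / 4 * T N" using t by (intro mult_right_mono) auto
          then have 2: "\<bar>(I L + I L) * T N - 2 * J * T N\<bar> \<le> e / 4 * T N"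
            using t by (simp add: abs_mult flip: left_diff_distrib)
          have "e * T N = e / 2 * T N + e / 4 * T N + e / 4 * T N" by (simp add: field_simps)
          then show ?thesis using 1 2 u by linarith
        qed
        then show "of_bool (\<bar>?C N A - 2 * J * T N\<bar> > e * T N) \<le> ?U A + ?V A"
          by (cases "\<bar>?X N A - (I L + I L) * T N\<bar> \<le> e / 4 * T N"; cases "?mid N A < e / 2 * T N")
             (simp_all add: not_le not_less)
      qed
      also have "\<dots> = ?E ?U + ?E ?V" by (rule subset_expect_add)
      also have "?E ?V \<le> ?E (?mid N) / (e / 2 * T N)"
        by (rule subset_expect_markov[OF p01']) (use e t in auto)
      also have "?E (?mid N) = 2 * ?E (\<lambda>A. real (mid_missing N (?M N) A))"
        using subset_expect_reflect[of "p N" N "\<lambda>A. real (mid_missing N (?M N) A)"] by (simp add: subset_expect_add)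
      also have "2 * ?E (\<lambda>A. real (mid_missing N (?M N) A)) / (e / 2 * T N) \<le> 2 * (\<delta> * e / 16 * T N) / (e / 2 * T N)"
      proof (intro divide_right_mono mult_left_mono)
        have "1 + T N / \<kappa> \<le> T N * (2 / \<kappa>)" using elim(3) \<kappa> by (simp add: field_simps)
        then have "exp (- \<kappa> * L) * (1 + T N / \<kappa>) \<le> exp (- \<kappa> * L) * (T N * (2 / \<kappa>))" by (intro mult_left_mono) auto
        also have "\<dots> = exp (- \<kappa> * L) * (2 / \<kappa>) * T N" by simp
        also have "\<dots> \<le> \<delta> * e / 32 * T N" using tail t by (intro mult_right_mono) auto
        finally have 1: "exp (- \<kappa> * L) * (1 + T N / \<kappa>) \<le> \<delta> * e / 32 * T N" .
        have 2: "C \<le> \<delta> * e / 32 * T N" using elim(4) \<delta> e by (simp add: field_simps)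
        have "\<delta> * e / 16 * T N = \<delta> * e / 32 * T N + \<delta> * e / 32 * T N" by (simp add: field_simps)
        then show "?E (\<lambda>A. real (mid_missing N (?M N) A)) \<le> \<delta> * e / 16 * T N" using 1 2 elim(2) by linarith
      qed (use e t in auto)
      also have "2 * (\<delta> * e / 16 * T N) / (e / 2 * T N) = \<delta> / 4" using e t by (simp add: field_simps)
      finally show ?case using elim(1) \<delta> by linarith
    qed
  qed
  then show ?thesis
  proof (rule rv_asymp_conv_prob)
    show "0 < 2 * J" using J by simp
    show "\<forall>\<^sub>F N in sequentially. 0 < T N" using Tpos by simp
    have "2 * Gamma (1 / (real h - 1)) * root (h - 1) (fact (h - 1) * fact s * fact d)
                 / ((real h - 1) * p N powr (real h / (real h - 1))) = 2 * J * T N" for N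
    proof -
      have "root n (fact n * fact s * fact d) = 1 / root n a" using n by (simp add: a_def real_root_divide)
      moreover have "p N powr \<alpha> = 1 / T N" using pp[of N] by (simp add: T_def powr_minus_divide)
      ultimately show ?thesis using n(1) Tpos[of N]
        unfolding J_def n(2)[symmetric] n_def[symmetric] \<alpha>_def[symmetric] by simp
    qed
    then show "\<forall>\<^sub>F N in sequentially. 2 * Gamma (1 / (real h - 1)) * root (h - 1) (fact (h - 1) * fact s * fact d)
                 / ((real h - 1) * p N powr (real h / (real h - 1))) = 2 * J * T N" by simp
  qed
qed

end

theorem theorem1p2:
  fixes p :: "nat \<Rightarrow> real" and s d h :: nat
  assumes p_range: "\<And>N. 0 < p N \<and> p N < 1"
    and p_lim: "p \<longlonglongrightarrow> 0"
    and Np_lim: "filterlim (\<lambda>N. real N * p N) at_top sequentially"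
    and h_ge: "h \<ge> 2"
    and sd: "s + d = h"
  shows
    "(p \<in> o(\<lambda>N. real N powr (- ((real h - 1) / real h))) \<longrightarrow>
        rv_asymp (\<lambda>N. random_subset N (p N)) (\<lambda>N A. real (card (sumdiff_set s d A)))
          (\<lambda>N. (real N * p N) ^ h / (fact s * fact d)))
   \<and> (\<forall>c>0. (\<forall>\<^sub>F N in sequentially. p N = c * real N powr (- ((real h - 1) / real h))) \<longrightarrow>
        rv_asymp (\<lambda>N. random_subset N (p N)) (\<lambda>N A. real (card (sumdiff_set s d A)))
          (\<lambda>N. (real h - 2 * integral {0..real h / 2}
                   (\<lambda>x. exp (- (c ^ h / (fact s * fact d)) * irwin_hall h x))) * real N)
      \<and> rv_asymp (\<lambda>N. random_subset N (p N)) (\<lambda>N A. real (card (sumdiff_compl s d N A)))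
          (\<lambda>N. (2 * integral {0..real h / 2}
                   (\<lambda>x. exp (- (c ^ h / (fact s * fact d)) * irwin_hall h x))) * real N))
   \<and> ((\<lambda>N. real N powr (- ((real h - 1) / real h))) \<in> o(p) \<longrightarrow>
        rv_asymp (\<lambda>N. random_subset N (p N)) (\<lambda>N A. real (card (sumdiff_compl s d N A)))
          (\<lambda>N. 2 * Gamma (1 / (real h - 1)) * root (h - 1) (fact (h - 1) * fact s * fact d)
                 / ((real h - 1) * p N powr (real h / (real h - 1)))))"
proof -
  interpret sumdiff_asymp s d h p
    by unfold_locales (use assms in auto)
  show ?thesis using sparse_regime critical_regime dense_regime by blast
qed

end
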